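(* Let $k$ be an algebraically closed field of characteristic $p>2$ and $n\ge1$. The following compatibly split subvarieties $Y$ of $U_{\langle x,y^n\rangle}\subseteq\mathrm{Hilb}^n(\mathbb{A}^2_k)$ (labels as in the context) are Cohen–Macaulay: 1. $Y = (s,u,0,+0)$ with $u\geq 0$, $Y = (s,u,0,+1)$ with $u\geq 2$, and $Y = (n-1,0,0,+1)$; 2. $Y = (0,0,n,+0)$ and $Y = (0,0,n-1,+1)$; 3. $Y = (0,u,n-u,+0)$ with $u\geq 1$, and $Y = (0,u,n-u,+1)$ with $u\geq 2$; 4. $Y = (1,u,n-u-1,+0)$ with $u\geq 0$, $Y = (1,u,n-u-1,+1)$ with $u\geq 2$, and $Y = (1,0,n-2,+1)$.
   Context: Points of $\mathrm{Hilb}^n(\mathbb{A}^2_k)$ are colength-$n$ ideals of $k[x,y]$. $U_{\langle x,y^n\rangle}\subseteq\mathrm{Hilb}^n(\mathbb{A}^2_k)$ is the open affine set of ideals $I$ with $1,y,\dots,y^{n-1}$ a $k$-basis of $k[x,y]/I$ (isomorphic to $\mathbb{A}^{2n}_k$). Subvarieties are closed, reduced and irreducible. Labels: for integers $s,u,t\ge0$, $Y=(s,u,t,+i)$ means $Y=Y'\cap U_{\langle x,y^n\rangle}$ (reduced), where $Y'$ is the closure of the image of $$\mathrm{Hilb}^s(\{x=0\}\setminus\{(0,0)\})\times\mathrm{Hilb}^t(\mathbb{A}^2_k\setminus\{xy=0\})\times W\to\mathrm{Hilb}^n(\mathbb{A}^2_k),\ (I_1,I_2,I_3)\mapsto I_1\cap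 I_2\cap I_3,$$ with: for $+0$ ($s+u+t=n$), no factor $W$ if $u=0$ and $W=\{\langle x,y^u\rangle\}$ if $u\ge1$; for $+1$, $W=\mathrm{Hilb}^1(\{y=0\}\setminus\{(0,0)\})$ if $u=0$ ($s+t+1=n$), and $W=\{\langle y^u,xy,x^2,ay^{u-1}+bx\rangle:[a,b]\in\mathbb{P}^1_k\}\subseteq\mathrm{Hilb}^u(\mathbb{A}^2_k)$ if $u\ge2$ ($s+u+t=n$). These are compatibly split for the Frobenius splitting of $U_{\langle x,y^n\rangle}$ restricted from the splitting of $\mathrm{Hilb}^n(\mathbb{A}^2_k)$ induced by the standard splitting of $\mathbb{A}^2_k$; the splitting is not otherwise involved in the conclusion. *)

theory Defs
  imports
    "HOL-Algebra.Algebraic_Closure_Type"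
    "HOL-Analysis.Abstract_Topology"
    "HOL-Library.FuncSet"
    "HOL-Library.Extended_Nat"
begin

section \<open>Cohen--Macaulay rings\<close>

definition krull_dim :: "('a, 'b) ring_scheme \<Rightarrow> enat" where
  "krull_dim R = Sup {enat n |n. \<exists>P. (\<forall>i\<le>n. primeideal (P i) R) \<and> (\<forall>i<n. P i \<subset> P (Suc i))}"

text \<open>The condition at index \<open>i\<close> says that \<open>xs ! i\<close> is not a zero divisor on
  \<open>R / (xs ! 0, \<dots>, xs ! (i - 1))\<close>.\<close>

definition regular_sequence :: "('a, 'b) ring_scheme \<Rightarrow> 'a list \<Rightarrow> bool" where
  "regular_sequence R xs \<longleftrightarrow>
     set xs \<subseteq> carrier R \<and>
     (\<forall>i<length xs. \<forall>a\<in>carrier R.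
        xs ! i \<otimes>\<^bsub>R\<^esub> a \<in> genideal R (set (take i xs)) \<longrightarrow> a \<in> genideal R (set (take i xs))) \<and>
     genideal R (set xs) \<noteq> carrier R"

definition depth :: "('a, 'b) ring_scheme \<Rightarrow> 'a set \<Rightarrow> enat" where
  "depth R M = Sup {enat (length xs) |xs. regular_sequence R xs \<and> set xs \<subseteq> M}"

definition cohen_macaulay_local :: "('a, 'b) ring_scheme \<Rightarrow> bool" where
  "cohen_macaulay_local R \<longleftrightarrow>
     cring R \<and> noetherian_ring R \<and>
     (\<exists>M. {M'. maximalideal M' R} = {M} \<and> depth R M = krull_dim R)"

text \<open>The localization of \<open>R\<close> at a prime ideal \<open>P\<close>: the pair \<open>(a, s)\<close> stands for \<open>a / s\<close>.\<close>

definition fraction_rel ::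
  "('a, 'b) ring_scheme \<Rightarrow> 'a set \<Rightarrow> (('a \<times> 'a) \<times> ('a \<times> 'a)) set" where
  "fraction_rel R P =
     {((a, s), (b, t)) |a s b t.
        a \<in> carrier R \<and> s \<in> carrier R - P \<and> b \<in> carrier R \<and> t \<in> carrier R - P \<and>
        (\<exists>u\<in>carrier R - P. u \<otimes>\<^bsub>R\<^esub> (a \<otimes>\<^bsub>R\<^esub> t) = u \<otimes>\<^bsub>R\<^esub> (b \<otimes>\<^bsub>R\<^esub> s))}"

definition localization_at :: "('a, 'b) ring_scheme \<Rightarrow> 'a set \<Rightarrow> ('a \<times> 'a) set ring" where
  "localization_at R P = (let r = fraction_rel R P in
     \<lparr>carrier = (carrier R \<times> (carrier R - P)) // r,
      monoid.mult = (\<lambda>F G. \<Union>(a, s)\<in>F. \<Union>(b, t)\<in>G. r `` {(a \<otimes>\<^bsub>R\<^esub> b, s \<otimes>\<^bsub>R\<^esub> t)}),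
      one = r `` {(\<one>\<^bsub>R\<^esub>, \<one>\<^bsub>R\<^esub>)},
      ring.zero = r `` {(\<zero>\<^bsub>R\<^esub>, \<one>\<^bsub>R\<^esub>)},
      add = (\<lambda>F G. \<Union>(a, s)\<in>F. \<Union>(b, t)\<in>G.
               r `` {(a \<otimes>\<^bsub>R\<^esub> t \<oplus>\<^bsub>R\<^esub> b \<otimes>\<^bsub>R\<^esub> s, s \<otimes>\<^bsub>R\<^esub> t)})\<rparr>)"

definition cohen_macaulay_ring :: "('a, 'b) ring_scheme \<Rightarrow> bool" where
  "cohen_macaulay_ring R \<longleftrightarrow>
     cring R \<and> noetherian_ring R \<and>
     (\<forall>P. primeideal P R \<longrightarrow> cohen_macaulay_local (localization_at R P))"


section \<open>Points of the Hilbert scheme of the affine plane\<close>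

text \<open>The ring \<open>k[x,y]\<close> is represented as \<open>k[x][y]\<close>, that is, by the type \<open>'a poly poly\<close>: the
  inner variable is \<open>x\<close> and the outer variable is \<open>y\<close>. The scalar \<open>c\<close> of \<open>k\<close> acts as
  \<open>smult [:c:]\<close>.\<close>

abbreviation kxy :: "'a::comm_ring_1 poly poly ring" where
  "kxy \<equiv> ring_of_type_algebra"

definition varx :: "'a::comm_ring_1 poly poly" where
  "varx = [:[:0, 1:]:]"

definition vary :: "'a::comm_ring_1 poly poly" where
  "vary = [:0, 1:]"

definition eval2 :: "'a::comm_ring_1 poly poly \<Rightarrow> 'a \<times> 'a \<Rightarrow> 'a" where
  "eval2 p = (\<lambda>(a, b). poly (poly p [:b:]) a)"

definition zero_locus :: "'a::comm_ring_1 poly poly set \<Rightarrow> ('a \<times> 'a) set" where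
  "zero_locus I = {z. \<forall>p\<in>I. eval2 p z = 0}"

text \<open>\<open>rep_mod I B p c\<close>: modulo \<open>I\<close>, the polynomial \<open>p\<close> is the linear combination of \<open>B\<close> with
  coefficients \<open>c\<close>. \<open>basis_mod I B\<close>: the elements of \<open>B\<close> have pairwise different classes in
  \<open>k[x,y] / I\<close>, and these classes form a basis of that vector space.\<close>

definition rep_mod ::
  "'a::field poly poly set \<Rightarrow> 'a poly poly set \<Rightarrow> 'a poly poly \<Rightarrow> ('a poly poly \<Rightarrow> 'a) \<Rightarrow> bool" where
  "rep_mod I B p c \<longleftrightarrow> c \<in> extensional B \<and> p - (\<Sum>b\<in>B. smult [:c b:] b) \<in> I"

definition basis_mod :: "'a::field poly poly set \<Rightarrow> 'a poly poly set \<Rightarrow> bool" where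
  "basis_mod I B \<longleftrightarrow> finite B \<and> (\<forall>p. \<exists>!c. rep_mod I B p c)"

definition coord :: "'a::field poly poly set \<Rightarrow> 'a poly poly \<Rightarrow> 'a poly poly \<Rightarrow>
    'a poly poly set \<Rightarrow> 'a" where
  "coord B p b I = (THE c. rep_mod I B p c) b"

text \<open>The closed points of \<open>Hilb\<^sup>n\<close>: the ideals of colength \<open>n\<close>.\<close>

definition hilb :: "nat \<Rightarrow> 'a::field poly poly set set" where
  "hilb n = {I. ideal I kxy \<and> (\<exists>B. card B = n \<and> basis_mod I B)}"

text \<open>The points of \<open>Hilb\<^sup>n (V(J) - D)\<close>, for a set \<open>J\<close> of equations and a closed set \<open>D\<close>.\<close>

definition hilb_sub ::
  "nat \<Rightarrow> 'a::field poly poly set \<Rightarrow> ('a \<times> 'a) set \<Rightarrow> 'a poly poly set set" where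
  "hilb_sub n J D = {I \<in> hilb n. J \<subseteq> I \<and> zero_locus I \<inter> D = {}}"


section \<open>Charts, Zariski topology, and coordinate rings\<close>

text \<open>For a finite set \<open>B\<close> with \<open>n\<close> elements, the ideals \<open>I\<close> such that \<open>B\<close> is a basis of
  \<open>k[x,y] / I\<close> form an affine open subset of \<open>Hilb\<^sup>n\<close> (the trace of a standard chart of a
  Grassmannian). Its coordinate ring is generated as a \<open>k\<close>-algebra by the functions
  sending \<open>I\<close> to a coordinate, with respect to \<open>B\<close>, of the class of a fixed polynomial \<open>p\<close>.\<close>

definition chart :: "'a::field poly poly set \<Rightarrow> 'a poly poly set set" where
  "chart B = {I. ideal I kxy \<and> basis_mod I B}"

inductive_set regular_functions :: "'a::field poly poly set \<Rightarrow> ('a poly poly set \<Rightarrow> 'a) set"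
  for B :: "'a poly poly set" where
  const: "(\<lambda>I. c) \<in> regular_functions B"
| coord: "b \<in> B \<Longrightarrow> coord B p b \<in> regular_functions B"
| add: "f \<in> regular_functions B \<Longrightarrow> g \<in> regular_functions B \<Longrightarrow>
    (\<lambda>I. f I + g I) \<in> regular_functions B"
| mult: "f \<in> regular_functions B \<Longrightarrow> g \<in> regular_functions B \<Longrightarrow>
    (\<lambda>I. f I * g I) \<in> regular_functions B"

text \<open>The Zariski topology on the closed points of \<open>Hilb\<^sup>n\<close>: these charts are an affine open
  cover, so their principal open subsets form a basis.\<close>

definition hilb_zariski :: "nat \<Rightarrow> 'a::field poly poly set topology" where
  "hilb_zariski n = topology_generated_by
     {{I \<in> chart B. f I \<noteq> 0} |B f. finite B \<and> card B = n \<and> f \<in> regular_functions B}"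

text \<open>The coordinate ring of a closed subset \<open>Y\<close>, with reduced structure, of the affine variety
  \<open>chart B\<close>.\<close>

definition coordinate_ring ::
  "'a::field poly poly set \<Rightarrow> 'a poly poly set set \<Rightarrow> ('a poly poly set \<Rightarrow> 'a) ring" where
  "coordinate_ring B Y =
     \<lparr>carrier = (\<lambda>f. restrict f Y) ` regular_functions B,
      monoid.mult = (\<lambda>f g. \<lambda>I\<in>Y. f I * g I),
      one = (\<lambda>I\<in>Y. 1),
      ring.zero = (\<lambda>I\<in>Y. 0),
      add = (\<lambda>f g. \<lambda>I\<in>Y. f I + g I)\<rparr>"


section \<open>The subvarieties \<open>(s, u, t, +i)\<close> of \<open>U\<close>\<close>

definition basis_U :: "nat \<Rightarrow> 'a::field poly poly set" where
  "basis_U n = {vary ^ j |j. j < n}"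

definition chart_U :: "nat \<Rightarrow> 'a::field poly poly set set" where
  "chart_U n = chart (basis_U n)"

datatype plus_label = Plus0 | Plus1

text \<open>Where the product has no factor \<open>W\<close>, \<open>W\<close> is taken to be the single point \<open>k[x,y]\<close> of
  \<open>Hilb\<^sup>0\<close>, which does not change the intersection. The label \<open>+1\<close> with \<open>u = 1\<close> does not
  occur.\<close>

fun factor_W :: "nat \<Rightarrow> plus_label \<Rightarrow> 'a::field poly poly set set" where
  "factor_W u Plus0 = (if u = 0 then {UNIV} else {genideal kxy {varx, vary ^ u}})"
| "factor_W u Plus1 =
    (if u = 0 then hilb_sub 1 {vary} {(0, 0)}
     else {genideal kxy {vary ^ u, varx * vary, varx ^ 2,
             smult [:a:] (vary ^ (u - 1)) + smult [:b:] varx} |a b. (a, b) \<noteq> (0, 0)})"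

text \<open>The length \<open>n\<close> is \<open>s + u + t\<close>, except for the label \<open>+1\<close> with \<open>u = 0\<close>, where it is
  \<open>s + t + 1\<close>.\<close>

definition subvariety ::
  "nat \<Rightarrow> nat \<Rightarrow> nat \<Rightarrow> nat \<Rightarrow> plus_label \<Rightarrow> 'a::field poly poly set set" where
  "subvariety n s u t i =
     (hilb_zariski n closure_of
        {I1 \<inter> I2 \<inter> I3 |I1 I2 I3.
           I1 \<in> hilb_sub s {varx} {(0, 0)} \<and>
           I2 \<in> hilb_sub t {} {(a, b). a * b = 0} \<and>
           I3 \<in> factor_W u i})
     \<inter> chart_U n"

definition cohen_macaulay :: "nat \<Rightarrow> 'a::field poly poly set set \<Rightarrow> bool" where
  "cohen_macaulay n Y \<longleftrightarrow> cohen_macaulay_ring (coordinate_ring (basis_U n) Y)"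

end

theory Submission
  imports
    Defs
    "HOL-Library.Function_Algebras"
    "Jordan_Normal_Form.Char_Poly"
begin

text \<open>A point of \<open>U\<close> is an ideal \<open>(f(y), x - g(y))\<close> with \<open>f\<close> monic of degree \<open>n\<close> and
  \<open>deg g < n\<close>. A point in the image of a label satisfies \<open>y\<^sup>d h | f\<close> and \<open>y\<^sup>w h | g\<close> for some
  \<open>h\<close> of degree \<open>s\<close>, where \<open>d\<close> and \<open>w\<close> depend only on \<open>u\<close> and \<open>i\<close>. If \<open>s \<le> 1\<close> or \<open>t = 0\<close> this
  condition is closed, and every pair satisfying it lies on a line whose general member comes from
  the label; so it describes \<open>Y\<close>. For \<open>s = 0\<close> or \<open>t = 0\<close> the coordinate ring is a polynomial ring.
  For \<open>s = 1\<close> the pair \<open>(f / y\<^sup>d, g / y\<^sup>w)\<close> has a common root, and the coordinate ring is free with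
  basis \<open>1, g\<^sub>0, \<dots>, g\<^sub>0\<^bsup>m-1\<^esup>\<close> over the polynomial ring \<open>A\<close> in all coefficients except the constant
  coefficient \<open>g\<^sub>0\<close> of \<open>g / y\<^sup>w\<close>: the resultant is monic in \<open>g\<^sub>0\<close> of degree \<open>m = deg f - d\<close>.

  An algebra \<open>C\<close> that is finite and free over a polynomial ring \<open>A\<close> in this way is Cohen--Macaulay:
  for a prime \<open>Q\<close> of \<open>C\<close> let \<open>S\<close> be a largest set of variables that is algebraically independent
  modulo \<open>Q\<close>. Chains of primes below \<open>Q\<close> have length at most the number of variables outside
  \<open>S\<close>, and each of these variables contributes a polynomial in \<open>Q\<close> over \<open>k[S]\<close> whose leading
  coefficient is not in \<open>Q\<close>; together they form a regular sequence in the localization.\<close>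

section \<open>Regular sequences and localization\<close>

text \<open>The closure defining \<open>Y\<close> is taken in the whole Hilbert scheme, whose
  topology is generated by charts for arbitrary bases \<open>B\<close>, so a line in
  \<open>U\<close> has to be tested against open sets of foreign charts. By Cramer's rule a regular
  function of such a chart becomes, along the line, a polynomial in the parameter divided by a power
  of a determinant; hence an open set that contains one point of the line contains all but finitely
  many. Conditions such as "no common root" are written as nonvanishing determinants for the same
  reason.

  The resultant for \<open>s = 1\<close> is monic because it is the characteristic polynomial of
  minus the multiplication by \<open>g / y^w\<close> without its constant term on
  \<open>k[y] / (f / y^d)\<close>. No relation of smaller degree exists, because generically this
  polynomial has \<open>m\<close> different roots, each of them the value of the constant
  coefficient at a point of \<open>Y\<close> with the same remaining coordinates.

  Leading coefficients with respect to a variable \<open>v\<close> of \<open>A\<close> make sense in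
  \<open>C\<close> because \<open>C\<close> is the direct sum of the \<open>M v^i\<close> for a
  module \<open>M\<close> over the polynomial ring in the other variables, although \<open>M\<close>
  need not be a subring.\<close>

lemma (in cring) exists_prime_disjoint:
  assumes J: "ideal J R" and S: "S \<subseteq> carrier R" "\<one> \<in> S"
    and S_mult: "\<And>s t. s \<in> S \<Longrightarrow> t \<in> S \<Longrightarrow> s \<otimes> t \<in> S" and disj: "J \<inter> S = {}"
  obtains Q where "primeideal Q R" "J \<subseteq> Q" "Q \<inter> S = {}"
proof -
  define F where "F = {I. ideal I R \<and> J \<subseteq> I \<and> I \<inter> S = {}}"
  have "\<Union>C \<in> F" if C: "C \<noteq> {}" "subset.chain F C" for C
  proof -
    have "subset.chain {I. ideal I R} C"
      using C(2) by (auto simp: pred_on.chain_def F_def)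
    then have "ideal (\<Union>C) R"
      using chain_Union_is_ideal[of C] C(1) by simp
    moreover have "C \<subseteq> F"
      using C(2) by (simp add: pred_on.chain_def)
    ultimately show ?thesis
      using C(1) unfolding F_def by blast
  qed
  moreover have "F \<noteq> {}"
    using J disj unfolding F_def by blast
  ultimately obtain Q where Q: "Q \<in> F" and max: "\<And>I. I \<in> F \<Longrightarrow> Q \<subseteq> I \<Longrightarrow> I = Q"
    using subset_Zorn_nonempty[of F] by blast
  have idQ: "ideal Q R" and JQ: "J \<subseteq> Q" and QS: "Q \<inter> S = {}"
    using Q unfolding F_def by auto
  interpret Q: ideal Q R by (rule idQ)
  \<comment> \<open>By maximality of \<open>Q\<close>, enlarging it by any \<open>a\<close> outside
    makes it meet \<open>S\<close>. If \<open>a\<close> and \<open>b\<close> are both outside but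
    their product is inside, the product of the two elements found in \<open>S\<close> lies in
    \<open>Q\<close>.\<close>
  have ext: "\<exists>q r. q \<in> Q \<and> r \<in> carrier R \<and> q \<oplus> r \<otimes> a \<in> S"
    if a: "a \<in> carrier R" "a \<notin> Q" for a
  proof -
    have ida: "ideal (Q <+>\<^bsub>R\<^esub> PIdl a) R"
      using add_ideals[OF idQ cgenideal_ideal[OF a(1)]] .
    have sub: "Q \<subseteq> Q <+>\<^bsub>R\<^esub> PIdl a"
    proof
      fix q assume "q \<in> Q"
      moreover have "q = q \<oplus> \<zero>" using \<open>q \<in> Q\<close> Q.Icarr by simp
      moreover have "\<zero> \<in> PIdl a"
        using cgenideal_ideal[OF a(1)] by (simp add: additive_subgroup.zero_closed ideal.axioms(1))
      ultimately show "q \<in> Q <+>\<^bsub>R\<^esub> PIdl a" unfolding set_add_def' by blast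
    qed
    have "a \<in> Q <+>\<^bsub>R\<^esub> PIdl a"
    proof -
      have "a = \<zero> \<oplus> a" using a by simp
      moreover have "\<zero> \<in> Q" "a \<in> PIdl a" using Q.zero_closed cgenideal_self[OF a(1)] by auto
      ultimately show ?thesis unfolding set_add_def' by blast
    qed
    then have "Q <+>\<^bsub>R\<^esub> PIdl a \<noteq> Q" using a(2) by blast
    then have "Q <+>\<^bsub>R\<^esub> PIdl a \<notin> F" using max sub by blast
    then obtain z where "z \<in> Q <+>\<^bsub>R\<^esub> PIdl a" "z \<in> S"
      using ida sub JQ unfolding F_def by blast
    then show ?thesis unfolding set_add_def' cgenideal_def by auto
  qed
  have "primeideal Q R"
  proof (rule primeidealI[OF idQ is_cring])
    show "carrier R \<noteq> Q" using QS S by blast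
    fix a b assume a: "a \<in> carrier R" and b: "b \<in> carrier R" and ab: "a \<otimes> b \<in> Q"
    show "a \<in> Q \<or> b \<in> Q"
    proof (rule ccontr)
      assume "\<not> (a \<in> Q \<or> b \<in> Q)"
      then obtain q r q' r' where q: "q \<in> Q" "r \<in> carrier R" "q \<oplus> r \<otimes> a \<in> S"
        and q': "q' \<in> Q" "r' \<in> carrier R" "q' \<oplus> r' \<otimes> b \<in> S"
        using ext a b by meson
      have "(q \<oplus> r \<otimes> a) \<otimes> (q' \<oplus> r' \<otimes> b) =
          q \<otimes> (q' \<oplus> r' \<otimes> b) \<oplus> ((r \<otimes> a) \<otimes> q' \<oplus> (r \<otimes> r') \<otimes> (a \<otimes> b))"
        using q(1,2) q'(1,2) a b Q.Icarr by (simp add: l_distr r_distr a_assoc m_ac)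
      also have "\<dots> \<in> Q"
        using Q.I_r_closed[OF q(1), of "q' \<oplus> r' \<otimes> b"] Q.I_l_closed[OF q'(1), of "r \<otimes> a"]
            Q.I_l_closed[OF ab, of "r \<otimes> r'"] q(2) q'(1,2) a b Q.Icarr
        by (intro Q.a_closed) auto
      finally show False using S_mult[OF q(3) q'(3)] QS by blast
    qed
  qed
  then show ?thesis using JQ QS that by blast
qed

text \<open>The products of a power of \<open>x\<close> with an element outside \<open>Q\<close>
  form a multiplicative set. It misses \<open>J\<close>, because powers of \<open>x\<close> can be
  cancelled modulo \<open>J\<close> and \<open>J\<close> lies in \<open>Q\<close>; a prime over
  \<open>J\<close> that misses the set has both required properties.\<close>

lemma (in cring) prime_below_avoiding_nonzerodivisor:
  assumes Q: "primeideal Q R" and J: "ideal J R" "J \<subseteq> Q" and x: "x \<in> carrier R"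
    and nzd: "\<And>a. a \<in> carrier R \<Longrightarrow> x \<otimes> a \<in> J \<Longrightarrow> a \<in> J"
  obtains Q' where "primeideal Q' R" "J \<subseteq> Q'" "Q' \<subseteq> Q" "x \<notin> Q'"
proof -
  interpret Q: primeideal Q R by (rule Q)
  define S where "S = {x [^] (n::nat) \<otimes> s |n s. s \<in> carrier R - Q}"
  have one: "\<one> \<in> carrier R - Q" using Q.I_notcarr Q.one_imp_carrier by auto
  have pow: "a \<in> J" if "a \<in> carrier R" "x [^] (n::nat) \<otimes> a \<in> J" for n a
    using that
  proof (induction n)
    case (Suc n)
    have "x \<otimes> (x [^] n \<otimes> a) \<in> J"
      using Suc.prems x by (simp add: m_ac)
    then show ?case using nzd[of "x [^] n \<otimes> a"] Suc x by simp
  qed simp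
  have "\<one> = x [^] (0::nat) \<otimes> \<one>" by simp
  then have S1: "\<one> \<in> S" unfolding S_def using one by blast
  have S2: "s \<otimes> t \<in> S" if st: "s \<in> S" "t \<in> S" for s t
  proof -
    obtain n a m b where "s = x [^] (n::nat) \<otimes> a" "t = x [^] (m::nat) \<otimes> b"
      and ab: "a \<in> carrier R - Q" "b \<in> carrier R - Q"
      using st unfolding S_def by blast
    then have "s \<otimes> t = x [^] (n + m) \<otimes> (a \<otimes> b)"
      using x by (simp add: nat_pow_mult[symmetric] m_ac)
    moreover have "a \<otimes> b \<in> carrier R - Q"
      using ab Q.I_prime by auto
    ultimately show ?thesis unfolding S_def by blast
  qed
  have S3: "S \<subseteq> carrier R" unfolding S_def using x by auto
  have S4: "J \<inter> S = {}" unfolding S_def using pow J(2) by blast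
  obtain Q' where Q': "primeideal Q' R" "J \<subseteq> Q'" "Q' \<inter> S = {}"
    using exists_prime_disjoint[OF J(1) S3 S1 S2 S4] by metis
  interpret Q': primeideal Q' R by (rule Q'(1))
  have "Q' \<subseteq> Q"
  proof
    fix a assume a: "a \<in> Q'"
    then have "a = x [^] (0::nat) \<otimes> a" using Q'.Icarr by simp
    then have "a \<notin> Q \<Longrightarrow> a \<in> S" unfolding S_def using a Q'.Icarr by blast
    then show "a \<in> Q" using a Q'(3) by blast
  qed
  moreover have "x \<in> S"
  proof -
    have "x = x [^] (1::nat) \<otimes> \<one>" using x by simp
    then show ?thesis unfolding S_def using one by blast
  qed
  ultimately show ?thesis using that[of Q'] Q' by blast
qed

text \<open>Built downwards from \<open>Q\<close>: when the last element of the sequence is given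
  up, it lies in the current lowest prime and is a nonzerodivisor modulo its predecessors, so a
  strictly smaller prime over the predecessors avoids it. This is the inequality "depth at most
  dimension".\<close>

lemma (in cring) regular_sequence_prime_chain:
  assumes reg: "regular_sequence R xs" and Q: "primeideal Q R" "set xs \<subseteq> Q" and "k \<le> length xs"
  shows "\<exists>C. (\<forall>i\<le>k. primeideal (C i) R) \<and> (\<forall>i<k. C i \<subset> C (Suc i)) \<and>
    Idl (set (take (length xs - k) xs)) \<subseteq> C 0"
  using \<open>k \<le> length xs\<close>
proof (induction k)
  case 0
  have "Idl (set xs) \<subseteq> Q"
    using Q by (simp add: genideal_minimal primeideal_def)
  then show ?case using Q(1) by (intro exI[of _ "\<lambda>_. Q"]) simp
next
  case (Suc k)
  then obtain C where C: "\<And>i. i \<le> k \<Longrightarrow> primeideal (C i) R" "\<And>i. i < k \<Longrightarrow> C i \<subset> C (Suc i)"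
    "Idl (set (take (length xs - k) xs)) \<subseteq> C 0" by auto
  define j where "j = length xs - Suc k"
  have j: "j < length xs" "length xs - k = Suc j" using Suc.prems by (auto simp: j_def)
  have carr: "set xs \<subseteq> carrier R" using reg by (simp add: regular_sequence_def)
  have carr': "set (take i xs) \<subseteq> carrier R" for i using carr set_take_subset[of i xs] by blast
  have x: "xs ! j \<in> carrier R" using carr j by auto
  have sub: "set (take (Suc j) xs) \<subseteq> C 0"
    using C(3) genideal_self[OF carr'] unfolding j by blast
  have sub': "Idl (set (take j xs)) \<subseteq> C 0"
    using sub C(1)[of 0] set_take_subset_set_take[of j "Suc j" xs]
    by (intro genideal_minimal) (auto simp: primeideal_def)
  obtain Q' where Q': "primeideal Q' R" "Idl (set (take j xs)) \<subseteq> Q'" "Q' \<subseteq> C 0" "xs ! j \<notin> Q'"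
    using prime_below_avoiding_nonzerodivisor[OF C(1)[of 0] genideal_ideal[OF carr'] sub' x]
      reg j(1) unfolding regular_sequence_def by blast
  have "xs ! j \<in> C 0" using sub j(1) by (auto simp: take_Suc_conv_app_nth)
  then have "Q' \<subset> C 0" using Q'(3,4) by blast
  then show ?case
    using C Q'(1,2)
    by (intro exI[of _ "case_nat Q' C"]) (auto simp: j_def split: nat.splits)
qed

lemma (in cring) regular_sequence_length_le_krull_dim:
  assumes "regular_sequence R xs" and "primeideal Q R" "set xs \<subseteq> Q"
  shows "enat (length xs) \<le> krull_dim R"
  using regular_sequence_prime_chain[OF assms, of "length xs"] unfolding krull_dim_def
  by (intro Sup_upper) auto

section \<open>Localization at a prime ideal\<close>

locale prime_localization = cring +
  fixes P
  assumes prime: "primeideal P R"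
begin

sublocale P: primeideal P R by (rule prime)

definition frac :: "'a \<Rightarrow> 'a \<Rightarrow> ('a \<times> 'a) set" where
  "frac a s = fraction_rel R P `` {(a, s)}"

abbreviation L where "L \<equiv> localization_at R P"

lemma one_denom: "\<one> \<in> carrier R - P"
  using P.I_notcarr P.one_imp_carrier by auto

lemma denom_mult: "s \<in> carrier R - P \<Longrightarrow> t \<in> carrier R - P \<Longrightarrow> s \<otimes> t \<in> carrier R - P"
  using P.I_prime by auto

lemma equiv_fraction_rel: "equiv (carrier R \<times> (carrier R - P)) (fraction_rel R P)"
proof (rule equivI)
  show "fraction_rel R P \<subseteq> (carrier R \<times> (carrier R - P)) \<times> (carrier R \<times> (carrier R - P))"
    unfolding fraction_rel_def by auto
  show "refl_on (carrier R \<times> (carrier R - P)) (fraction_rel R P)"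
    unfolding refl_on_def fraction_rel_def using one_denom by auto
  show "sym (fraction_rel R P)"
    unfolding sym_def fraction_rel_def by simp metis
  show "trans (fraction_rel R P)"
  proof (rule transI)
    fix x y z assume xy: "(x, y) \<in> fraction_rel R P" and yz: "(y, z) \<in> fraction_rel R P"
    obtain a s b t u where 1: "x = (a, s)" "y = (b, t)" "a \<in> carrier R" "s \<in> carrier R - P"
      "b \<in> carrier R" "t \<in> carrier R - P" "u \<in> carrier R - P" "u \<otimes> (a \<otimes> t) = u \<otimes> (b \<otimes> s)"
      using xy unfolding fraction_rel_def by blast
    obtain c w v where 2: "z = (c, w)" "c \<in> carrier R" "w \<in> carrier R - P"
      "v \<in> carrier R - P" "v \<otimes> (b \<otimes> w) = v \<otimes> (c \<otimes> t)"
      using yz 1(2) unfolding fraction_rel_def by blast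
    \<comment> \<open>The common multiplier contains the middle denominator \<open>t\<close> as
      well, since \<open>t\<close> may be a zero divisor and cannot be cancelled.\<close>
    have "(u \<otimes> v \<otimes> t) \<otimes> (a \<otimes> w) = v \<otimes> w \<otimes> (u \<otimes> (a \<otimes> t))"
      using 1(1-7) 2(1-4) by (simp add: m_ac)
    also have "\<dots> = u \<otimes> s \<otimes> (v \<otimes> (b \<otimes> w))" unfolding 1(8) using 1(1-7) 2(1-4) by (simp add: m_ac)
    also have "\<dots> = (u \<otimes> v \<otimes> t) \<otimes> (c \<otimes> s)" unfolding 2(5) using 1(1-7) 2(1-4) by (simp add: m_ac)
    finally have "(u \<otimes> v \<otimes> t) \<otimes> (a \<otimes> w) = (u \<otimes> v \<otimes> t) \<otimes> (c \<otimes> s)" .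
    moreover have "u \<otimes> v \<otimes> t \<in> carrier R - P" using 1 2 denom_mult by blast
    ultimately show "(x, z) \<in> fraction_rel R P"
      unfolding fraction_rel_def using 1(1,3,4) 2(1,2,3) by blast
  qed
qed

lemma frac_eq_iff:
  assumes "a \<in> carrier R" "s \<in> carrier R - P" "b \<in> carrier R" "t \<in> carrier R - P"
  shows "frac a s = frac b t \<longleftrightarrow> (\<exists>u\<in>carrier R - P. u \<otimes> (a \<otimes> t) = u \<otimes> (b \<otimes> s))"
  unfolding frac_def using assms eq_equiv_class_iff[OF equiv_fraction_rel, of "(a, s)" "(b, t)"]
  by (auto simp: fraction_rel_def)

lemma frac_eqI:
  assumes "a \<in> carrier R" "s \<in> carrier R - P" "b \<in> carrier R" "t \<in> carrier R - P"
    and "a \<otimes> t = b \<otimes> s"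
  shows "frac a s = frac b t"
  using frac_eq_iff[OF assms(1-4)] assms(5) one_denom by metis

lemma mem_fracD: "(b, t) \<in> frac a s \<Longrightarrow>
    b \<in> carrier R \<and> t \<in> carrier R - P \<and> (\<exists>u\<in>carrier R - P. u \<otimes> (a \<otimes> t) = u \<otimes> (b \<otimes> s))"
  unfolding frac_def fraction_rel_def by blast

lemma self_mem_frac: "a \<in> carrier R \<Longrightarrow> s \<in> carrier R - P \<Longrightarrow> (a, s) \<in> frac a s"
  unfolding frac_def by (rule equiv_class_self[OF equiv_fraction_rel]) simp

lemma carrier_L: "carrier L = {frac a s |a s. a \<in> carrier R \<and> s \<in> carrier R - P}"
  unfolding localization_at_def Let_def quotient_def frac_def by auto

lemma frac_closed: "a \<in> carrier R \<Longrightarrow> s \<in> carrier R - P \<Longrightarrow> frac a s \<in> carrier L"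
  unfolding carrier_L by blast

lemma carrier_L_cases:
  assumes "x \<in> carrier L"
  obtains a s where "x = frac a s" "a \<in> carrier R" "s \<in> carrier R - P"
  using assms unfolding carrier_L by blast

lemma one_L: "\<one>\<^bsub>L\<^esub> = frac \<one> \<one>" and zero_L: "\<zero>\<^bsub>L\<^esub> = frac \<zero> \<one>"
  unfolding localization_at_def Let_def frac_def by auto

lemma UN_pairs_const:
  assumes "(a0, s0) \<in> A" "(b0, t0) \<in> B"
    and "\<And>a s b t. (a, s) \<in> A \<Longrightarrow> (b, t) \<in> B \<Longrightarrow> f a s b t = c"
  shows "(\<Union>(a, s)\<in>A. \<Union>(b, t)\<in>B. f a s b t) = c"
  using assms by fast

lemma mult_L:
  assumes "a \<in> carrier R" "s \<in> carrier R - P" "b \<in> carrier R" "t \<in> carrier R - P"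
  shows "frac a s \<otimes>\<^bsub>L\<^esub> frac b t = frac (a \<otimes> b) (s \<otimes> t)"
proof -
  have *: "frac (a' \<otimes> b') (s' \<otimes> t') = frac (a \<otimes> b) (s \<otimes> t)"
    if m: "(a', s') \<in> frac a s" "(b', t') \<in> frac b t" for a' s' b' t'
  proof -
    obtain u where u: "a' \<in> carrier R" "s' \<in> carrier R - P" "u \<in> carrier R - P"
      "u \<otimes> (a \<otimes> s') = u \<otimes> (a' \<otimes> s)" using mem_fracD[OF m(1)] by blast
    obtain v where v: "b' \<in> carrier R" "t' \<in> carrier R - P" "v \<in> carrier R - P"
      "v \<otimes> (b \<otimes> t') = v \<otimes> (b' \<otimes> t)" using mem_fracD[OF m(2)] by blast
    have "(u \<otimes> v) \<otimes> ((a' \<otimes> b') \<otimes> (s \<otimes> t)) = (u \<otimes> (a' \<otimes> s)) \<otimes> (v \<otimes> (b' \<otimes> t))"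
      using u v assms by (simp add: m_ac)
    also have "\<dots> = (u \<otimes> v) \<otimes> ((a \<otimes> b) \<otimes> (s' \<otimes> t'))"
      unfolding u(4)[symmetric] v(4)[symmetric] using u(1-3) v(1-3) assms by (simp add: m_ac)
    finally show ?thesis using u v assms denom_mult
      by (subst frac_eq_iff) (auto intro!: bexI[of _ "u \<otimes> v"])
  qed
  have "frac a s \<otimes>\<^bsub>L\<^esub> frac b t = (\<Union>(a', s')\<in>frac a s. \<Union>(b', t')\<in>frac b t. frac (a' \<otimes> b') (s' \<otimes> t'))"
    unfolding localization_at_def Let_def by (simp add: frac_def)
  also have "\<dots> = frac (a \<otimes> b) (s \<otimes> t)"
    using self_mem_frac[OF assms(1,2)] self_mem_frac[OF assms(3,4)] * by (rule UN_pairs_const)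
  finally show ?thesis .
qed

lemma add_L:
  assumes "a \<in> carrier R" "s \<in> carrier R - P" "b \<in> carrier R" "t \<in> carrier R - P"
  shows "frac a s \<oplus>\<^bsub>L\<^esub> frac b t = frac (a \<otimes> t \<oplus> b \<otimes> s) (s \<otimes> t)"
proof -
  have *: "frac (a' \<otimes> t' \<oplus> b' \<otimes> s') (s' \<otimes> t') = frac (a \<otimes> t \<oplus> b \<otimes> s) (s \<otimes> t)"
    if m: "(a', s') \<in> frac a s" "(b', t') \<in> frac b t" for a' s' b' t'
  proof -
    obtain u where u: "a' \<in> carrier R" "s' \<in> carrier R - P" "u \<in> carrier R - P"
      "u \<otimes> (a \<otimes> s') = u \<otimes> (a' \<otimes> s)" using mem_fracD[OF m(1)] by blast
    obtain v where v: "b' \<in> carrier R" "t' \<in> carrier R - P" "v \<in> carrier R - P"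
      "v \<otimes> (b \<otimes> t') = v \<otimes> (b' \<otimes> t)" using mem_fracD[OF m(2)] by blast
    have "(u \<otimes> v) \<otimes> ((a' \<otimes> t' \<oplus> b' \<otimes> s') \<otimes> (s \<otimes> t)) =
        (u \<otimes> (a' \<otimes> s)) \<otimes> (v \<otimes> (t \<otimes> t')) \<oplus> (v \<otimes> (b' \<otimes> t)) \<otimes> (u \<otimes> (s \<otimes> s'))"
      using u v assms by (simp add: l_distr r_distr m_ac)
    also have "\<dots> = (u \<otimes> v) \<otimes> ((a \<otimes> t \<oplus> b \<otimes> s) \<otimes> (s' \<otimes> t'))"
      unfolding u(4)[symmetric] v(4)[symmetric] using u(1-3) v(1-3) assms by (simp add: l_distr r_distr m_ac)
    finally show ?thesis using u v assms denom_mult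
      by (subst frac_eq_iff) (auto intro!: bexI[of _ "u \<otimes> v"])
  qed
  have "frac a s \<oplus>\<^bsub>L\<^esub> frac b t =
      (\<Union>(a', s')\<in>frac a s. \<Union>(b', t')\<in>frac b t. frac (a' \<otimes> t' \<oplus> b' \<otimes> s') (s' \<otimes> t'))"
    unfolding localization_at_def Let_def by (simp add: frac_def)
  also have "\<dots> = frac (a \<otimes> t \<oplus> b \<otimes> s) (s \<otimes> t)"
    using self_mem_frac[OF assms(1,2)] self_mem_frac[OF assms(3,4)] * by (rule UN_pairs_const)
  finally show ?thesis .
qed

lemma cring_L: "cring L"
proof (rule cringI)
  note d = denom_mult one_denom
  show "abelian_group L"
  proof (rule abelian_groupI)
    fix x y assume "x \<in> carrier L" "y \<in> carrier L"
    then obtain a s b t where 1: "x = frac a s" "a \<in> carrier R" "s \<in> carrier R - P"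
      "y = frac b t" "b \<in> carrier R" "t \<in> carrier R - P"
      by (metis carrier_L_cases)
    then show "x \<oplus>\<^bsub>L\<^esub> y \<in> carrier L" using d by (simp add: add_L frac_closed)
    show "x \<oplus>\<^bsub>L\<^esub> y = y \<oplus>\<^bsub>L\<^esub> x" using 1 by (simp add: add_L a_comm m_comm)
    fix z assume "z \<in> carrier L"
    then obtain c w where 2: "z = frac c w" "c \<in> carrier R" "w \<in> carrier R - P"
      by (metis carrier_L_cases)
    have "s \<otimes> t \<in> carrier R - P" "t \<otimes> w \<in> carrier R - P" using 1 2 d by auto
    then show "x \<oplus>\<^bsub>L\<^esub> y \<oplus>\<^bsub>L\<^esub> z = x \<oplus>\<^bsub>L\<^esub> (y \<oplus>\<^bsub>L\<^esub> z)"
      using 1 2 by (simp add: add_L l_distr r_distr a_assoc m_ac)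
  next
    show "\<zero>\<^bsub>L\<^esub> \<in> carrier L" using d by (simp add: zero_L frac_closed)
    fix x assume "x \<in> carrier L"
    then obtain a s where 1: "x = frac a s" "a \<in> carrier R" "s \<in> carrier R - P"
      by (metis carrier_L_cases)
    then show "\<zero>\<^bsub>L\<^esub> \<oplus>\<^bsub>L\<^esub> x = x" using d by (simp add: zero_L add_L)
    have "frac (\<ominus> a) s \<oplus>\<^bsub>L\<^esub> x = frac \<zero> (s \<otimes> s)"
      using 1 d by (simp add: add_L l_minus l_neg)
    also have "\<dots> = \<zero>\<^bsub>L\<^esub>" unfolding zero_L using 1 d by (intro frac_eqI) auto
    finally show "\<exists>y\<in>carrier L. y \<oplus>\<^bsub>L\<^esub> x = \<zero>\<^bsub>L\<^esub>"
      using 1 by (intro bexI[of _ "frac (\<ominus> a) s"]) (auto intro: frac_closed)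
  qed
  show "comm_monoid L"
  proof (rule comm_monoidI)
    show "\<one>\<^bsub>L\<^esub> \<in> carrier L" using d by (simp add: one_L frac_closed)
    fix x assume "x \<in> carrier L"
    then obtain a s where 1: "x = frac a s" "a \<in> carrier R" "s \<in> carrier R - P"
      by (metis carrier_L_cases)
    then show "\<one>\<^bsub>L\<^esub> \<otimes>\<^bsub>L\<^esub> x = x" using d by (simp add: one_L mult_L)
    fix y assume "y \<in> carrier L"
    then obtain b t where 2: "y = frac b t" "b \<in> carrier R" "t \<in> carrier R - P"
      by (metis carrier_L_cases)
    then show "x \<otimes>\<^bsub>L\<^esub> y \<in> carrier L" using 1 d by (simp add: mult_L frac_closed)
    show "x \<otimes>\<^bsub>L\<^esub> y = y \<otimes>\<^bsub>L\<^esub> x" using 1 2 d by (simp add: mult_L m_comm)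
    fix z assume "z \<in> carrier L"
    then obtain c w where 3: "z = frac c w" "c \<in> carrier R" "w \<in> carrier R - P"
      by (metis carrier_L_cases)
    have "s \<otimes> t \<in> carrier R - P" "t \<otimes> w \<in> carrier R - P" using 1 2 3 d by auto
    then show "x \<otimes>\<^bsub>L\<^esub> y \<otimes>\<^bsub>L\<^esub> z = x \<otimes>\<^bsub>L\<^esub> (y \<otimes>\<^bsub>L\<^esub> z)" using 1 2 3 by (simp add: mult_L m_assoc)
  qed
  fix x y z assume "x \<in> carrier L" "y \<in> carrier L" "z \<in> carrier L"
  then obtain a s b t c w where 1: "x = frac a s" "a \<in> carrier R" "s \<in> carrier R - P"
      "y = frac b t" "b \<in> carrier R" "t \<in> carrier R - P"
      "z = frac c w" "c \<in> carrier R" "w \<in> carrier R - P"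
    by (metis carrier_L_cases)
  have e: "s \<otimes> t \<in> carrier R - P" "t \<otimes> w \<in> carrier R - P" "s \<otimes> w \<in> carrier R - P"
    "s \<otimes> t \<otimes> w \<in> carrier R - P" "s \<otimes> w \<otimes> (t \<otimes> w) \<in> carrier R - P" using 1 d by auto
  have "(x \<oplus>\<^bsub>L\<^esub> y) \<otimes>\<^bsub>L\<^esub> z = frac ((a \<otimes> t \<oplus> b \<otimes> s) \<otimes> c) (s \<otimes> t \<otimes> w)"
    using 1 e by (simp add: add_L mult_L)
  also have "\<dots> = frac ((a \<otimes> c) \<otimes> (t \<otimes> w) \<oplus> (b \<otimes> c) \<otimes> (s \<otimes> w)) (s \<otimes> w \<otimes> (t \<otimes> w))"
    using 1 e by (intro frac_eqI) (auto simp: l_distr r_distr m_ac)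
  also have "\<dots> = x \<otimes>\<^bsub>L\<^esub> z \<oplus>\<^bsub>L\<^esub> y \<otimes>\<^bsub>L\<^esub> z"
    using 1 e by (simp add: add_L mult_L)
  finally show "(x \<oplus>\<^bsub>L\<^esub> y) \<otimes>\<^bsub>L\<^esub> z = x \<otimes>\<^bsub>L\<^esub> z \<oplus>\<^bsub>L\<^esub> y \<otimes>\<^bsub>L\<^esub> z" .
qed

sublocale L: cring L by (rule cring_L)

lemma frac_hom: "ring_hom_cring R L (\<lambda>a. frac a \<one>)"
proof (intro ring_hom_cring.intro ring_hom_cring_axioms.intro is_cring cring_L ring_hom_memI)
  fix a b assume "a \<in> carrier R" "b \<in> carrier R"
  then show "frac a \<one> \<in> carrier L" "frac (a \<otimes> b) \<one> = frac a \<one> \<otimes>\<^bsub>L\<^esub> frac b \<one>"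
    "frac (a \<oplus> b) \<one> = frac a \<one> \<oplus>\<^bsub>L\<^esub> frac b \<one>"
    using one_denom by (auto simp: frac_closed mult_L add_L)
qed (simp add: one_L)

lemma frac_decomp:
  assumes "a \<in> carrier R" "s \<in> carrier R - P"
  shows "frac a s = frac \<one> s \<otimes>\<^bsub>L\<^esub> frac a \<one>" "frac a \<one> = frac s \<one> \<otimes>\<^bsub>L\<^esub> frac a s"
proof -
  show "frac a s = frac \<one> s \<otimes>\<^bsub>L\<^esub> frac a \<one>" using assms one_denom by (simp add: mult_L)
  show "frac a \<one> = frac s \<one> \<otimes>\<^bsub>L\<^esub> frac a s"
    using assms one_denom by (simp add: mult_L) (intro frac_eqI; simp add: m_comm)
qed

text \<open>Denominators are units of \<open>L\<close>, so an ideal of \<open>L\<close> is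
  determined by the numerators in it. Statements about ideals of \<open>L\<close> are thereby
  reduced to their contractions to \<open>R\<close>.\<close>

lemma frac_mem_ideal_iff:
  assumes J: "ideal J L" and a: "a \<in> carrier R" "s \<in> carrier R - P"
  shows "frac a s \<in> J \<longleftrightarrow> frac a \<one> \<in> J"
proof -
  interpret J: ideal J L by (rule J)
  show ?thesis
    using frac_decomp[OF a] a one_denom frac_closed J.I_l_closed by (metis DiffD1 one_closed)
qed

lemma ideal_L_subset_iff:
  assumes J: "ideal J L" "ideal J' L"
  shows "J \<subseteq> J' \<longleftrightarrow> {a \<in> carrier R. frac a \<one> \<in> J} \<subseteq> {a \<in> carrier R. frac a \<one> \<in> J'}"
proof
  assume s: "{a \<in> carrier R. frac a \<one> \<in> J} \<subseteq> {a \<in> carrier R. frac a \<one> \<in> J'}"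
  show "J \<subseteq> J'"
  proof
    fix x assume x: "x \<in> J"
    have "x \<in> carrier L" by (rule ideal.Icarr[OF J(1) x])
    then obtain a t where a: "x = frac a t" "a \<in> carrier R" "t \<in> carrier R - P"
      by (metis carrier_L_cases)
    then show "x \<in> J'" using x s frac_mem_ideal_iff J by blast
  qed
qed auto

lemma ideal_fractions:
  assumes I: "ideal I R"
  shows "ideal {frac a s |a s. a \<in> I \<and> s \<in> carrier R - P} L" (is "ideal ?J L")
proof -
  interpret I: ideal I R by (rule I)
  show ?thesis
  proof (rule idealI)
    show "ring L" by (rule L.ring_axioms)
    show "subgroup ?J (add_monoid L)"
    proof (rule L.add.subgroupI)
      show "?J \<subseteq> carrier L" using I.Icarr frac_closed by auto
      show "?J \<noteq> {}" using I.zero_closed one_denom by blast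
      fix x y assume xy: "x \<in> ?J"
      then obtain a s where a: "x = frac a s" "a \<in> I" "s \<in> carrier R - P" by blast
      have "frac (\<ominus> a) s \<oplus>\<^bsub>L\<^esub> x = \<zero>\<^bsub>L\<^esub>"
        using a I.Icarr one_denom denom_mult
        by (simp add: add_L l_minus l_neg zero_L) (intro frac_eqI; simp)
      then have "\<ominus>\<^bsub>L\<^esub> x = frac (\<ominus> a) s"
        using a I.Icarr frac_closed by (intro L.minus_equality) auto
      then show "\<ominus>\<^bsub>L\<^esub> x \<in> ?J" using a I.a_inv_closed by blast
      assume "y \<in> ?J"
      then obtain b t where b: "y = frac b t" "b \<in> I" "t \<in> carrier R - P" by blast
      have "x \<oplus>\<^bsub>L\<^esub> y = frac (a \<otimes> t \<oplus> b \<otimes> s) (s \<otimes> t)"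
        using a b I.Icarr by (simp add: add_L)
      moreover have "a \<otimes> t \<oplus> b \<otimes> s \<in> I"
        using a b by (intro I.a_closed I.I_r_closed) auto
      ultimately show "x \<oplus>\<^bsub>L\<^esub> y \<in> ?J" using a b denom_mult by blast
    qed
    fix x y assume "x \<in> ?J" "y \<in> carrier L"
    then obtain a s b t where ab: "x = frac a s" "a \<in> I" "s \<in> carrier R - P"
      "y = frac b t" "b \<in> carrier R" "t \<in> carrier R - P" by (auto elim: carrier_L_cases)
    then have "y \<otimes>\<^bsub>L\<^esub> x = frac (b \<otimes> a) (t \<otimes> s)" "x \<otimes>\<^bsub>L\<^esub> y = frac (a \<otimes> b) (s \<otimes> t)"
      using I.Icarr by (auto simp: mult_L)
    moreover have "b \<otimes> a \<in> I" "a \<otimes> b \<in> I" "t \<otimes> s \<in> carrier R - P" "s \<otimes> t \<in> carrier R - P"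
      using ab I.I_l_closed I.I_r_closed denom_mult by auto
    ultimately show "y \<otimes>\<^bsub>L\<^esub> x \<in> ?J" "x \<otimes>\<^bsub>L\<^esub> y \<in> ?J" by blast+
  qed
qed

lemma frac_mem_fractions_iff:
  assumes I: "ideal I R" and a: "a \<in> carrier R" "s \<in> carrier R - P"
  shows "frac a s \<in> {frac b t |b t. b \<in> I \<and> t \<in> carrier R - P} \<longleftrightarrow> (\<exists>u\<in>carrier R - P. u \<otimes> a \<in> I)"
    (is "?l \<longleftrightarrow> ?r")
proof -
  interpret I: ideal I R by (rule I)
  show ?thesis
  proof
    assume ?l
    then obtain b t where b: "frac a s = frac b t" "b \<in> I" "t \<in> carrier R - P" by blast
    then obtain u where u: "u \<in> carrier R - P" "u \<otimes> (a \<otimes> t) = u \<otimes> (b \<otimes> s)"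
      using frac_eq_iff[OF a I.Icarr b(3)] by blast
    have "(u \<otimes> t) \<otimes> a = u \<otimes> (b \<otimes> s)" using u a b by (simp add: u(2)[symmetric] m_ac)
    also have "\<dots> \<in> I" using u a b by (intro I.I_l_closed I.I_r_closed) auto
    finally show ?r using u b denom_mult by blast
  next
    assume ?r
    then obtain u where u: "u \<in> carrier R - P" "u \<otimes> a \<in> I" by blast
    then have "frac a s = frac (u \<otimes> a) (u \<otimes> s)"
      using a denom_mult by (intro frac_eqI) (auto simp: m_ac)
    then show ?l using u a denom_mult by blast
  qed
qed

lemma frac_mem_genideal_iff:
  assumes A: "A \<subseteq> carrier R" and a: "a \<in> carrier R" "s \<in> carrier R - P"
  shows "frac a s \<in> genideal L ((\<lambda>a. frac a \<one>) ` A) \<longleftrightarrow>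
    (\<exists>u\<in>carrier R - P. u \<otimes> a \<in> Idl A)" (is "_ \<in> genideal L ?A \<longleftrightarrow> _")
proof -
  interpret h: ring_hom_cring R L "\<lambda>a. frac a \<one>" by (rule frac_hom)
  let ?J = "{frac b t |b t. b \<in> Idl A \<and> t \<in> carrier R - P}"
  have A': "?A \<subseteq> carrier L" using A h.hom_closed by blast
  interpret G: ideal "genideal L ?A" L using A' by (rule L.genideal_ideal)
  have 1: "genideal L ?A \<subseteq> ?J"
  proof (rule L.genideal_minimal)
    show "ideal ?J L" by (rule ideal_fractions[OF genideal_ideal[OF A]])
    show "?A \<subseteq> ?J" using genideal_self[OF A] one_denom by blast
  qed
  have "Idl A \<subseteq> {r \<in> carrier R. frac r \<one> \<in> genideal L ?A}"
  proof (rule genideal_minimal)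
    show "ideal {r \<in> carrier R. frac r \<one> \<in> genideal L ?A} R"
      using h.ring.ideal_vimage[OF G.is_ideal] .
    show "A \<subseteq> {r \<in> carrier R. frac r \<one> \<in> genideal L ?A}"
      using A L.genideal_self[OF A'] by blast
  qed
  then have "?J \<subseteq> genideal L ?A"
    using frac_mem_ideal_iff[OF G.is_ideal] by blast
  with 1 have "genideal L ?A = ?J" by blast
  then show ?thesis using frac_mem_fractions_iff[OF genideal_ideal[OF A] a] by simp
qed

text \<open>Generators of the contraction of \<open>J\<close> to \<open>R\<close> also generate
  \<open>J\<close>.\<close>

lemma noetherian_L:
  assumes "noetherian_ring R"
  shows "noetherian_ring L"
proof (rule L.noetherian_ringI)
  interpret N: noetherian_ring R by (rule assms)
  interpret h: ring_hom_cring R L "\<lambda>a. frac a \<one>" by (rule frac_hom)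
  fix J assume J: "ideal J L"
  obtain A where A: "A \<subseteq> carrier R" "finite A" "{r \<in> carrier R. frac r \<one> \<in> J} = Idl A"
    using N.finetely_gen[OF h.ring.ideal_vimage[OF J]] by blast
  let ?A = "(\<lambda>a. frac a \<one>) ` A"
  have A': "?A \<subseteq> carrier L" using A h.hom_closed by blast
  have "?A \<subseteq> J" using A(3) genideal_self[OF A(1)] by blast
  then have 1: "genideal L ?A \<subseteq> J" by (rule L.genideal_minimal[OF J])
  have "J \<subseteq> genideal L ?A"
    unfolding ideal_L_subset_iff[OF J L.genideal_ideal[OF A']] A(3)
  proof
    fix a assume a: "a \<in> Idl A"
    then have ac: "a \<in> carrier R" by (rule ideal.Icarr[OF genideal_ideal[OF A(1)]])
    then have "\<one> \<otimes> a \<in> Idl A" using a by simp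
    then show "a \<in> {a \<in> carrier R. frac a \<one> \<in> genideal L ?A}"
      using frac_mem_genideal_iff[OF A(1) ac one_denom] one_denom ac by blast
  qed
  then show "\<exists>A\<subseteq>carrier L. finite A \<and> J = genideal L A"
    using A(2) A' 1 by blast
qed

definition max_L where "max_L = {frac a s |a s. a \<in> P \<and> s \<in> carrier R - P}"

lemma frac_mem_max_L: "a \<in> carrier R \<Longrightarrow> s \<in> carrier R - P \<Longrightarrow> frac a s \<in> max_L \<longleftrightarrow> a \<in> P"
  unfolding max_L_def using frac_mem_fractions_iff[OF P.is_ideal] P.I_prime one_denom P.I_l_closed
  by blast

lemma ideal_subset_max_L:
  assumes J: "ideal J L" "J \<noteq> carrier L"
  shows "J \<subseteq> max_L"
proof
  fix x assume x: "x \<in> J"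
  interpret J: ideal J L by (rule J)
  obtain a s where a: "x = frac a s" "a \<in> carrier R" "s \<in> carrier R - P"
    using x J.Icarr by (metis carrier_L_cases)
  have "a \<in> P"
  proof (rule ccontr)
    assume "a \<notin> P"
    then have "frac s a \<otimes>\<^bsub>L\<^esub> x = \<one>\<^bsub>L\<^esub>"
      using a one_denom denom_mult by (simp add: mult_L one_L) (intro frac_eqI; simp add: m_comm)
    moreover have "frac s a \<otimes>\<^bsub>L\<^esub> x \<in> J"
      using a \<open>a \<notin> P\<close> x by (intro J.I_l_closed frac_closed) auto
    ultimately show False using J.one_imp_carrier J(2) by simp
  qed
  then show "x \<in> max_L" using a frac_mem_max_L by blast
qed

lemma maximal_ideals_L: "{M. maximalideal M L} = {max_L}"
proof -
  have id: "ideal max_L L" unfolding max_L_def by (rule ideal_fractions[OF P.is_ideal])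
  have ne: "carrier L \<noteq> max_L"
  proof -
    have "\<one>\<^bsub>L\<^esub> \<notin> max_L" unfolding one_L using frac_mem_max_L one_denom by blast
    then show ?thesis using L.one_closed by blast
  qed
  have "maximalideal max_L L"
    using ideal_subset_max_L ne by (intro maximalidealI id) blast+
  moreover have "M = max_L" if "maximalideal M L" for M
  proof -
    interpret M: maximalideal M L by (rule that)
    have "M \<subseteq> max_L" using ideal_subset_max_L M.is_ideal M.I_notcarr by blast
    moreover have "max_L \<subseteq> carrier L" using id by (simp add: additive_subgroup.a_subset ideal.axioms(1))
    ultimately show ?thesis using M.I_maximal[OF id] ne by blast
  qed
  ultimately show ?thesis by blast
qed

text \<open>Contraction sends primes of \<open>L\<close> to primes of \<open>R\<close> inside
  \<open>P\<close> and preserves strict inclusions, so a bound on chains below \<open>P\<close>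
  bounds chains in \<open>L\<close>.\<close>

lemma krull_dim_L_le:
  assumes "\<And>C l. (\<And>i. i \<le> l \<Longrightarrow> primeideal (C i) R \<and> C i \<subseteq> P) \<Longrightarrow>
    (\<And>i. i < l \<Longrightarrow> C i \<subset> C (Suc i)) \<Longrightarrow> l \<le> d"
  shows "krull_dim L \<le> enat d"
  unfolding krull_dim_def
proof (rule Sup_least, clarify)
  interpret h: ring_hom_cring R L "\<lambda>a. frac a \<one>" by (rule frac_hom)
  fix n C assume C: "\<forall>i\<le>n. primeideal (C i) L" "\<forall>i<n. C i \<subset> C (Suc i)"
  let ?C = "\<lambda>i. {a \<in> carrier R. frac a \<one> \<in> C i}"
  have "n \<le> d"
  proof (rule assms[of n ?C])
    fix i assume i: "i \<le> n"
    then interpret Ci: primeideal "C i" L using C by simp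
    have "C i \<subseteq> max_L" using ideal_subset_max_L Ci.is_ideal Ci.I_notcarr by blast
    then have "?C i \<subseteq> P" using frac_mem_max_L one_denom by blast
    moreover have "primeideal (?C i) R" by (rule h.ring.primeideal_vimage[OF is_cring Ci.primeideal])
    ultimately show "primeideal (?C i) R \<and> ?C i \<subseteq> P" by blast
  next
    fix i assume i: "i < n"
    have id: "ideal (C i) L" "ideal (C (Suc i)) L" using C i by (auto simp: primeideal_def)
    have "C i \<subseteq> C (Suc i)" "\<not> C (Suc i) \<subseteq> C i" using C i by auto
    then show "?C i \<subset> ?C (Suc i)"
      unfolding ideal_L_subset_iff[OF id] ideal_L_subset_iff[OF id(2,1)] by blast
  qed
  then show "enat n \<le> enat d" by simp
qed

text \<open>Regularity is asked for in \<open>R\<close> only up to a factor \<open>u\<close> outside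
  \<open>P\<close>, which becomes a unit in \<open>L\<close>. Members of \<open>P\<close> cannot
  generate the unit ideal of \<open>L\<close>, since they stay in its maximal ideal.\<close>

lemma regular_sequence_L:
  assumes xs: "set xs \<subseteq> P"
    and reg: "\<And>i a. i < length xs \<Longrightarrow> a \<in> carrier R \<Longrightarrow> xs ! i \<otimes> a \<in> Idl (set (take i xs)) \<Longrightarrow>
      \<exists>u\<in>carrier R - P. u \<otimes> a \<in> Idl (set (take i xs))"
  shows "regular_sequence L (map (\<lambda>a. frac a \<one>) xs)" (is "regular_sequence L ?ys")
    and "set (map (\<lambda>a. frac a \<one>) xs) \<subseteq> max_L"
proof -
  have xsc: "set xs \<subseteq> carrier R" using xs P.a_subset by blast
  have tc: "set (take i xs) \<subseteq> carrier R" for i using xsc set_take_subset by fastforce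
  have st: "set (take i ?ys) = (\<lambda>a. frac a \<one>) ` set (take i xs)" for i
    by (simp add: take_map)
  show sub: "set ?ys \<subseteq> max_L" using xs xsc frac_mem_max_L one_denom by auto
  have idm: "ideal max_L L" unfolding max_L_def by (rule ideal_fractions[OF P.is_ideal])
  show "regular_sequence L ?ys" unfolding regular_sequence_def
  proof (intro conjI allI impI ballI)
    show "set ?ys \<subseteq> carrier L" using xsc one_denom by (auto intro: frac_closed)
    have "\<one>\<^bsub>L\<^esub> \<notin> max_L" unfolding one_L using frac_mem_max_L one_denom by blast
    moreover have "genideal L (set ?ys) \<subseteq> max_L" by (rule L.genideal_minimal[OF idm sub])
    ultimately show "genideal L (set ?ys) \<noteq> carrier L" using L.one_closed by blast
    fix i x assume i: "i < length ?ys" and x: "x \<in> carrier L"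
      and m: "?ys ! i \<otimes>\<^bsub>L\<^esub> x \<in> genideal L (set (take i ?ys))"
    obtain a s where a: "x = frac a s" "a \<in> carrier R" "s \<in> carrier R - P"
      using x by (metis carrier_L_cases)
    have xi: "xs ! i \<in> carrier R" using i xsc by auto
    then have "?ys ! i \<otimes>\<^bsub>L\<^esub> x = frac (xs ! i \<otimes> a) s"
      using a i one_denom by (simp add: mult_L)
    then obtain u where u: "u \<in> carrier R - P" "u \<otimes> (xs ! i \<otimes> a) \<in> Idl (set (take i xs))"
      using m frac_mem_genideal_iff[OF tc, of "xs ! i \<otimes> a" s i] xi a unfolding st by auto
    then have "xs ! i \<otimes> (u \<otimes> a) \<in> Idl (set (take i xs))"
      using xi a by (simp add: m_lcomm)
    then obtain v where v: "v \<in> carrier R - P" "v \<otimes> (u \<otimes> a) \<in> Idl (set (take i xs))"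
      using reg[of i "u \<otimes> a"] i a u by auto
    then have "(v \<otimes> u) \<otimes> a \<in> Idl (set (take i xs))" using u a by (simp add: m_assoc)
    then show "x \<in> genideal L (set (take i ?ys))"
      unfolding st a(1) frac_mem_genideal_iff[OF tc a(2,3)] using denom_mult v u by blast
  qed
qed

end

text \<open>A certificate for the Cohen--Macaulay property at \<open>P\<close>, phrased inside
  \<open>R\<close>: a sequence in \<open>P\<close> that is regular up to factors outside
  \<open>P\<close> and at least as long as every chain of primes below \<open>P\<close>. In this
  form it can be carried along a ring isomorphism without comparing localizations.\<close>

definition cm_data :: "('a, 'b) ring_scheme \<Rightarrow> 'a set \<Rightarrow> 'a list \<Rightarrow> bool" where
  "cm_data R P xs \<longleftrightarrow> set xs \<subseteq> P \<and>
     (\<forall>i<length xs. \<forall>a\<in>carrier R. xs ! i \<otimes>\<^bsub>R\<^esub> a \<in> genideal R (set (take i xs)) \<longrightarrow>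
        (\<exists>u\<in>carrier R - P. u \<otimes>\<^bsub>R\<^esub> a \<in> genideal R (set (take i xs)))) \<and>
     (\<forall>C l. (\<forall>i\<le>l. primeideal (C i) R \<and> C i \<subseteq> P) \<longrightarrow> (\<forall>i<l. C i \<subset> C (Suc i)) \<longrightarrow> l \<le> length xs)"

text \<open>The length of \<open>xs\<close> is at most the depth, the depth is at most the
  dimension, and the dimension is at most the length of \<open>xs\<close>, so all three
  agree.\<close>

lemma cohen_macaulay_ringI:
  assumes "cring R" and noeth: "noetherian_ring R"
    and "\<And>P. primeideal P R \<Longrightarrow> \<exists>xs. cm_data R P xs"
  shows "cohen_macaulay_ring R"
  unfolding cohen_macaulay_ring_def
proof (intro conjI allI impI assms(1,2))
  fix P assume P: "primeideal P R"
  interpret cring R by fact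
  interpret prime_localization R P by (intro prime_localization.intro prime_localization_axioms.intro is_cring P)
  obtain xs where xs: "cm_data R P xs" using assms(3)[OF P] by blast
  then have sub: "set xs \<subseteq> P"
    and reg: "\<And>i a. i < length xs \<Longrightarrow> a \<in> carrier R \<Longrightarrow> xs ! i \<otimes>\<^bsub>R\<^esub> a \<in> genideal R (set (take i xs)) \<Longrightarrow>
      \<exists>u\<in>carrier R - P. u \<otimes>\<^bsub>R\<^esub> a \<in> genideal R (set (take i xs))"
    and ch: "\<And>C l. (\<And>i. i \<le> l \<Longrightarrow> primeideal (C i) R \<and> C i \<subseteq> P) \<Longrightarrow>
      (\<And>i. i < l \<Longrightarrow> C i \<subset> C (Suc i)) \<Longrightarrow> l \<le> length xs"
    unfolding cm_data_def by blast+
  have max: "maximalideal max_L L" using maximal_ideals_L by blast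
  have "depth L max_L \<le> krull_dim L"
    unfolding depth_def
    using L.regular_sequence_length_le_krull_dim[OF _ L.maximalideal_prime[OF max]]
    by (intro Sup_least) auto
  moreover have "enat (length xs) \<le> depth L max_L"
  proof -
    have "enat (length (map (\<lambda>a. frac a \<one>\<^bsub>R\<^esub>) xs)) \<le> depth L max_L"
      unfolding depth_def using regular_sequence_L[OF sub reg] by (intro Sup_upper) blast
    then show ?thesis by simp
  qed
  moreover have "krull_dim L \<le> enat (length xs)"
    by (rule krull_dim_L_le) (rule ch)
  ultimately show "cohen_macaulay_local L"
    unfolding cohen_macaulay_local_def using cring_L noetherian_L[OF noeth] maximal_ideals_L by auto
qed

section \<open>Subrings of a commutative ring\<close>

text \<open>Rings are taken as subsets of a type of class \<open>comm_ring_1\<close>, so that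
  elements of an extension by \<open>x\<close> can be handled as values at \<open>x\<close> of
  polynomials of type \<open>poly\<close>.\<close>

definition class_ring :: "'r::comm_ring_1 set \<Rightarrow> 'r ring" where
  "class_ring C = \<lparr>carrier = C, monoid.mult = (*), one = 1, ring.zero = 0, add = (+)\<rparr>"

lemma class_ring_simps [simp]:
  "carrier (class_ring C) = C" "x \<otimes>\<^bsub>class_ring C\<^esub> y = x * y" "\<one>\<^bsub>class_ring C\<^esub> = 1"
  "\<zero>\<^bsub>class_ring C\<^esub> = 0" "x \<oplus>\<^bsub>class_ring C\<^esub> y = x + y"
  by (simp_all add: class_ring_def)

locale class_subring =
  fixes C :: "'r::comm_ring_1 set"
  assumes one_mem [simp, intro]: "1 \<in> C"
    and add_mem [intro]: "a \<in> C \<Longrightarrow> b \<in> C \<Longrightarrow> a + b \<in> C"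
    and mult_mem [intro]: "a \<in> C \<Longrightarrow> b \<in> C \<Longrightarrow> a * b \<in> C"
    and uminus_mem [intro]: "a \<in> C \<Longrightarrow> - a \<in> C"
begin

lemma zero_mem [simp, intro]: "0 \<in> C"
  using add_mem[OF one_mem uminus_mem[OF one_mem]] by simp

lemma power_mem [intro]: "a \<in> C \<Longrightarrow> a ^ n \<in> C"
  by (induction n) auto

lemma sum_mem [intro]: "(\<And>i. i \<in> I \<Longrightarrow> f i \<in> C) \<Longrightarrow> sum f I \<in> C"
  by (induction I rule: infinite_finite_induct) auto

lemma cring: "cring (class_ring C)"
proof (rule cringI)
  show "abelian_group (class_ring C)"
    by (rule abelian_groupI) (auto simp: algebra_simps intro!: bexI[of _ "- _"])
  show "comm_monoid (class_ring C)"
    by (rule comm_monoidI) (auto simp: algebra_simps)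
qed (auto simp: algebra_simps)

lemma ideal_iff:
  "ideal I (class_ring C) \<longleftrightarrow> I \<subseteq> C \<and> 0 \<in> I \<and> (\<forall>a\<in>I. \<forall>b\<in>I. a + b \<in> I) \<and> (\<forall>c\<in>C. \<forall>a\<in>I. c * a \<in> I)"
proof
  assume "ideal I (class_ring C)"
  then interpret I: ideal I "class_ring C" .
  show "I \<subseteq> C \<and> 0 \<in> I \<and> (\<forall>a\<in>I. \<forall>b\<in>I. a + b \<in> I) \<and> (\<forall>c\<in>C. \<forall>a\<in>I. c * a \<in> I)"
    using I.a_subset additive_subgroup.zero_closed[OF I.ideal_axioms[THEN ideal.axioms(1)]]
      additive_subgroup.a_closed[OF I.ideal_axioms[THEN ideal.axioms(1)]] I.I_l_closed by simp
next
  assume *: "I \<subseteq> C \<and> 0 \<in> I \<and> (\<forall>a\<in>I. \<forall>b\<in>I. a + b \<in> I) \<and> (\<forall>c\<in>C. \<forall>a\<in>I. c * a \<in> I)"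
  interpret R: cring "class_ring C" by (rule cring)
  have neg: "- a \<in> I" if "a \<in> I" for a
  proof -
    have "(- 1) * a \<in> I" using * that uminus_mem[OF one_mem] by blast
    then show ?thesis by simp
  qed
  show "ideal I (class_ring C)"
  proof (rule idealI)
    show "subgroup I (add_monoid (class_ring C))"
    proof (rule R.add.subgroupI)
      fix a assume a: "a \<in> I"
      then have "\<ominus>\<^bsub>class_ring C\<^esub> a = - a"
        using * by (intro R.minus_equality) auto
      then show "\<ominus>\<^bsub>class_ring C\<^esub> a \<in> I" using neg a by simp
    qed (use * in auto)
    have "a * x \<in> I" if "a \<in> I" "x \<in> C" for a x
      using * that by (metis mult.commute)
    then show "a \<otimes>\<^bsub>class_ring C\<^esub> x \<in> I" if "a \<in> I" "x \<in> carrier (class_ring C)" for a x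
      using that by simp
  qed (use * R.ring_axioms in auto)
qed

end

locale prime_class_subring = class_subring +
  fixes P
  assumes prime: "primeideal P (class_ring C)"
begin

lemma P_subset: "P \<subseteq> C" and P_zero [simp, intro]: "0 \<in> P"
  and P_add: "a \<in> P \<Longrightarrow> b \<in> P \<Longrightarrow> a + b \<in> P"
  and P_mult: "c \<in> C \<Longrightarrow> a \<in> P \<Longrightarrow> c * a \<in> P"
  using primeideal.axioms(1)[OF prime] unfolding ideal_iff by auto

lemma P_prime: "a \<in> C \<Longrightarrow> b \<in> C \<Longrightarrow> a * b \<in> P \<Longrightarrow> a \<in> P \<or> b \<in> P"
  using primeideal.I_prime[OF prime] by simp

lemma P_one: "1 \<notin> P"
  using ideal.one_imp_carrier[OF primeideal.axioms(1)[OF prime]] primeideal.I_notcarr[OF prime]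
  by auto

lemma P_uminus: "a \<in> P \<Longrightarrow> - a \<in> P"
  using P_mult[of "- 1" a] by auto

lemma P_diff: "a \<in> P \<Longrightarrow> b \<in> P \<Longrightarrow> a - b \<in> P"
  using P_add[OF _ P_uminus, of a b] by simp

lemma P_sum: "(\<And>i. i \<in> I \<Longrightarrow> f i \<in> P) \<Longrightarrow> sum f I \<in> P"
  by (induction I rule: infinite_finite_induct) (auto intro: P_add)

lemma P_power: "a \<in> C \<Longrightarrow> a \<notin> P \<Longrightarrow> a ^ n \<notin> P"
  using P_one P_prime by (induction n) auto

end

text \<open>For \<open>M = C\<close> this is the ideal generated by \<open>H\<close>. For a module
  \<open>M\<close> over a subring containing \<open>H\<close> it is the submodule
  \<open>H M\<close>; both readings meet when an ideal is described coefficient by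
  coefficient.\<close>

inductive_set mspan :: "'r::comm_ring_1 set \<Rightarrow> 'r set \<Rightarrow> 'r set" for H M where
  zero: "0 \<in> mspan H M"
| step: "a \<in> mspan H M \<Longrightarrow> h \<in> H \<Longrightarrow> m \<in> M \<Longrightarrow> h * m + a \<in> mspan H M"

lemma mspan_add: "a \<in> mspan H M \<Longrightarrow> b \<in> mspan H M \<Longrightarrow> a + b \<in> mspan H M"
  by (induction rule: mspan.induct) (auto simp: add.assoc intro: mspan.step)

lemma mspan_base: "h \<in> H \<Longrightarrow> m \<in> M \<Longrightarrow> h * m \<in> mspan H M"
  using mspan.step[OF mspan.zero] by simp

lemma mspan_mult:
  assumes "a \<in> mspan H M" and "\<And>m. m \<in> M \<Longrightarrow> c * m \<in> M'" and "H \<subseteq> H'"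
  shows "c * a \<in> mspan H' M'"
  using assms(1)
proof (induction rule: mspan.induct)
  case (step a h m)
  have "c * (h * m + a) = h * (c * m) + c * a" by (simp add: algebra_simps)
  also have "\<dots> \<in> mspan H' M'" using step assms by (auto intro: mspan.step)
  finally show ?case .
qed (simp add: mspan.zero)

lemma mspan_subset:
  assumes "0 \<in> J" "\<And>a b. a \<in> J \<Longrightarrow> b \<in> J \<Longrightarrow> a + b \<in> J" "\<And>h m. h \<in> H \<Longrightarrow> m \<in> M \<Longrightarrow> h * m \<in> J"
  shows "mspan H M \<subseteq> J"
proof
  fix a assume "a \<in> mspan H M"
  then show "a \<in> J" by (induction rule: mspan.induct) (auto intro: assms)
qed

lemma (in class_subring) genideal_eq_mspan:
  assumes "H \<subseteq> C"
  shows "genideal (class_ring C) H = mspan H C"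
proof -
  interpret R: cring "class_ring C" by (rule cring)
  have "ideal (mspan H C) (class_ring C)"
    unfolding ideal_iff
  proof (intro conjI ballI)
    show "mspan H C \<subseteq> C" using assms by (intro mspan_subset) auto
    show "c * a \<in> mspan H C" if "c \<in> C" "a \<in> mspan H C" for c a
      using that(2) by (rule mspan_mult) (use that in auto)
  qed (auto intro: mspan.zero mspan_add)
  moreover have "H \<subseteq> mspan H C" using mspan_base[of _ H 1 C] by auto
  ultimately have "genideal (class_ring C) H \<subseteq> mspan H C" by (rule R.genideal_minimal)
  moreover have "mspan H C \<subseteq> genideal (class_ring C) H"
  proof -
    interpret I: ideal "genideal (class_ring C) H" "class_ring C"
      using assms by (intro R.genideal_ideal) simp
    show ?thesis
      using R.genideal_self[of H] assms I.zero_closed I.a_closed I.I_r_closed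
      by (intro mspan_subset) auto
  qed
  ultimately show ?thesis by blast
qed

lemma (in class_subring) noetherianI:
  assumes "\<And>I. ideal I (class_ring C) \<Longrightarrow> \<exists>A. finite A \<and> A \<subseteq> C \<and> I \<subseteq> mspan A C \<and> A \<subseteq> I"
  shows "noetherian_ring (class_ring C)"
proof -
  interpret R: cring "class_ring C" by (rule cring)
  show ?thesis
  proof (rule R.noetherian_ringI)
    fix I assume I: "ideal I (class_ring C)"
    obtain A where A: "finite A" "A \<subseteq> C" "I \<subseteq> mspan A C" "A \<subseteq> I" using assms[OF I] by blast
    then have "I = genideal (class_ring C) A"
      using genideal_eq_mspan[OF A(2)] R.genideal_minimal[OF I A(4)] by blast
    then show "\<exists>A\<subseteq>carrier (class_ring C). finite A \<and> I = genideal (class_ring C) A"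
      using A by auto
  qed
qed

lemma (in class_subring) noetherianD:
  assumes "noetherian_ring (class_ring C)" "ideal I (class_ring C)"
  shows "\<exists>A. finite A \<and> A \<subseteq> C \<and> I = mspan A C"
  using noetherian_ring.finetely_gen[OF assms] genideal_eq_mspan by (metis class_ring_simps(1))

subsection \<open>Polynomials with coefficients in a subset\<close>

text \<open>\<open>M\<close> is an arbitrary subset: the coefficients are taken from a subring in
  some places and from a mere module in others.\<close>

definition coeffs_in :: "'r::comm_ring_1 set \<Rightarrow> 'r poly \<Rightarrow> bool" where
  "coeffs_in M p \<longleftrightarrow> (\<forall>i. coeff p i \<in> M)"

lemma coeffs_inD: "coeffs_in M p \<Longrightarrow> coeff p i \<in> M"
  by (simp add: coeffs_in_def)

lemma coeffs_in_mono: "coeffs_in M p \<Longrightarrow> M \<subseteq> N \<Longrightarrow> coeffs_in N p"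
  by (auto simp: coeffs_in_def)

lemma coeffs_in_add: "coeffs_in M p \<Longrightarrow> coeffs_in M q \<Longrightarrow>
    (\<And>a b. a \<in> M \<Longrightarrow> b \<in> M \<Longrightarrow> a + b \<in> M) \<Longrightarrow> coeffs_in M (p + q)"
  by (simp add: coeffs_in_def)

lemma coeffs_in_monom: "0 \<in> M \<Longrightarrow> a \<in> M \<Longrightarrow> coeffs_in M (monom a n)"
  by (simp add: coeffs_in_def)

lemma coeffs_in_smult: "coeffs_in M p \<Longrightarrow> (\<And>m. m \<in> M \<Longrightarrow> c * m \<in> N) \<Longrightarrow> coeffs_in N (smult c p)"
  by (simp add: coeffs_in_def)

lemma coeffs_in_mult:
  assumes "coeffs_in M p" "coeffs_in N q" "0 \<in> J" "\<And>a b. a \<in> J \<Longrightarrow> b \<in> J \<Longrightarrow> a + b \<in> J"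
    and "\<And>a b. a \<in> M \<Longrightarrow> b \<in> N \<Longrightarrow> a * b \<in> J"
  shows "coeffs_in J (p * q)"
proof -
  have sum: "sum f I \<in> J" if "\<And>i. i \<in> I \<Longrightarrow> f i \<in> J" for f and I :: "nat set"
    using that by (induction I rule: infinite_finite_induct) (simp_all add: assms(3,4))
  show ?thesis unfolding coeffs_in_def coeff_mult
    using assms(1,2,5) by (intro allI sum) (simp add: coeffs_in_def)
qed

lemma coeffs_in_pCons: "coeffs_in M (pCons a p) \<longleftrightarrow> a \<in> M \<and> coeffs_in M p"
  unfolding coeffs_in_def by (auto simp: coeff_pCons split: nat.splits)

context class_subring
begin

lemma coeffs_in_ring:
  "coeffs_in C 0" "a \<in> C \<Longrightarrow> coeffs_in C (monom a n)" "a \<in> C \<Longrightarrow> coeffs_in C [:a:]"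
  "coeffs_in C p \<Longrightarrow> coeffs_in C q \<Longrightarrow> coeffs_in C (p + q)"
  "coeffs_in C p \<Longrightarrow> coeffs_in C q \<Longrightarrow> coeffs_in C (p - q)"
  "coeffs_in C p \<Longrightarrow> coeffs_in C q \<Longrightarrow> coeffs_in C (p * q)"
  "a \<in> C \<Longrightarrow> coeffs_in C p \<Longrightarrow> coeffs_in C (smult a p)"
proof -
  show "coeffs_in C p \<Longrightarrow> coeffs_in C q \<Longrightarrow> coeffs_in C (p * q)"
    by (rule coeffs_in_mult) auto
  show "a \<in> C \<Longrightarrow> coeffs_in C [:a:]" by (simp add: coeffs_in_pCons) (simp add: coeffs_in_def)
  show "coeffs_in C p \<Longrightarrow> coeffs_in C q \<Longrightarrow> coeffs_in C (p - q)"
    using add_mem[OF _ uminus_mem] by (force simp: coeffs_in_def)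
qed (auto simp: coeffs_in_def)

lemma poly_mem: "coeffs_in C p \<Longrightarrow> x \<in> C \<Longrightarrow> poly p x \<in> C"
  by (auto simp: poly_altdef coeffs_in_def)

end

text \<open>Negation is not a rule; it comes from \<open>- 1\<close> when \<open>K\<close> is a
  subring.\<close>

inductive_set adjoin :: "'r::comm_ring_1 set \<Rightarrow> 'r set \<Rightarrow> 'r set" for K S where
  base: "a \<in> K \<union> S \<Longrightarrow> a \<in> adjoin K S"
| add: "a \<in> adjoin K S \<Longrightarrow> b \<in> adjoin K S \<Longrightarrow> a + b \<in> adjoin K S"
| mult: "a \<in> adjoin K S \<Longrightarrow> b \<in> adjoin K S \<Longrightarrow> a * b \<in> adjoin K S"

lemma (in class_subring) adjoin_subset:
  assumes "K \<subseteq> C" "S \<subseteq> C"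
  shows "adjoin K S \<subseteq> C"
proof
  fix a assume "a \<in> adjoin K S"
  then show "a \<in> C" by (induction rule: adjoin.induct) (use assms in auto)
qed

lemma (in class_subring) class_subring_adjoin: "class_subring (adjoin C S)"
proof
  show one: "1 \<in> adjoin C S" by (auto intro: adjoin.base)
  have "- 1 \<in> adjoin C S" by (auto intro: adjoin.base)
  then show "- a \<in> adjoin C S" if "a \<in> adjoin C S" for a
    using adjoin.mult[OF \<open>- 1 \<in> adjoin C S\<close> that] by simp
qed (auto intro: adjoin.add adjoin.mult)

lemma adjoin_mono:
  assumes "K \<subseteq> K'" "S \<subseteq> S'"
  shows "adjoin K S \<subseteq> adjoin K' S'"
proof
  fix a assume "a \<in> adjoin K S"
  then show "a \<in> adjoin K' S'"
    by (induction rule: adjoin.induct) (use assms in \<open>auto intro: adjoin.intros\<close>)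
qed

lemma (in class_subring) adjoin_empty: "adjoin C {} = C"
  using adjoin_subset[of C "{}"] adjoin.base[of _ C "{}"] by blast

lemma (in class_subring) adjoin_insert_subset:
  assumes "K \<subseteq> C" "S \<subseteq> C"
  shows "adjoin K (insert x S) \<subseteq> {poly p x |p. coeffs_in C p}"
proof
  fix a assume "a \<in> adjoin K (insert x S)"
  then show "a \<in> {poly p x |p. coeffs_in C p}"
  proof (induction rule: adjoin.induct)
    case (base a)
    consider "a \<in> C" | "a = x" using base assms by blast
    then show ?case
    proof cases
      case 1
      then show ?thesis using coeffs_in_ring(3)[of a] by (intro CollectI exI[of _ "[:a:]"]) simp
    next
      case 2
      have "coeffs_in C [:0, 1:]" unfolding coeffs_in_pCons by (auto simp: coeffs_in_def)
      then show ?thesis using 2 by (intro CollectI exI[of _ "[:0, 1:]"]) simp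
    qed
  next
    case (add a b)
    then obtain p q where "a = poly p x" "coeffs_in C p" "b = poly q x" "coeffs_in C q" by blast
    then show ?case using coeffs_in_ring(4) by (metis (mono_tags, lifting) CollectI poly_add)
  next
    case (mult a b)
    then obtain p q where "a = poly p x" "coeffs_in C p" "b = poly q x" "coeffs_in C q" by blast
    then show ?case using coeffs_in_ring(6) by (metis (mono_tags, lifting) CollectI poly_mult)
  qed
qed

lemma (in class_subring) adjoin_insert:
  "adjoin C (insert x S) = {poly p x |p. coeffs_in (adjoin C S) p}"
proof -
  interpret A: class_subring "adjoin C S" by (rule class_subring_adjoin)
  interpret B: class_subring "adjoin C (insert x S)" by (rule class_subring_adjoin)
  have 1: "adjoin C S \<subseteq> adjoin C (insert x S)" by (rule adjoin_mono) auto
  have x: "x \<in> adjoin C (insert x S)" by (auto intro: adjoin.base)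
  have "poly p x \<in> adjoin C (insert x S)" if "coeffs_in (adjoin C S) p" for p
    using B.poly_mem[OF coeffs_in_mono[OF that 1] x] .
  moreover have "adjoin C (insert x S) \<subseteq> {poly p x |p. coeffs_in (adjoin C S) p}"
    by (rule A.adjoin_insert_subset) (auto intro: adjoin.base)
  ultimately show ?thesis by blast
qed

section \<open>The Hilbert basis theorem\<close>

text \<open>The element \<open>x\<close> may satisfy relations over \<open>D\<close>, so leading
  coefficients are read off from polynomials representing the elements of \<open>I\<close>. The
  ideals \<open>Ld n\<close> of coefficients at \<open>n\<close> increase with \<open>n\<close> and
  stop growing at some \<open>N\<close>; representatives for generators of \<open>Ld 0\<close>, ...,
  \<open>Ld N\<close> generate \<open>I\<close>.\<close>

lemma (in class_subring) hilbert_basis: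
  assumes D: "class_subring D" and noeth: "noetherian_ring (class_ring D)"
    and C: "C = {poly p x |p. coeffs_in D p}"
  shows "noetherian_ring (class_ring C)"
proof (rule noetherianI)
  interpret D: class_subring D by (rule D)
  fix I assume I: "ideal I (class_ring C)"
  have I0: "0 \<in> I" and I_add: "\<And>a b. a \<in> I \<Longrightarrow> b \<in> I \<Longrightarrow> a + b \<in> I"
    and I_mult: "\<And>c a. c \<in> C \<Longrightarrow> a \<in> I \<Longrightarrow> c * a \<in> I" and IC: "I \<subseteq> C"
    using I unfolding ideal_iff by auto
  have DC: "D \<subseteq> C"
  proof
    fix d assume "d \<in> D"
    then show "d \<in> C" unfolding C using D.coeffs_in_ring(3)[of d]
      by (intro CollectI exI[of _ "[:d:]"]) simp
  qed
  have xC: "x \<in> C"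
    unfolding C by (intro CollectI exI[of _ "[:0, 1:]"]) (simp add: coeffs_in_pCons D.coeffs_in_ring(1))
  \<comment> \<open>The index \<open>n\<close> is a bound for the degree and not the degree itself,
    so that admissible polynomials of index \<open>n\<close> form a \<open>D\<close>-module.\<close>
  define adm where "adm n p \<longleftrightarrow> coeffs_in D p \<and> (\<forall>i>n. coeff p i = 0) \<and> poly p x \<in> I" for n p
  define Ld where "Ld n = {coeff p n |p. adm n p}" for n
  have adm_add: "adm n (p + q)" if "adm n p" "adm n q" for n p q
    using that D.coeffs_in_ring I_add unfolding adm_def by simp
  have adm_smult: "adm n (smult c p)" if "adm n p" "c \<in> D" for n p c
    using that D.coeffs_in_ring I_mult DC unfolding adm_def by auto
  have adm_shift: "adm (k + n) (monom 1 k * p)" if "adm n p" for n p k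
  proof -
    have "x ^ k * poly p x \<in> I" using that I_mult xC power_mem unfolding adm_def by auto
    then show ?thesis
      using that D.coeffs_in_ring unfolding adm_def by (auto simp: coeff_monom_mult poly_monom)
  qed
  have Ld_ideal: "ideal (Ld n) (class_ring D)" for n
    unfolding D.ideal_iff
  proof (intro conjI ballI)
    show "Ld n \<subseteq> D" unfolding Ld_def adm_def by (auto simp: coeffs_in_def)
    have "adm n 0" unfolding adm_def using I0 D.coeffs_in_ring by simp
    then show "0 \<in> Ld n" unfolding Ld_def by (metis (mono_tags, lifting) coeff_0 mem_Collect_eq)
    show "a + b \<in> Ld n" if "a \<in> Ld n" "b \<in> Ld n" for a b
      using that adm_add unfolding Ld_def by (auto simp flip: coeff_add)
    show "c * a \<in> Ld n" if "c \<in> D" "a \<in> Ld n" for a c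
      using that adm_smult unfolding Ld_def by (auto simp flip: coeff_smult)
  qed
  have Ld_step: "Ld n \<subseteq> Ld (k + n)" for k n
  proof
    fix a assume "a \<in> Ld n"
    then obtain p where p: "a = coeff p n" "adm n p" unfolding Ld_def by blast
    then have "a = coeff (monom 1 k * p) (k + n)" by (simp add: coeff_monom_mult)
    then show "a \<in> Ld (k + n)" unfolding Ld_def using adm_shift[OF p(2)] by blast
  qed
  have Ld_mono: "Ld m \<subseteq> Ld n" if "m \<le> n" for m n
    using Ld_step[of m "n - m"] that by simp
  have Un: "ideal (\<Union>n. Ld n) (class_ring D)"
    unfolding D.ideal_iff
  proof (intro conjI ballI)
    show "(\<Union>n. Ld n) \<subseteq> D" "0 \<in> (\<Union>n. Ld n)" using Ld_ideal unfolding D.ideal_iff by blast+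
    show "c * a \<in> (\<Union>n. Ld n)" if "c \<in> D" "a \<in> (\<Union>n. Ld n)" for a c
      using that Ld_ideal unfolding D.ideal_iff by blast
    fix a b assume "a \<in> (\<Union>n. Ld n)" "b \<in> (\<Union>n. Ld n)"
    then obtain m n where "a \<in> Ld m" "b \<in> Ld n" by blast
    then have "a \<in> Ld (max m n)" "b \<in> Ld (max m n)" using Ld_mono by (meson max.cobounded1 max.cobounded2 subsetD)+
    then show "a + b \<in> (\<Union>n. Ld n)" using Ld_ideal unfolding D.ideal_iff by blast
  qed
  obtain A where A: "finite A" "A \<subseteq> D" "(\<Union>n. Ld n) = mspan A D"
    using D.noetherianD[OF noeth Un] by blast
  have "A \<subseteq> (\<Union>n. Ld n)" unfolding A(3) using mspan_base[of _ A 1 D] by auto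
  with \<open>finite A\<close> have "\<exists>n. \<forall>a\<in>A. a \<in> Ld n"
  proof (induction A)
    case (insert a A)
    then obtain n m where "\<forall>a\<in>A. a \<in> Ld n" "a \<in> Ld m" by auto
    then have "\<forall>b\<in>insert a A. b \<in> Ld (max n m)"
      using Ld_mono by (metis insert_iff max.cobounded1 max.cobounded2 subsetD)
    then show ?case by blast
  qed simp
  then obtain N where "A \<subseteq> Ld N" by blast
  have LdN: "Ld n \<subseteq> Ld N" for n
  proof -
    have "mspan A D \<subseteq> Ld N"
    proof (rule mspan_subset)
      show "h * m \<in> Ld N" if "h \<in> A" "m \<in> D" for h m
        using Ld_ideal[of N] \<open>A \<subseteq> Ld N\<close> that unfolding D.ideal_iff
        by (subst mult.commute) blast
    qed (use Ld_ideal[of N] in \<open>auto simp: D.ideal_iff\<close>)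
    then show ?thesis using A(3) by blast
  qed
  have "\<exists>B. finite B \<and> B \<subseteq> D \<and> Ld n = mspan B D" for n
    using D.noetherianD[OF noeth Ld_ideal] .
  then obtain B where B: "\<And>n. finite (B n)" "\<And>n. Ld n = mspan (B n) D" by metis
  define pol where "pol n b = (SOME p. adm n p \<and> coeff p n = b)" for n b
  have pol: "adm n (pol n b) \<and> coeff (pol n b) n = b" if "b \<in> B n" for n b
  proof -
    have "b \<in> Ld n" unfolding B(2) using mspan_base[OF that, of 1 D] by simp
    then have "\<exists>p. adm n p \<and> coeff p n = b" unfolding Ld_def by blast
    then show ?thesis unfolding pol_def by (rule someI_ex)
  qed
  define G where "G = (\<Union>n\<le>N. (\<lambda>b. poly (pol n b) x) ` B n)"
  have G: "finite G" "G \<subseteq> I" using B(1) pol unfolding G_def adm_def by auto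
  have GC: "mspan G C \<subseteq> C" using G IC by (intro mspan_subset) auto
  \<comment> \<open>Above \<open>N\<close> nothing new appears: the coefficient is produced at the
    index \<open>min n N\<close> and moved up to \<open>n\<close> by a power of
    \<open>x\<close>.\<close>
  have lift: "\<exists>q. adm n q \<and> coeff q n = a \<and> poly q x \<in> mspan G C" if "a \<in> Ld n" for a n
  proof -
    define n' where "n' = min n N"
    have n': "n' \<le> n" "n' \<le> N" "Ld n \<subseteq> Ld n'" using LdN by (auto simp: n'_def min_def)
    then have "a \<in> mspan (B n') D" using that B(2) by blast
    then show ?thesis
    proof (induction rule: mspan.induct)
      case zero
      have "adm n 0" unfolding adm_def using I0 D.coeffs_in_ring by simp
      then show ?case by (intro exI[of _ 0]) (simp add: mspan.zero)
    next
      case (step a h m)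
      then obtain q where q: "adm n q" "coeff q n = a" "poly q x \<in> mspan G C" by blast
      define q' where "q' = smult m (monom 1 (n - n') * pol n' h)"
      have "adm n q'" unfolding q'_def
        using adm_smult[OF adm_shift[of n' "pol n' h" "n - n'"] step(3)] pol[OF step(2)] n' by simp
      moreover have "coeff q' n = h * m"
        using n' pol[OF step(2)] unfolding q'_def by (simp add: coeff_monom_mult)
      moreover have "poly q' x = poly (pol n' h) x * (m * x ^ (n - n'))"
        unfolding q'_def by (simp add: poly_monom algebra_simps)
      then have "poly q' x \<in> mspan G C"
        using step n' DC xC unfolding G_def by (auto intro!: mspan_base)
      ultimately show ?case using q adm_add
        by (intro exI[of _ "q' + q"]) (auto intro: mspan_add)
    qed
  qed
  have key: "poly p x \<in> mspan G C" if "coeffs_in D p" "poly p x \<in> I" "\<forall>i\<ge>n. coeff p i = 0" for p n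
    using that
  proof (induction n arbitrary: p)
    case 0
    then have "p = 0" by (simp add: poly_eq_iff)
    then show ?case by (simp add: mspan.zero)
  next
    case (Suc n)
    then have "adm n p" unfolding adm_def by auto
    then obtain q where q: "adm n q" "coeff q n = coeff p n" "poly q x \<in> mspan G C"
      using lift[of "coeff p n" n] unfolding Ld_def by blast
    have "poly q x \<in> I" using q(1) by (simp add: adm_def)
    then have "poly p x + (- 1) * poly q x \<in> I"
      using Suc.prems(2) by (intro I_add I_mult) auto
    moreover have "coeff p i - coeff q i = 0" if "i \<ge> n" for i
      using that q Suc.prems(3) by (cases "i = n") (auto simp: adm_def)
    ultimately have "poly (p - q) x \<in> mspan G C"
      using Suc.prems(1) q(1) D.coeffs_in_ring by (intro Suc.IH) (auto simp: adm_def)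
    then have "poly (p - q) x + poly q x \<in> mspan G C" using q(3) by (rule mspan_add)
    then show ?case by simp
  qed
  have "I \<subseteq> mspan G C"
  proof
    fix a assume a: "a \<in> I"
    then obtain p where p: "a = poly p x" "coeffs_in D p" using IC C by blast
    then show "a \<in> mspan G C" using key[of p "Suc (degree p)"] a by (auto simp: coeff_eq_0)
  qed
  then show "\<exists>A. finite A \<and> A \<subseteq> C \<and> I \<subseteq> mspan A C \<and> A \<subseteq> I" using G IC by blast
qed

locale class_subfield = class_subring +
  assumes inverse_ex: "a \<in> C \<Longrightarrow> a \<noteq> 0 \<Longrightarrow> \<exists>b\<in>C. b * a = 1"

lemma (in class_subfield) noetherian: "noetherian_ring (class_ring C)"
proof (rule noetherianI)
  fix I assume I: "ideal I (class_ring C)"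
  show "\<exists>A. finite A \<and> A \<subseteq> C \<and> I \<subseteq> mspan A C \<and> A \<subseteq> I"
  proof (cases "I \<subseteq> {0}")
    case True
    then show ?thesis by (intro exI[of _ "{}"]) (auto simp: mspan.zero)
  next
    case False
    then obtain a where a: "a \<in> I" "a \<noteq> 0" by blast
    then have "1 \<in> I" using I inverse_ex[of a] unfolding ideal_iff by (metis subsetD)
    moreover have "I \<subseteq> mspan {1} C" using I mspan_base[of 1 "{1}" _ C] unfolding ideal_iff by auto
    ultimately show ?thesis by (intro exI[of _ "{1}"]) auto
  qed
qed

lemma (in class_subfield) noetherian_adjoin:
  assumes "finite S"
  shows "noetherian_ring (class_ring (adjoin C S))"
  using assms
proof (induction S)
  case empty
  then show ?case by (simp add: adjoin_empty noetherian)
next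
  case (insert x S)
  interpret B: class_subring "adjoin C (insert x S)" by (rule class_subring_adjoin)
  show ?case by (rule B.hilbert_basis[OF class_subring_adjoin insert.IH adjoin_insert])
qed

section \<open>Chains of primes and regular sequences\<close>

lemma degree_less_of_coeff_zero: "degree p \<le> m \<Longrightarrow> coeff p m = 0 \<Longrightarrow> 0 < m \<Longrightarrow> degree p < m"
  by (cases "degree p = m") auto

text \<open>Each step multiplies \<open>p\<close> by the leading coefficient of \<open>r\<close>
  before cancelling the top term. Leading coefficients may be zero divisors, so the fall of the
  degree is inferred from a vanishing coefficient, and the degree of the quotient is only bounded
  above.\<close>

lemma (in class_subring) pseudo_division:
  assumes "coeffs_in C p" "coeffs_in C r" "0 < degree r"
  shows "\<exists>k s r'. coeffs_in C s \<and> coeffs_in C r' \<and> smult (lead_coeff r ^ k) p = r * s + r' \<and>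
    degree r' < degree r \<and> degree s \<le> degree p - degree r"
  using assms(1)
proof (induction "degree p" arbitrary: p rule: less_induct)
  case less
  show ?case
  proof (cases "degree p < degree r")
    case True
    then show ?thesis using less.prems coeffs_in_ring(1)
      by (intro exI[of _ 0] exI[of _ p]) (simp add: exI[of _ 0])
  next
    case False
    define b where "b = monom (lead_coeff p) (degree p - degree r)"
    define p1 where "p1 = smult (lead_coeff r) p - b * r"
    have cb: "coeffs_in C b" unfolding b_def
      using less.prems by (intro coeffs_in_ring) (rule coeffs_inD)
    have cr: "lead_coeff r \<in> C" using assms(2) by (rule coeffs_inD)
    have p1: "coeffs_in C p1" unfolding p1_def
      using less.prems cb cr assms(2) by (intro coeffs_in_ring)
    have degb: "degree b \<le> degree p - degree r" unfolding b_def by (rule degree_monom_le)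
    have "degree (b * r) \<le> degree p"
      using degree_mult_le[of b r] degb False by linarith
    then have "degree p1 \<le> degree p"
      unfolding p1_def using degree_smult_le[of "lead_coeff r" p] by (intro degree_diff_le) auto
    moreover have "coeff p1 (degree p) = 0"
    proof -
      have "coeff (b * r) (degree p) = lead_coeff p * lead_coeff r"
        using False by (simp add: b_def coeff_monom_mult)
      then show ?thesis by (simp add: p1_def)
    qed
    ultimately have deg: "degree p1 < degree p"
      using False assms(3) by (intro degree_less_of_coeff_zero) auto
    obtain k s r' where IH: "coeffs_in C s" "coeffs_in C r'"
      "smult (lead_coeff r ^ k) p1 = r * s + r'" "degree r' < degree r"
      "degree s \<le> degree p1 - degree r" using less.hyps[OF deg p1] by blast
    have "smult (lead_coeff r ^ Suc k) p = smult (lead_coeff r ^ k) (p1 + b * r)"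
      unfolding p1_def by (simp add: mult.commute)
    also have "\<dots> = r * (s + smult (lead_coeff r ^ k) b) + r'"
      using IH(3) by (simp add: smult_add_right algebra_simps)
    finally have "smult (lead_coeff r ^ Suc k) p = r * (s + smult (lead_coeff r ^ k) b) + r'" .
    moreover have "coeffs_in C (s + smult (lead_coeff r ^ k) b)"
      using IH(1) cb cr by (intro coeffs_in_ring power_mem)
    moreover have "degree (s + smult (lead_coeff r ^ k) b) \<le> degree p - degree r"
      using IH(5) deg degb degree_smult_le[of "lead_coeff r ^ k" b]
      by (intro degree_add_le) linarith+
    ultimately show ?thesis using IH(2,4) by blast
  qed
qed

text \<open>An element that is algebraic modulo \<open>P\<close> over the subring \<open>D\<close> and does not lie in \<open>P\<close> divides,
  modulo \<open>P\<close>, an element of \<open>D - P\<close>. For two primes \<open>P \<subset> Q\<close> this forces \<open>Q\<close> to contain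
  an element of \<open>D - P\<close>, which is how transcendence degree enters the height bound.\<close>

lemma (in prime_class_subring) exists_multiple_in_subring:
  assumes D: "class_subring D" "D \<subseteq> C" and x: "x \<in> C"
    and p: "coeffs_in D p" "coeff p i \<notin> P" "poly p x \<in> P"
    and q: "coeffs_in D q" "poly q x \<notin> P"
  shows "\<exists>d\<in>D. d \<notin> P \<and> (\<exists>e\<in>C. d - e * poly q x \<in> P)"
proof -
  interpret D: class_subring D by (rule D)
  have polyC: "poly r x \<in> C" if "coeffs_in D r" for r
    using coeffs_in_mono[OF that D(2)] x by (rule poly_mem)
  \<comment> \<open>\<open>Rel\<close> collects the nontrivial relations of \<open>x\<close> modulo
    \<open>P\<close> over \<open>D\<close>, and \<open>Mul\<close> the polynomials whose value is,
    modulo \<open>P\<close>, a multiple of \<open>q(x)\<close> outside \<open>P\<close>. Both are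
    taken of least degree; a \<open>Mul\<close> of positive degree then yields a relation of smaller
    degree as the quotient of \<open>p\<close> by \<open>r\<close>.\<close>
  define Rel where "Rel p \<longleftrightarrow> coeffs_in D p \<and> (\<exists>i. coeff p i \<notin> P) \<and> poly p x \<in> P" for p
  define Mul where "Mul r \<longleftrightarrow> coeffs_in D r \<and> poly r x \<notin> P \<and> (\<exists>e\<in>C. poly r x - e * poly q x \<in> P)" for r
  have "Rel p" using p unfolding Rel_def by blast
  then obtain p where p: "Rel p" and pmin: "\<And>p'. Rel p' \<Longrightarrow> degree p \<le> degree p'"
    using ex_has_least_nat[of Rel p degree] by blast
  have "Mul q" using q unfolding Mul_def by (auto intro!: bexI[of _ 1])
  then obtain r where r: "Mul r" and rmin: "\<And>r'. Mul r' \<Longrightarrow> degree r \<le> degree r'"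
    using ex_has_least_nat[of Mul q degree] by blast
  have lcD: "lead_coeff f \<in> D" if "coeffs_in D f" for f using that by (rule coeffs_inD)
  have dropD: "coeffs_in D (f - monom (lead_coeff f) (degree f))" if "coeffs_in D f" for f
    using that lcD by (intro D.coeffs_in_ring)
  have drop_deg: "degree (f - monom (lead_coeff f) (degree f)) < degree f" if "degree f > 0"
    for f :: "'a poly"
    using that by (intro degree_less_of_coeff_zero degree_diff_le degree_monom_le) auto
  have drop_P: "lead_coeff f * x ^ degree f \<in> P" if "lead_coeff f \<in> P" for f
    using that x P_mult[of "x ^ degree f" "lead_coeff f"] by (auto simp: mult.commute)
  obtain e where e: "e \<in> C" "poly r x - e * poly q x \<in> P" using r unfolding Mul_def by blast
  have rD: "coeffs_in D r" "poly r x \<notin> P" using r by (auto simp: Mul_def)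
  have pD: "coeffs_in D p" "poly p x \<in> P" using p by (auto simp: Rel_def)
  show ?thesis
  proof (cases "degree r = 0")
    case True
    then obtain d where "r = [:d:]" by (rule degree_eq_zeroE)
    then have "d \<in> D" "d \<notin> P" "d - e * poly q x \<in> P"
      using rD e by (auto simp: coeffs_in_pCons)
    then show ?thesis using e(1) by blast
  next
    case False
    \<comment> \<open>A leading coefficient in \<open>P\<close> could be dropped together with its
      term: the value at \<open>x\<close> changes only by an element of \<open>P\<close>, against
      minimality. The same argument serves for \<open>p\<close> below.\<close>
    have lr: "lead_coeff r \<notin> P"
    proof
      assume lr: "lead_coeff r \<in> P"
      define r' where "r' = r - monom (lead_coeff r) (degree r)"
      have eq: "poly r' x = poly r x - lead_coeff r * x ^ degree r"
        by (simp add: r'_def poly_monom)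
      have "poly r' x \<notin> P"
        using rD(2) P_add[OF _ drop_P[OF lr]] unfolding eq by (metis diff_add_cancel)
      moreover have "poly r' x - e * poly q x \<in> P"
        using P_diff[OF e(2) drop_P[OF lr]] unfolding eq by (simp add: algebra_simps)
      ultimately have "Mul r'" unfolding Mul_def r'_def using dropD[OF rD(1)] e(1) by blast
      then show False using rmin[of r'] drop_deg[of r] False unfolding r'_def by simp
    qed
    have lp: "lead_coeff p \<notin> P"
    proof
      assume lp: "lead_coeff p \<in> P"
      obtain i where i: "coeff p i \<notin> P" using p by (auto simp: Rel_def)
      then have "i \<noteq> degree p" using lp by blast
      have "degree p > 0"
      proof (rule ccontr)
        assume "\<not> degree p > 0"
        then have "degree p = 0" by simp
        then have "coeff p i = 0" using \<open>i \<noteq> degree p\<close> by (intro coeff_eq_0) simp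
        then show False using i by simp
      qed
      define p' where "p' = p - monom (lead_coeff p) (degree p)"
      have eq: "poly p' x = poly p x - lead_coeff p * x ^ degree p"
        by (simp add: p'_def poly_monom)
      have "poly p' x \<in> P" unfolding eq using P_diff[OF pD(2) drop_P[OF lp]] .
      moreover have "coeff p' i \<notin> P" using i \<open>i \<noteq> degree p\<close> by (simp add: p'_def)
      ultimately have "Rel p'" unfolding Rel_def p'_def using dropD[OF pD(1)] by blast
      then show False using pmin[of p'] drop_deg[of p] \<open>degree p > 0\<close> unfolding p'_def by simp
    qed
    \<comment> \<open>Otherwise \<open>r\<close> could be pseudo-reduced by \<open>p\<close>, whose
      value lies in \<open>P\<close>, to a \<open>Mul\<close> of smaller degree.\<close>
    have rp: "degree r \<le> degree p"
    proof (rule ccontr)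
      assume "\<not> degree r \<le> degree p"
      then have less: "degree p < degree r" by simp
      define b where "b = monom (lead_coeff r) (degree r - degree p)"
      define r' where "r' = smult (lead_coeff p) r - b * p"
      have cb: "coeffs_in D b" unfolding b_def using lcD[OF rD(1)] by (intro D.coeffs_in_ring)
      have cr': "coeffs_in D r'" unfolding r'_def
        using rD(1) pD(1) lcD cb by (intro D.coeffs_in_ring)
      have "degree (b * p) \<le> degree r"
        using degree_mult_le[of b p] degree_monom_le[of "lead_coeff r" "degree r - degree p"] less
        unfolding b_def by linarith
      then have "degree r' \<le> degree r"
        unfolding r'_def using degree_smult_le[of "lead_coeff p" r] by (intro degree_diff_le) auto
      moreover have "coeff r' (degree r) = 0"
      proof -
        have "coeff (b * p) (degree r) = lead_coeff r * lead_coeff p"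
          using less by (simp add: b_def coeff_monom_mult)
        then show ?thesis by (simp add: r'_def)
      qed
      ultimately have "degree r' < degree r" using False by (intro degree_less_of_coeff_zero) auto
      have eq: "poly r' x = lead_coeff p * poly r x - poly b x * poly p x" by (simp add: r'_def)
      have bp: "poly b x * poly p x \<in> P" using P_mult[OF polyC[OF cb] pD(2)] .
      have lpC: "lead_coeff p \<in> C" using lcD[OF pD(1)] D(2) by blast
      have "lead_coeff p * poly r x \<notin> P"
        using P_prime[OF lpC polyC[OF rD(1)]] lp rD(2) by blast
      then have "poly r' x \<notin> P" using P_add[OF _ bp] unfolding eq by (metis diff_add_cancel)
      moreover have "poly r' x - (lead_coeff p * e) * poly q x \<in> P"
        using P_diff[OF P_mult[OF lpC e(2)] bp] unfolding eq by (simp add: algebra_simps)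
      ultimately have "Mul r'" unfolding Mul_def using cr' lpC e(1) by blast
      then show False using rmin \<open>degree r' < degree r\<close> by fastforce
    qed
    obtain k s r' where d: "coeffs_in D s" "coeffs_in D r'"
      "smult (lead_coeff r ^ k) p = r * s + r'" "degree r' < degree r" "degree s \<le> degree p - degree r"
      using D.pseudo_division[OF pD(1) rD(1)] False by blast
    have lrC: "lead_coeff r \<in> C" using lcD[OF rD(1)] D(2) by blast
    have eq: "poly r' x = lead_coeff r ^ k * poly p x - poly r x * poly s x"
      using arg_cong[OF d(3), of "\<lambda>f. poly f x"] by (simp add: algebra_simps)
    have lkp: "lead_coeff r ^ k * poly p x \<in> P" using P_mult[OF power_mem[OF lrC] pD(2)] .
    \<comment> \<open>Modulo \<open>P\<close> the remainder takes the value
      \<open>- s(x) e q(x)\<close>, so outside \<open>P\<close> it would be a \<open>Mul\<close> of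
      degree below that of \<open>r\<close>.\<close>
    have "poly r' x \<in> P"
    proof (rule ccontr)
      assume *: "poly r' x \<notin> P"
      have "poly r' x - (- (poly s x) * e) * poly q x =
          lead_coeff r ^ k * poly p x - poly s x * (poly r x - e * poly q x)"
        unfolding eq by (simp add: algebra_simps)
      also have "\<dots> \<in> P" using P_diff[OF lkp P_mult[OF polyC[OF d(1)] e(2)]] .
      finally have "Mul r'" unfolding Mul_def using * d(2) polyC[OF d(1)] e(1) by blast
      then show False using rmin d(4) by fastforce
    qed
    then have "poly r x * poly s x \<in> P" using P_diff[OF lkp] unfolding eq by fastforce
    then have sx: "poly s x \<in> P" using P_prime[OF polyC[OF rD(1)] polyC[OF d(1)]] rD(2) by blast
    \<comment> \<open>The remainder does not reach the degree of \<open>p\<close>; if all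
      coefficients of \<open>s\<close> were in \<open>P\<close>, so would be the top coefficient of
      the left side, which is a product of elements outside \<open>P\<close>.\<close>
    have "\<exists>i. coeff s i \<notin> P"
    proof (rule ccontr)
      assume "\<not> ?thesis"
      then have s: "\<And>i. coeff s i \<in> P" by blast
      have "lead_coeff r ^ k * lead_coeff p = coeff (r * s) (degree p) + coeff r' (degree p)"
        using arg_cong[OF d(3), of "\<lambda>f. coeff f (degree p)"] by simp
      also have "coeff r' (degree p) = 0" using d(4) rp by (intro coeff_eq_0) simp
      also have "coeff (r * s) (degree p) + 0 \<in> P"
        unfolding coeff_mult using s coeffs_inD[OF rD(1)] D(2)
        by (auto intro!: P_sum P_mult)
      finally show False
        using P_power[OF lrC lr, of k] P_prime[OF power_mem[OF lrC], of "lead_coeff p" k] lp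
          lcD[OF pD(1)] D(2) by blast
    qed
    then have "Rel s" unfolding Rel_def using d(1) sx by blast
    then have "degree p \<le> degree s" by (rule pmin)
    then show ?thesis using d(5) False rp by simp
  qed
qed

text \<open>The elements of \<open>W\<close> are eliminated one at a time: \<open>f\<close> is read
  as a polynomial in one of them and traded, modulo \<open>P\<close>, for a multiple over the
  others. The multipliers are composed.\<close>

lemma (in prime_class_subring) exists_multiple_in_adjoin:
  assumes K: "class_subring K" "K \<subseteq> C" "S \<subseteq> C" and W: "finite W" "W \<subseteq> C"
    and alg: "\<And>x. x \<in> W \<Longrightarrow> \<exists>p i. coeffs_in (adjoin K S) p \<and> coeff p i \<notin> P \<and> poly p x \<in> P"
    and f: "f \<in> adjoin K (S \<union> W)" "f \<notin> P"
  shows "\<exists>d\<in>adjoin K S. d \<notin> P \<and> (\<exists>e\<in>C. d - e * f \<in> P)"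
  using W alg f
proof (induction W arbitrary: f)
  case empty
  then show ?case by (intro bexI[of _ f] conjI bexI[of _ 1]) auto
next
  case (insert x W)
  interpret K: class_subring K by (rule K)
  let ?D = "adjoin K (S \<union> W)"
  have D: "class_subring ?D" by (rule K.class_subring_adjoin)
  have DC: "?D \<subseteq> C" using K insert.prems by (intro adjoin_subset) auto
  obtain q where q: "f = poly q x" "coeffs_in ?D q"
    using insert.prems(3) K.adjoin_insert[of x "S \<union> W"] by auto
  obtain p i where p: "coeffs_in (adjoin K S) p" "coeff p i \<notin> P" "poly p x \<in> P"
    using insert.prems(2)[of x] by blast
  have "coeffs_in ?D p" using p(1) adjoin_mono[of K K S "S \<union> W"] by (auto intro: coeffs_in_mono)
  then obtain d e where d: "d \<in> ?D" "d \<notin> P" "e \<in> C" "d - e * f \<in> P"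
    using exists_multiple_in_subring[OF D DC _ _ p(2,3) q(2)] insert.prems q(1) by blast
  obtain d' e' where d': "d' \<in> adjoin K S" "d' \<notin> P" "e' \<in> C" "d' - e' * d \<in> P"
    using insert.IH[OF _ _ d(1,2)] insert.prems by blast
  have "d' - (e' * e) * f = (d' - e' * d) + e' * (d - e * f)" by (simp add: algebra_simps)
  also have "\<dots> \<in> P" using d d' by (intro P_add P_mult)
  finally show ?case using d' d(3) by blast
qed

text \<open>For every variable \<open>v\<close> the ring \<open>C\<close> is to be the direct sum of
  the \<open>M v * v^i\<close>, with \<open>M v\<close> a module over the polynomial ring in the
  other variables; \<open>decomp\<close> and \<open>uniq\<close> express existence and uniqueness of
  the expansion. In the application \<open>M v\<close> is spanned by powers of \<open>g\<close> and
  need not be closed under multiplication.\<close>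

locale free_adjoin = class_subring C + K: class_subfield K
  for C K :: "'r::comm_ring_1 set" +
  fixes V :: "'r set" and g :: 'r and M :: "'r \<Rightarrow> 'r set"
  assumes finite_V: "finite V"
    and C_eq: "C = adjoin K (insert g V)"
    and g_integral: "\<exists>p. coeffs_in (adjoin K V) p \<and> lead_coeff p = 1 \<and> poly p g = 0"
    and M_subset: "v \<in> V \<Longrightarrow> M v \<subseteq> C"
    and M_zero: "v \<in> V \<Longrightarrow> 0 \<in> M v"
    and M_add: "v \<in> V \<Longrightarrow> a \<in> M v \<Longrightarrow> b \<in> M v \<Longrightarrow> a + b \<in> M v"
    and M_mult: "v \<in> V \<Longrightarrow> d \<in> adjoin K (V - {v}) \<Longrightarrow> a \<in> M v \<Longrightarrow> d * a \<in> M v"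
    and decomp: "v \<in> V \<Longrightarrow> c \<in> C \<Longrightarrow> \<exists>p. coeffs_in (M v) p \<and> c = poly p v"
    and uniq: "v \<in> V \<Longrightarrow> coeffs_in (M v) p \<Longrightarrow> poly p v = 0 \<Longrightarrow> p = 0"
begin

lemma K_subset: "K \<subseteq> C" and V_subset: "V \<subseteq> C" and g_mem: "g \<in> C"
  unfolding C_eq by (auto intro: adjoin.base)

text \<open>\<open>K[S]\<close> embeds into \<open>C / P\<close>. A largest such \<open>S\<close>
  inside \<open>V\<close> takes the place of a transcendence basis of the residue ring.\<close>

definition indep :: "'r set \<Rightarrow> 'r set \<Rightarrow> bool" where
  "indep P S \<longleftrightarrow> S \<subseteq> V \<and> adjoin K S \<inter> P \<subseteq> {0}"

text \<open>If no variable could be added, every element of \<open>V - S\<close> would be algebraic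
  over \<open>K[S]\<close> modulo \<open>P\<close>, and so would \<open>g\<close>, being integral.
  An element of \<open>Q\<close> outside \<open>P\<close> then divides, modulo \<open>P\<close>, an
  element of \<open>K[S]\<close> outside \<open>P\<close>; that element lies in \<open>Q\<close>, so
  it is 0.\<close>

lemma indep_extend:
  assumes P: "primeideal P (class_ring C)" and Q: "primeideal Q (class_ring C)"
    and PQ: "P \<subset> Q" and S: "indep Q S"
  shows "\<exists>v\<in>V - S. indep P (insert v S)"
proof (rule ccontr)
  interpret P: prime_class_subring C P
    by (intro prime_class_subring.intro prime_class_subring_axioms.intro class_subring_axioms P)
  interpret Q: prime_class_subring C Q
    by (intro prime_class_subring.intro prime_class_subring_axioms.intro class_subring_axioms Q)
  have SV: "S \<subseteq> V" and SQ: "adjoin K S \<inter> Q \<subseteq> {0}" using S by (auto simp: indep_def)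
  assume "\<not> ?thesis"
  then have no: "\<not> indep P (insert v S)" if "v \<in> V - S" for v using that by blast
  \<comment> \<open>The nonzero coefficients of the relation lie in \<open>K[S]\<close>, which meets
    \<open>Q\<close> only in 0; so they are outside \<open>Q\<close>, and a fortiori outside
    \<open>P\<close>.\<close>
  have alg: "\<exists>p i. coeffs_in (adjoin K S) p \<and> coeff p i \<notin> P \<and> poly p v \<in> P" if v: "v \<in> V - S" for v
  proof -
    obtain h where h: "h \<in> adjoin K (insert v S)" "h \<in> P" "h \<noteq> 0"
      using no[OF v] v SV unfolding indep_def by blast
    obtain p where p: "h = poly p v" "coeffs_in (adjoin K S) p"
      using h(1) unfolding K.adjoin_insert by blast
    have "p \<noteq> 0" using p h by auto
    then obtain i where i: "coeff p i \<noteq> 0" by (metis leading_coeff_0_iff)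
    have "coeff p i \<notin> P" using i SQ PQ coeffs_inD[OF p(2), of i] by blast
    then show ?thesis using p h by blast
  qed
  obtain f where f: "f \<in> Q" "f \<notin> P" using PQ by blast
  have fC: "f \<in> C" using f Q.P_subset by blast
  have VK: "adjoin K V \<subseteq> C" using K_subset V_subset by (rule adjoin_subset)
  obtain q where q: "f = poly q g" "coeffs_in (adjoin K V) q"
    using fC unfolding C_eq K.adjoin_insert by blast
  obtain p where p: "coeffs_in (adjoin K V) p" "lead_coeff p = 1" "poly p g = 0"
    using g_integral by blast
  obtain d e where d: "d \<in> adjoin K V" "d \<notin> P" "e \<in> C" "d - e * f \<in> P"
    using P.exists_multiple_in_subring[OF K.class_subring_adjoin VK g_mem p(1), of "degree p" q]
      p P.P_one q f(2) by auto
  have "S \<union> (V - S) = V" "S \<subseteq> C" "V - S \<subseteq> C" using SV V_subset by blast+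
  then obtain d' e' where d': "d' \<in> adjoin K S" "d' \<notin> P" "e' \<in> C" "d' - e' * d \<in> P"
    using P.exists_multiple_in_adjoin[OF K.class_subring_axioms K_subset, of S "V - S" d]
      alg d finite_V by auto
  have "d \<in> Q"
    using Q.P_add[of "d - e * f" "e * f"] Q.P_mult[OF d(3) f(1)] d(4) PQ by auto
  then have "d' \<in> Q"
    using Q.P_add[of "d' - e' * d" "e' * d"] Q.P_mult[OF d'(3)] d'(4) PQ by auto
  then have "d' = 0" using SQ d'(1) by blast
  then show False using d'(2) by simp
qed

text \<open>Descending along the chain, every strict inclusion makes room for one further variable
  in an independent set, and there are only \<open>card V\<close> variables.\<close>

lemma prime_chain_length:
  assumes C: "\<And>i. i \<le> l \<Longrightarrow> primeideal (c i) (class_ring C) \<and> c i \<subseteq> Q" "\<And>i. i < l \<Longrightarrow> c i \<subset> c (Suc i)"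
    and S: "indep Q S"
  shows "l \<le> card V - card S"
proof -
  have "\<exists>T. indep (c (l - j)) T \<and> card T = card S + j" if "j \<le> l" for j
    using that
  proof (induction j)
    case 0
    then show ?case using S C(1)[of l] unfolding indep_def by (intro exI[of _ S]) auto
  next
    case (Suc j)
    then obtain T where T: "indep (c (l - j)) T" "card T = card S + j" by auto
    have l: "Suc (l - Suc j) = l - j" "l - Suc j < l" using Suc.prems by auto
    have "\<exists>v\<in>V - T. indep (c (l - Suc j)) (insert v T)"
      using C(1)[of "l - Suc j"] C(1)[of "l - j"] C(2)[of "l - Suc j"] T(1) l
      by (intro indep_extend[of _ "c (l - j)"]) auto
    then obtain v where "v \<in> V - T" "indep (c (l - Suc j)) (insert v T)" by blast
    moreover have "finite T" using T(1) finite_V finite_subset unfolding indep_def by blast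
    ultimately show ?case using T(2) by (intro exI[of _ "insert v T"]) auto
  qed
  from this[of l] obtain T where "T \<subseteq> V" "card T = card S + l" unfolding indep_def by auto
  then show ?thesis using card_mono[OF finite_V, of T] by linarith
qed

text \<open>Elements of \<open>H\<close> do not involve \<open>v\<close>, so multiplication by them
  respects expansions in powers of \<open>v\<close>: membership in the ideal generated by
  \<open>H\<close> can be tested coefficientwise, in \<open>H (M v)\<close>.\<close>

lemma mspan_decomp:
  assumes v: "v \<in> V" and H: "H \<subseteq> adjoin K (V - {v})" and f: "f \<in> mspan H C"
  shows "\<exists>q. coeffs_in (mspan H (M v)) q \<and> f = poly q v"
  using f
proof (induction rule: mspan.induct)
  case zero
  then show ?case by (intro exI[of _ 0]) (simp add: coeffs_in_def mspan.zero)
next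
  case (step a h m)
  then obtain q where q: "coeffs_in (mspan H (M v)) q" "a = poly q v" by blast
  obtain p where p: "coeffs_in (M v) p" "m = poly p v" using decomp[OF v step(3)] by blast
  have "coeffs_in (mspan H (M v)) (smult h p + q)"
    using p q step(2) by (auto intro!: coeffs_in_add mspan_add coeffs_in_smult[OF p(1)] mspan_base)
  moreover have "h * m + a = poly (smult h p + q) v" using p q by simp
  ultimately show ?case by blast
qed

lemma mspan_poly:
  assumes v: "v \<in> V" and q: "coeffs_in (mspan H (M v)) q"
  shows "poly q v \<in> mspan H C"
proof -
  have t: "coeff q i * v ^ i \<in> mspan H C" for i
  proof -
    have "v ^ i * coeff q i \<in> mspan H C"
      using coeffs_inD[OF q] by (rule mspan_mult) (use M_subset[OF v] V_subset v in auto)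
    then show ?thesis by (simp add: mult.commute)
  qed
  have sum: "sum f I \<in> mspan H C" if "\<And>i. f i \<in> mspan H C" for f and I :: "nat set"
    using that by (induction I rule: infinite_finite_induct) (simp_all add: mspan.zero mspan_add)
  show ?thesis unfolding poly_altdef by (rule sum) (rule t)
qed

text \<open>Comparing leading coefficients with respect to \<open>v\<close> kills the top term of \<open>f\<close> after
  multiplication by the leading coefficient of \<open>c\<close>.\<close>

lemma regular_up_to_lead_coeff:
  assumes v: "v \<in> V" and H: "H \<subseteq> adjoin K (V - {v})" and c: "coeffs_in (adjoin K (V - {v})) c"
    and f: "f \<in> C" "poly c v * f \<in> mspan H C"
  shows "\<exists>k. lead_coeff c ^ k * f \<in> mspan H C"
proof -
  let ?D = "adjoin K (V - {v})"
  let ?J = "mspan H (M v)"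
  have D: "class_subring ?D" by (rule K.class_subring_adjoin)
  interpret D: class_subring ?D by (rule D)
  have DC: "?D \<subseteq> C" using K_subset V_subset by (intro adjoin_subset) auto
  have lc: "lead_coeff c \<in> ?D" using c by (rule coeffs_inD)
  have JM: "?J \<subseteq> M v"
    using M_zero[OF v] M_add[OF v] M_mult[OF v] H by (intro mspan_subset) auto
  have M_diff: "a - b \<in> M v" if "a \<in> M v" "b \<in> M v" for a b
    using M_add[OF v that(1) M_mult[OF v _ that(2), of "- 1"]] D.uminus_mem[OF D.one_mem] by simp
  have key: "\<exists>k. lead_coeff c ^ k * poly p v \<in> mspan H C"
    if "coeffs_in (M v) p" "poly c v * poly p v \<in> mspan H C" "\<forall>i\<ge>n. coeff p i = 0" for p n
    using that
  proof (induction n arbitrary: p)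
    case 0
    then have "p = 0" by (simp add: poly_eq_iff)
    then show ?case by (simp add: mspan.zero)
  next
    case (Suc n)
    obtain q where q: "coeffs_in ?J q" "poly c v * poly p v = poly q v"
      using mspan_decomp[OF v H Suc.prems(2)] by blast
    have cp: "coeffs_in (M v) (c * p)"
      using c Suc.prems(1) by (rule coeffs_in_mult) (use M_zero[OF v] M_add[OF v] M_mult[OF v] in auto)
    \<comment> \<open>Only the values at \<open>v\<close> are known to agree; uniqueness of
      expansions turns this into an identity of polynomials, whose coefficients can be
      compared.\<close>
    have "coeffs_in (M v) (c * p - q)"
      using cp coeffs_in_mono[OF q(1) JM] M_diff by (simp add: coeffs_in_def)
    then have "c * p - q = 0" by (rule uniq[OF v]) (simp add: q(2))
    then have cpq: "c * p = q" by simp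
    have "coeff (c * p) (degree c + n) = lead_coeff c * coeff p n"
    proof -
      have "coeff c i * coeff p (degree c + n - i) = 0" if "i \<noteq> degree c" for i
      proof (cases "i < degree c")
        case True
        then have "Suc n \<le> degree c + n - i" by simp
        then show ?thesis using Suc.prems(3) by simp
      next
        case False
        then show ?thesis using that by (simp add: coeff_eq_0)
      qed
      then have "(\<Sum>i\<le>degree c + n. coeff c i * coeff p (degree c + n - i)) =
          (\<Sum>i\<in>{degree c}. coeff c i * coeff p (degree c + n - i))"
        by (intro sum.mono_neutral_right) auto
      then show ?thesis by (simp add: coeff_mult)
    qed
    then have top: "lead_coeff c * coeff p n \<in> ?J" using coeffs_inD[OF q(1)] cpq by metis
    define t where "t = monom (lead_coeff c * coeff p n) n"
    define p' where "p' = smult (lead_coeff c) p - t"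
    have t: "poly t v \<in> mspan H C"
      unfolding t_def using top by (intro mspan_poly[OF v] coeffs_in_monom) (auto intro: mspan.zero)
    have eq: "poly p' v = lead_coeff c * poly p v - poly t v" by (simp add: p'_def)
    have "coeffs_in (M v) p'"
      unfolding p'_def coeffs_in_def t_def
      using M_diff M_mult[OF v lc] Suc.prems(1) M_zero[OF v] by (auto simp: coeffs_in_def)
    moreover have "poly c v * poly p' v \<in> mspan H C"
    proof -
      have "poly c v \<in> C" using poly_mem[OF coeffs_in_mono[OF c DC]] V_subset v by blast
      then have 1: "(- poly c v) * poly t v \<in> mspan H C"
        using t by (intro mspan_mult[OF t]) auto
      have 2: "lead_coeff c * (poly c v * poly p v) \<in> mspan H C"
        using lc DC by (intro mspan_mult[OF Suc.prems(2)]) auto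
      have "poly c v * poly p' v = lead_coeff c * (poly c v * poly p v) + (- poly c v) * poly t v"
        unfolding eq by (simp add: algebra_simps)
      then show ?thesis using mspan_add[OF 2 1] by simp
    qed
    moreover have "\<forall>i\<ge>n. coeff p' i = 0"
      using Suc.prems(3) unfolding p'_def t_def by auto
    ultimately obtain k where k: "lead_coeff c ^ k * poly p' v \<in> mspan H C" using Suc.IH by blast
    have "lead_coeff c ^ k * poly t v \<in> mspan H C"
      using lc DC by (intro mspan_mult[OF t]) (auto intro!: mult_mem)
    then have "lead_coeff c ^ k * poly p' v + lead_coeff c ^ k * poly t v \<in> mspan H C"
      using k by (intro mspan_add)
    then have "lead_coeff c ^ Suc k * poly p v \<in> mspan H C"
      unfolding eq by (simp add: algebra_simps)
    then show ?case by blast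
  qed
  obtain p where "coeffs_in (M v) p" "f = poly p v" using decomp[OF v f(1)] by blast
  then show ?thesis using key[of p "Suc (degree p)"] f(2) by (auto simp: coeff_eq_0)
qed

theorem cm_data_exists:
  assumes Q: "primeideal Q (class_ring C)"
  shows "\<exists>xs. cm_data (class_ring C) Q xs"
proof -
  interpret Q: prime_class_subring C Q
    by (intro prime_class_subring.intro prime_class_subring_axioms.intro class_subring_axioms Q)
  have "adjoin K {} \<inter> Q \<subseteq> {0}"
  proof -
    have "k = 0" if k: "k \<in> K" "k \<in> Q" for k
    proof (rule ccontr)
      assume "k \<noteq> 0"
      then obtain l where "l \<in> K" "l * k = 1" using K.inverse_ex k by blast
      then have "1 \<in> Q" using Q.P_mult[of l k] k K_subset by auto
      then show False using Q.P_one by simp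
    qed
    then show ?thesis unfolding K.adjoin_empty by blast
  qed
  then have "indep Q {}" by (simp add: indep_def)
  moreover have "card S \<le> card V" if "indep Q S" for S
    using that card_mono[OF finite_V] unfolding indep_def by blast
  ultimately obtain S where S: "indep Q S" and Smax: "\<And>T. indep Q T \<Longrightarrow> card T \<le> card S"
    using ex_has_greatest_nat[of "indep Q" "{}" card "Suc (card V)"] by (auto simp: le_imp_less_Suc)
  have SV: "S \<subseteq> V" and SQ: "adjoin K S \<inter> Q \<subseteq> {0}" using S by (auto simp: indep_def)
  have finS: "finite S" using SV finite_V by (rule finite_subset)
  have "\<exists>c. coeffs_in (adjoin K S) c \<and> c \<noteq> 0 \<and> poly c v \<in> Q" if v: "v \<in> V - S" for v
  proof -
    have "\<not> indep Q (insert v S)" using Smax[of "insert v S"] v finS by auto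
    then obtain h where h: "h \<in> adjoin K (insert v S)" "h \<in> Q" "h \<noteq> 0"
      using v SV unfolding indep_def by blast
    then show ?thesis unfolding K.adjoin_insert by (auto intro: exI)
  qed
  then obtain c where c: "\<And>v. v \<in> V - S \<Longrightarrow> coeffs_in (adjoin K S) (c v)"
    "\<And>v. v \<in> V - S \<Longrightarrow> c v \<noteq> 0" "\<And>v. v \<in> V - S \<Longrightarrow> poly (c v) v \<in> Q" by metis
  \<comment> \<open>A nonzero element of \<open>K[S]\<close> is outside \<open>Q\<close>, so it is
    one of the factors that the certificate tolerates.\<close>
  have lcC: "lead_coeff (c v) \<in> C" and lcQ: "lead_coeff (c v) \<notin> Q" if v: "v \<in> V - S" for v
  proof -
    have "lead_coeff (c v) \<in> adjoin K S" using c(1)[OF v] by (rule coeffs_inD)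
    moreover have "lead_coeff (c v) \<noteq> 0" using c(2)[OF v] by simp
    ultimately show "lead_coeff (c v) \<notin> Q" "lead_coeff (c v) \<in> C"
      using SQ adjoin_subset[OF K_subset, of S] SV V_subset by blast+
  qed
  obtain vs where vs: "set vs = V - S" "distinct vs"
    using finite_distinct_list[of "V - S"] finite_V by blast
  define h where "h v = poly (c v) v" for v
  have hQ: "h v \<in> Q" if "v \<in> V - S" for v using c(3)[OF that] by (simp add: h_def)
  \<comment> \<open>The element \<open>h w\<close> involves only \<open>w\<close> and
    \<open>S\<close>. With respect to \<open>v\<close> all other members of the sequence are
    therefore constants, which is why the sequence is regular in any order.\<close>
  have h_mem: "h w \<in> adjoin K (V - {v})" if "v \<in> V - S" "w \<in> V - S" "w \<noteq> v" for v w
  proof -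
    have "h w \<in> adjoin K (insert w S)" unfolding h_def K.adjoin_insert using c(1)[OF that(2)] by blast
    then show ?thesis using adjoin_mono[of K K "insert w S" "V - {v}"] that SV by blast
  qed
  have "cm_data (class_ring C) Q (map h vs)"
    unfolding cm_data_def
  proof (intro conjI allI impI ballI)
    show "set (map h vs) \<subseteq> Q" using hQ vs by auto
  next
    fix i a assume i: "i < length (map h vs)" and a: "a \<in> carrier (class_ring C)"
      and m: "map h vs ! i \<otimes>\<^bsub>class_ring C\<^esub> a \<in> genideal (class_ring C) (set (take i (map h vs)))"
    let ?H = "set (take i (map h vs))"
    define v where "v = vs ! i"
    have i': "i < length vs" using i by simp
    have v: "v \<in> V - S" using nth_mem[OF i'] unfolding vs(1) v_def .
    have Hsub: "?H \<subseteq> h ` (V - S - {v})"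
    proof
      fix y assume "y \<in> ?H"
      then obtain j where j: "j < i" "y = h (vs ! j)"
        using i' by (auto simp: in_set_conv_nth)
      then have j': "j < length vs" using i' by simp
      have "vs ! j \<noteq> v" using j(1) i' j' vs(2) unfolding v_def by (simp add: nth_eq_iff_index_eq)
      moreover have "vs ! j \<in> V - S" using nth_mem[OF j'] unfolding vs(1) .
      moreover note j(2)
      ultimately show "y \<in> h ` (V - S - {v})" by blast
    qed
    then have H: "?H \<subseteq> adjoin K (V - {v})" using h_mem[OF v] by blast
    have HC: "?H \<subseteq> C" using Hsub hQ Q.P_subset by blast
    have "adjoin K S \<subseteq> adjoin K (V - {v})" using SV v by (intro adjoin_mono) auto
    then have cv: "coeffs_in (adjoin K (V - {v})) (c v)" using c(1)[OF v] coeffs_in_mono by blast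
    have "poly (c v) v * a \<in> mspan ?H C"
      using m i unfolding genideal_eq_mspan[OF HC] by (simp add: v_def h_def)
    then obtain k where k: "lead_coeff (c v) ^ k * a \<in> mspan ?H C"
      using regular_up_to_lead_coeff[OF _ H cv] v a by auto
    have "lead_coeff (c v) ^ k \<in> C - Q"
      using Q.P_power[OF lcC[OF v] lcQ[OF v]] power_mem[OF lcC[OF v]] by blast
    then show "\<exists>u\<in>carrier (class_ring C) - Q. u \<otimes>\<^bsub>class_ring C\<^esub> a \<in> genideal (class_ring C) ?H"
      using k unfolding genideal_eq_mspan[OF HC] by auto
  next
    fix ch l assume ch: "\<forall>i\<le>l. primeideal (ch i) (class_ring C) \<and> ch i \<subseteq> Q"
      "\<forall>i<l. ch i \<subset> ch (Suc i)"
    have "l \<le> card V - card S"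
      by (rule prime_chain_length[of l ch, OF _ _ S]) (use ch in blast)+
    also have "\<dots> = length (map h vs)"
      using distinct_card[OF vs(2)] vs(1) card_Diff_subset[OF finS SV] by simp
    finally show "l \<le> length (map h vs)" .
  qed
  then show ?thesis ..
qed

lemma noetherian: "noetherian_ring (class_ring C)"
  unfolding C_eq using finite_V by (intro K.noetherian_adjoin) simp

end

section \<open>Transport of the certificate along a ring isomorphism\<close>

lemma genideal_ring_iso_iff:
  assumes S: "cring S" and R: "cring R" and h: "h \<in> ring_iso S R"
    and A: "A \<subseteq> carrier S" and s: "s \<in> carrier S"
  shows "h s \<in> genideal R (h ` A) \<longleftrightarrow> s \<in> genideal S A"
proof -
  interpret S: cring S by (rule S)
  interpret R: cring R by (rule R)
  let ?k = "inv_into (carrier S) h"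
  have k: "?k \<in> ring_iso R S" by (rule ring_iso_set_sym[OF S.ring_axioms h])
  interpret h: ring_hom_ring S R h
    using h by (intro ring_hom_ringI2 S.ring_axioms R.ring_axioms) (simp add: ring_iso_def)
  interpret k: ring_hom_ring R S ?k
    using k by (intro ring_hom_ringI2 S.ring_axioms R.ring_axioms) (simp add: ring_iso_def)
  have bij: "bij_betw h (carrier S) (carrier R)" using h by (simp add: ring_iso_def)
  have kh: "?k (h a) = a" if "a \<in> carrier S" for a
    using bij that by (simp add: bij_betw_inv_into_left)
  have hA: "h ` A \<subseteq> carrier R" using A h.hom_closed by blast
  show ?thesis
  proof
    assume "h s \<in> genideal R (h ` A)"
    moreover have "genideal R (h ` A) \<subseteq> {r \<in> carrier R. ?k r \<in> genideal S A}"
    proof (rule R.genideal_minimal)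
      show "ideal {r \<in> carrier R. ?k r \<in> genideal S A} R"
        by (rule k.ideal_vimage[OF S.genideal_ideal[OF A]])
      show "h ` A \<subseteq> {r \<in> carrier R. ?k r \<in> genideal S A}"
      proof clarify
        fix a assume a: "a \<in> A"
        then have "a \<in> genideal S A" "a \<in> carrier S" using A S.genideal_self[OF A] by auto
        then show "h a \<in> carrier R \<and> ?k (h a) \<in> genideal S A" using kh h.hom_closed by simp
      qed
    qed
    ultimately have "?k (h s) \<in> genideal S A" by blast
    then show "s \<in> genideal S A" using kh[OF s] by simp
  next
    assume "s \<in> genideal S A"
    moreover have "genideal S A \<subseteq> {r \<in> carrier S. h r \<in> genideal R (h ` A)}"
    proof (rule S.genideal_minimal)
      show "ideal {r \<in> carrier S. h r \<in> genideal R (h ` A)} S"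
        by (rule h.ideal_vimage[OF R.genideal_ideal[OF hA]])
      show "A \<subseteq> {r \<in> carrier S. h r \<in> genideal R (h ` A)}"
        using A R.genideal_self[OF hA] by blast
    qed
    ultimately show "h s \<in> genideal R (h ` A)" by blast
  qed
qed

lemma cohen_macaulay_ring_iso:
  assumes S: "cring S" "noetherian_ring S" and cm: "\<And>P. primeideal P S \<Longrightarrow> \<exists>xs. cm_data S P xs"
    and h: "h \<in> ring_iso S R" and zero: "h \<zero>\<^bsub>S\<^esub> = \<zero>\<^bsub>R\<^esub>"
  shows "cohen_macaulay_ring R"
proof -
  interpret S: noetherian_ring S by (rule S(2))
  \<comment> \<open>Membership in \<open>ring_iso\<close> concerns one, sum and product; the zero
    field of \<open>R\<close> is identified separately with the image of 0.\<close>
  have "cring (R\<lparr>zero := h \<zero>\<^bsub>S\<^esub>\<rparr>)" by (rule cring.ring_iso_imp_img_cring[OF S(1) h])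
  then have R: "cring R" unfolding zero by simp
  interpret R: cring R by (rule R)
  interpret h: ring_hom_ring S R h
    using h by (intro ring_hom_ringI2 S.ring_axioms R.ring_axioms) (simp add: ring_iso_def)
  have bij: "bij_betw h (carrier S) (carrier R)" using h by (simp add: ring_iso_def)
  have surj: "\<exists>s\<in>carrier S. r = h s" if "r \<in> carrier R" for r
    using bij that unfolding bij_betw_def by blast
  note gen = genideal_ring_iso_iff[OF S(1) R h]
  have sub: "I \<subseteq> J" if "{s \<in> carrier S. h s \<in> I} \<subseteq> {s \<in> carrier S. h s \<in> J}" "I \<subseteq> carrier R" for I J
    using that surj by blast
  show ?thesis
  proof (rule cohen_macaulay_ringI[OF R])
    show "noetherian_ring R"
    proof (rule R.noetherian_ringI)
      fix I assume I: "ideal I R"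
      obtain A where A: "A \<subseteq> carrier S" "finite A" "{s \<in> carrier S. h s \<in> I} = genideal S A"
        using S.finetely_gen[OF h.ideal_vimage[OF I]] by blast
      have hA: "h ` A \<subseteq> carrier R" using A(1) by auto
      have IR: "I \<subseteq> carrier R" using ideal.Icarr[OF I] by blast
      have GR: "genideal R (h ` A) \<subseteq> carrier R"
        using ideal.Icarr[OF R.genideal_ideal[OF hA]] by blast
      have GS: "genideal S A \<subseteq> carrier S" unfolding A(3)[symmetric] by blast
      have e: "{s \<in> carrier S. h s \<in> I} = {s \<in> carrier S. h s \<in> genideal R (h ` A)}"
        unfolding A(3) using gen[OF A(1)] GS by blast
      have "I = genideal R (h ` A)"
      proof (rule subset_antisym)
        show "I \<subseteq> genideal R (h ` A)" by (rule sub[OF _ IR]) (simp add: e)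
        show "genideal R (h ` A) \<subseteq> I" by (rule sub[OF _ GR]) (simp add: e)
      qed
      then show "\<exists>A\<subseteq>carrier R. finite A \<and> I = genideal R A" using A(2) hA by blast
    qed
  next
    fix P assume P: "primeideal P R"
    define Q where "Q = {s \<in> carrier S. h s \<in> P}"
    have "primeideal Q S" unfolding Q_def by (rule h.primeideal_vimage[OF S(1) P])
    then obtain xs where xs: "cm_data S Q xs" using cm by blast
    then have xsQ: "set xs \<subseteq> Q" by (simp add: cm_data_def)
    then have xsS: "set xs \<subseteq> carrier S" unfolding Q_def by blast
    have PR: "P \<subseteq> carrier R" using ideal.Icarr[OF primeideal.axioms(1)[OF P]] by blast
    have "cm_data R P (map h xs)"
      unfolding cm_data_def
    proof (intro conjI allI impI ballI)
      show "set (map h xs) \<subseteq> P" using xsQ unfolding Q_def by auto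
    next
      fix i a assume i: "i < length (map h xs)" and a: "a \<in> carrier R"
        and m: "map h xs ! i \<otimes>\<^bsub>R\<^esub> a \<in> genideal R (set (take i (map h xs)))"
      let ?A = "set (take i xs)"
      have A: "?A \<subseteq> carrier S" using xsS set_take_subset[of i xs] by blast
      have st: "set (take i (map h xs)) = h ` ?A" by (simp add: take_map)
      obtain b where b: "b \<in> carrier S" "a = h b" using surj[OF a] by blast
      have i': "i < length xs" using i by simp
      have xi: "xs ! i \<in> carrier S" using nth_mem[OF i'] xsS by blast
      have "h (xs ! i \<otimes>\<^bsub>S\<^esub> b) \<in> genideal R (h ` ?A)"
        using m i' b xi unfolding st by simp
      then have "xs ! i \<otimes>\<^bsub>S\<^esub> b \<in> genideal S ?A"
        using gen[OF A, of "xs ! i \<otimes>\<^bsub>S\<^esub> b"] xi b by simp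
      then obtain u where u: "u \<in> carrier S - Q" "u \<otimes>\<^bsub>S\<^esub> b \<in> genideal S ?A"
        using xs i' b(1) unfolding cm_data_def by blast
      then have "h (u \<otimes>\<^bsub>S\<^esub> b) \<in> genideal R (h ` ?A)" using b by (intro iffD2[OF gen[OF A]]) auto
      moreover have "h (u \<otimes>\<^bsub>S\<^esub> b) = h u \<otimes>\<^bsub>R\<^esub> a" using u(1) b by simp
      moreover have "h u \<in> carrier R - P" using u(1) unfolding Q_def by auto
      ultimately show "\<exists>u\<in>carrier R - P. u \<otimes>\<^bsub>R\<^esub> a \<in> genideal R (set (take i (map h xs)))"
        unfolding st by metis
    next
      fix C l assume C: "\<forall>i\<le>l. primeideal (C i) R \<and> C i \<subseteq> P" "\<forall>i<l. C i \<subset> C (Suc i)"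
      let ?C = "\<lambda>i. {s \<in> carrier S. h s \<in> C i}"
      have ch: "\<forall>C l. (\<forall>i\<le>l. primeideal (C i) S \<and> C i \<subseteq> Q) \<longrightarrow> (\<forall>i<l. C i \<subset> C (Suc i)) \<longrightarrow>
          l \<le> length xs"
        using xs unfolding cm_data_def by (elim conjE)
      have c1: "\<forall>i\<le>l. primeideal (?C i) S \<and> ?C i \<subseteq> Q"
        using C(1) h.primeideal_vimage[OF S(1)] unfolding Q_def by blast
      have c2: "?C i \<subset> ?C (Suc i)" if "i < l" for i
      proof -
        have "C (Suc i) \<subseteq> P" using C(1) that by simp
        then have "C i \<subset> C (Suc i)" "C (Suc i) \<subseteq> carrier R" using C(2) PR that by auto
        then show ?thesis using sub[of "C (Suc i)" "C i"] by blast
      qed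
      have "l \<le> length xs" by (rule ch[THEN spec, THEN spec, THEN mp, THEN mp, OF c1]) (simp add: c2)
      then show "l \<le> length (map h xs)" by simp
    qed
    then show "\<exists>xs. cm_data R P xs" ..
  qed
qed

section \<open>Rings of functions\<close>

definition constants :: "('x \<Rightarrow> 'a) set" where
  "constants = range (\<lambda>c _. c)"

lemma const_mem [simp]: "(\<lambda>_. c) \<in> constants"
  by (auto simp: constants_def)

lemma class_subfield_constants: "class_subfield (constants :: ('x \<Rightarrow> 'a::field) set)"
proof
  fix a b :: "'x \<Rightarrow> 'a" assume a: "a \<in> constants"
  then obtain c where c: "a = (\<lambda>_. c)" by (auto simp: constants_def)
  have "- a = (\<lambda>_. - c)" by (auto simp: c)
  then show "- a \<in> constants" by simp
  show "\<exists>b\<in>constants. b * a = 1" if "a \<noteq> 0"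
    using that c by (intro bexI[of _ "\<lambda>_. inverse c"]) (auto simp: fun_eq_iff)
  assume "b \<in> constants"
  then obtain d where d: "b = (\<lambda>_. d)" by (auto simp: constants_def)
  have "a + b = (\<lambda>_. c + d)" "a * b = (\<lambda>_. c * d)" by (auto simp: c d)
  then show "a + b \<in> constants" "a * b \<in> constants" by simp_all
qed (use const_mem[of 1] in \<open>simp add: one_fun_def\<close>)

interpretation constants: class_subfield "constants :: ('x \<Rightarrow> 'a::field) set"
  by (rule class_subfield_constants)

lemma poly_fun_apply:
  fixes p :: "('x \<Rightarrow> 'a::comm_ring_1) poly"
  shows "poly p f z = poly (map_poly (\<lambda>h. h z) p) (f z)"
proof (induction p)
  case (pCons a p)
  then show ?case by (simp add: Polynomial.map_poly_pCons)
qed simp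

lemma adjoin_constants_cong:
  assumes "a \<in> adjoin constants S" and "\<And>s. s \<in> S \<Longrightarrow> s z = s z'"
  shows "a z = a z'"
  using assms(1) by (induction rule: adjoin.induct) (auto simp: assms(2) constants_def)

text \<open>By \<open>surj\<close> a point can be moved in the coordinate \<open>v\<close> alone.
  The coefficients of \<open>p\<close> depend on the other coordinates and stay fixed, so at each
  point an ordinary polynomial vanishes on the whole infinite field.\<close>

lemma transcendental_coordinate:
  fixes V :: "('x \<Rightarrow> 'a::field) set"
  assumes inf: "infinite (UNIV :: 'a set)"
    and surj: "\<And>w. \<exists>z. \<forall>v\<in>V. v z = w v"
    and v: "v \<in> V" and p: "coeffs_in (adjoin constants (V - {v})) p" "poly p v = 0"
  shows "p = 0"
proof -
  have "coeff p i z = 0" for i z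
  proof -
    define q where "q = map_poly (\<lambda>h. h z) p"
    have "poly q t = 0" for t
    proof -
      obtain z' where z': "\<And>u. u \<in> V \<Longrightarrow> u z' = (if u = v then t else u z)"
        using surj[of "\<lambda>u. if u = v then t else u z"] by blast
      have "map_poly (\<lambda>h. h z') p = q"
        unfolding q_def
      proof (rule poly_eqI)
        fix i
        have "coeff p i z' = coeff p i z"
          using coeffs_inD[OF p(1), of i] 
        proof (rule adjoin_constants_cong)
          fix s assume "s \<in> V - {v}"
          then show "s z' = s z" using z'[of s] by simp
        qed
        then show "coeff (map_poly (\<lambda>h. h z') p) i = coeff (map_poly (\<lambda>h. h z) p) i"
          by (simp add: coeff_map_poly)
      qed
      then have "poly p v z' = poly q t" using z'[OF v] by (simp add: poly_fun_apply)
      then show ?thesis by (simp add: p(2))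
    qed
    then have "{x. poly q x = 0} = UNIV" by auto
    then have "q = 0" using poly_roots_finite[of q] inf by fastforce
    then have "coeff q i = 0" by simp
    then show ?thesis by (simp add: q_def coeff_map_poly)
  qed
  then show ?thesis by (intro poly_eqI) (simp add: fun_eq_iff)
qed

lemma degree_less_of_coeffs: "0 < m \<Longrightarrow> (\<And>k. m \<le> k \<Longrightarrow> coeff p k = 0) \<Longrightarrow> degree p < m"
  using degree_le[of "m - 1" p] by (simp add: Suc_le_eq[symmetric])

text \<open>The second clause says that the functions in \<open>V\<close> take all systems of
  values, so that over an infinite field \<open>K[V]\<close> is a polynomial ring. The monic
  relation makes the first \<open>m\<close> powers of \<open>g\<close> span \<open>K[V, g]\<close>
  over it, and the last clause makes them independent.\<close>

definition free_basis :: "('x \<Rightarrow> 'a::field) set \<Rightarrow> ('x \<Rightarrow> 'a) \<Rightarrow> nat \<Rightarrow> bool" where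
  "free_basis V g m \<longleftrightarrow> finite V \<and> (\<forall>w. \<exists>z. \<forall>v\<in>V. v z = w v) \<and> 0 < m \<and>
     (\<exists>p. coeffs_in (adjoin constants V) p \<and> lead_coeff p = 1 \<and> degree p = m \<and> poly p g = 0) \<and>
     (\<forall>p. coeffs_in (adjoin constants V) p \<longrightarrow> degree p < m \<longrightarrow> poly p g = 0 \<longrightarrow> p = 0)"

text \<open>Modulo the monic relation an element has degree below \<open>m\<close> in
  \<open>g\<close>; expanding its coefficients in \<open>v\<close> and exchanging the two summations
  gives the expansion in powers of \<open>v\<close>. Uniqueness reverses the exchange, using first
  the independence of the powers of \<open>g\<close> and then the transcendence of
  \<open>v\<close>.\<close>

lemma free_adjoin_functions:
  fixes V :: "('x \<Rightarrow> 'a::field) set"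
  assumes inf: "infinite (UNIV :: 'a set)" and free: "free_basis V g m"
  shows "free_adjoin (adjoin constants (insert g V)) constants V g
    (\<lambda>v. {poly p g |p. coeffs_in (adjoin constants (V - {v})) p \<and> degree p < m})"
proof -
  let ?K = "constants :: ('x \<Rightarrow> 'a) set"
  let ?C = "adjoin ?K (insert g V)"
  let ?A = "adjoin ?K V"
  let ?D = "\<lambda>v. adjoin ?K (V - {v})"
  let ?M = "\<lambda>v. {poly p g |p. coeffs_in (?D v) p \<and> degree p < m}"
  have fin: "finite V" and surj: "\<And>w. \<exists>z. \<forall>v\<in>V. v z = w v" and m: "0 < m"
    and ind: "\<And>p. coeffs_in ?A p \<Longrightarrow> degree p < m \<Longrightarrow> poly p g = 0 \<Longrightarrow> p = 0"
    using free unfolding free_basis_def by blast+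
  obtain r where r: "coeffs_in ?A r" "lead_coeff r = 1" "degree r = m" "poly r g = 0"
    using free unfolding free_basis_def by blast
  note trans = transcendental_coordinate[OF inf surj]
  interpret C: class_subring ?C by (rule constants.class_subring_adjoin)
  interpret A: class_subring ?A by (rule constants.class_subring_adjoin)
  have D: "class_subring (?D v)" for v by (rule constants.class_subring_adjoin)
  have DA: "?D v \<subseteq> ?A" for v by (rule adjoin_mono) auto
  have AC: "?A \<subseteq> ?C" by (rule adjoin_mono) auto
  have gC: "g \<in> ?C" by (rule adjoin.base) simp
  have ins: "?A = adjoin ?K (insert v (V - {v}))" if "v \<in> V" for v
    using that by (simp add: insert_absorb)
  show ?thesis
  proof (intro free_adjoin.intro free_adjoin_axioms.intro C.class_subring_axioms
      constants.class_subfield_axioms fin)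
    show "?C = ?C" ..
    show "\<exists>p. coeffs_in ?A p \<and> lead_coeff p = 1 \<and> poly p g = 0" using r by blast
  next
    fix v assume v: "v \<in> V"
    interpret D: class_subring "?D v" by (rule D)
    show "?M v \<subseteq> ?C"
      using C.poly_mem[OF coeffs_in_mono gC] DA AC by blast
    show "0 \<in> ?M v" using D.coeffs_in_ring(1) m by (intro CollectI exI[of _ 0]) simp
    show "a + b \<in> ?M v" if "a \<in> ?M v" "b \<in> ?M v" for a b
      using that D.coeffs_in_ring(4) by (smt (verit, best) degree_add_less mem_Collect_eq poly_add)
    show "d * a \<in> ?M v" if d: "d \<in> ?D v" and a: "a \<in> ?M v" for d a
    proof -
      obtain p where "a = poly p g" "coeffs_in (?D v) p" "degree p < m" using a by blast
      then show ?thesis using D.coeffs_in_ring(7)[OF d] degree_smult_le[of d p]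
        by (intro CollectI exI[of _ "smult d p"]) auto
    qed
    show "\<exists>p. coeffs_in (?M v) p \<and> c = poly p v" if c: "c \<in> ?C" for c
    proof -
      obtain p where p: "c = poly p g" "coeffs_in ?A p"
        using c unfolding constants.adjoin_insert by blast
      obtain k s r' where d: "coeffs_in ?A r'" "smult (lead_coeff r ^ k) p = r * s + r'" "degree r' < m"
        using A.pseudo_division[OF p(2) r(1)] m unfolding r(3) by blast
      have "p = r * s + r'" using d(2) by (simp add: r(2))
      then have c': "c = poly r' g" using p(1) r(4) by simp
      have "\<exists>q. coeff r' j = poly q v \<and> coeffs_in (?D v) q" for j
        using coeffs_inD[OF d(1), of j] unfolding ins[OF v] constants.adjoin_insert by blast
      then obtain q where q: "\<And>j. coeff r' j = poly (q j) v" "\<And>j. coeffs_in (?D v) (q j)" by metis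
      define P where "P = (\<Sum>j<m. smult (g ^ j) (q j))"
      have "coeff P i \<in> ?M v" for i
      proof -
        let ?t = "\<Sum>j<m. monom (coeff (q j) i) j"
        have ct: "coeff ?t k = (if k < m then coeff (q k) i else 0)" for k
          by (simp add: coeff_sum)
        have "coeffs_in (?D v) ?t" unfolding coeffs_in_def ct using coeffs_inD[OF q(2)] by auto
        moreover have "degree ?t < m"
          using m by (intro degree_less_of_coeffs) (simp_all add: ct)
        moreover have "coeff P i = poly ?t g"
          by (simp add: P_def coeff_sum poly_sum poly_monom mult.commute)
        ultimately show ?thesis by blast
      qed
      moreover have "c = poly P v"
      proof -
        have "c = (\<Sum>j\<le>degree r'. coeff r' j * g ^ j)" unfolding c' poly_altdef ..
        also have "\<dots> = (\<Sum>j<m. coeff r' j * g ^ j)"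
          using d(3) by (intro sum.mono_neutral_left) (auto simp: coeff_eq_0)
        finally show ?thesis unfolding P_def by (simp add: poly_sum q(1) mult.commute)
      qed
      ultimately show ?thesis unfolding coeffs_in_def by blast
    qed
    show "p = 0" if p: "coeffs_in (?M v) p" "poly p v = 0" for p
    proof -
      have "\<exists>t. coeff p i = poly t g \<and> coeffs_in (?D v) t \<and> degree t < m" for i
        using coeffs_inD[OF p(1), of i] by blast
      then obtain t where t: "\<And>i. coeff p i = poly (t i) g" "\<And>i. coeffs_in (?D v) (t i)"
        "\<And>i. degree (t i) < m" by metis
      define q where "q j = (\<Sum>i\<le>degree p. monom (coeff (t i) j) i)" for j
      have cq: "coeff (q j) i = (if i \<le> degree p then coeff (t i) j else 0)" for i j
        by (simp add: q_def coeff_sum)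
      have qD: "coeffs_in (?D v) (q j)" for j
        unfolding coeffs_in_def cq using coeffs_inD[OF t(2)] by auto
      define P where "P = (\<Sum>j<m. monom (poly (q j) v) j)"
      have cP: "coeff P j = (if j < m then poly (q j) v else 0)" for j
        by (simp add: P_def coeff_sum)
      have "v \<in> ?A" using v by (intro adjoin.base) simp
      then have "poly (q j) v \<in> ?A" for j using A.poly_mem[OF coeffs_in_mono[OF qD DA]] by blast
      then have "coeffs_in ?A P" unfolding coeffs_in_def cP by auto
      moreover have "degree P < m" using m by (intro degree_less_of_coeffs) (simp_all add: cP)
      moreover have "poly P g = 0"
      proof -
        have "poly P g = (\<Sum>j<m. \<Sum>i\<le>degree p. coeff (t i) j * v ^ i * g ^ j)"
          by (simp add: P_def q_def poly_sum poly_monom sum_distrib_right)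
        also have "\<dots> = (\<Sum>i\<le>degree p. \<Sum>j<m. coeff (t i) j * v ^ i * g ^ j)" by (rule sum.swap)
        also have "\<dots> = (\<Sum>i\<le>degree p. coeff p i * v ^ i)"
        proof (rule sum.cong[OF refl])
          fix i
          have "coeff p i = (\<Sum>j\<le>degree (t i). coeff (t i) j * g ^ j)" unfolding t(1) poly_altdef ..
          also have "\<dots> = (\<Sum>j<m. coeff (t i) j * g ^ j)"
            using t(3)[of i] by (intro sum.mono_neutral_left) (auto simp: coeff_eq_0)
          finally have cpi: "coeff p i = (\<Sum>j<m. coeff (t i) j * g ^ j)" .
          show "(\<Sum>j<m. coeff (t i) j * v ^ i * g ^ j) = coeff p i * v ^ i"
            unfolding cpi sum_distrib_right by (simp add: ac_simps)
        qed
        also have "\<dots> = 0" using p(2) by (simp add: poly_altdef)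
        finally show ?thesis .
      qed
      ultimately have "P = 0" by (rule ind)
      then have "poly (q j) v = 0" if "j < m" for j using cP[of j] that by simp
      then have q0: "q j = 0" if "j < m" for j using trans[OF v qD] that by blast
      have "t i = 0" if "i \<le> degree p" for i
      proof (rule poly_eqI)
        fix j
        show "coeff (t i) j = coeff 0 j"
          using q0[of j] cq[of j i] that t(3)[of i] by (cases "j < m") (auto simp: coeff_eq_0)
      qed
      then have "lead_coeff p = 0" using t(1) by simp
      then show ?thesis by simp
    qed
  qed
qed

theorem cohen_macaulay_functions:
  fixes V :: "('x \<Rightarrow> 'a::field) set"
  assumes "infinite (UNIV :: 'a set)" and "free_basis V g m"
    and h: "h \<in> ring_iso (class_ring (adjoin constants (insert g V))) R" "h 0 = \<zero>\<^bsub>R\<^esub>"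
  shows "cohen_macaulay_ring R"
proof -
  interpret free_adjoin "adjoin constants (insert g V)" constants V g
    "\<lambda>v. {poly p g |p. coeffs_in (adjoin constants (V - {v})) p \<and> degree p < m}"
    by (rule free_adjoin_functions[OF assms(1,2)])
  show ?thesis
    using h by (intro cohen_macaulay_ring_iso[where h = h, OF cring noetherian cm_data_exists]) auto
qed

section \<open>Families of polynomials\<close>

text \<open>The uniform degree bound lets evaluation and division be written with the same number of
  terms at all points, which keeps the results in \<open>D\<close>.\<close>

definition poly_family :: "('x \<Rightarrow> 'a::field) set \<Rightarrow> ('x \<Rightarrow> 'a poly) \<Rightarrow> bool" where
  "poly_family D P \<longleftrightarrow> (\<forall>i. (\<lambda>z. coeff (P z) i) \<in> D) \<and> (\<exists>d. \<forall>z. degree (P z) \<le> d)"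

text \<open>Instances are the polynomials in a curve parameter, the regular functions of a chart,
  and the functions on a set of pairs generated by some coefficients. Remainders and determinants
  are thus treated once for all three.\<close>

locale function_algebra = class_subring D for D :: "('x \<Rightarrow> 'a::field) set" +
  assumes const: "(\<lambda>_. c) \<in> D"
begin

lemma pointwise:
  "f \<in> D \<Longrightarrow> h \<in> D \<Longrightarrow> (\<lambda>z. f z + h z) \<in> D"
  "f \<in> D \<Longrightarrow> h \<in> D \<Longrightarrow> (\<lambda>z. f z * h z) \<in> D"
  "f \<in> D \<Longrightarrow> h \<in> D \<Longrightarrow> (\<lambda>z. f z - h z) \<in> D"
  "f \<in> D \<Longrightarrow> (\<lambda>z. - f z) \<in> D"
proof -
  have neg: "(\<lambda>z. - f z) \<in> D" if "f \<in> D" for f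
    using mult_mem[OF const[of "- 1"] that] by (simp add: times_fun_def)
  show add: "f \<in> D \<Longrightarrow> h \<in> D \<Longrightarrow> (\<lambda>z. f z + h z) \<in> D" for f h
    using add_mem[of f h] by (simp add: plus_fun_def)
  show "f \<in> D \<Longrightarrow> h \<in> D \<Longrightarrow> (\<lambda>z. f z * h z) \<in> D"
    using mult_mem[of f h] by (simp add: times_fun_def)
  show "f \<in> D \<Longrightarrow> (\<lambda>z. - f z) \<in> D" by (rule neg)
  show "f \<in> D \<Longrightarrow> h \<in> D \<Longrightarrow> (\<lambda>z. f z - h z) \<in> D"
    using add[OF _ neg, of f h] by simp
qed

lemma pointwise_sum: "(\<And>i. i \<in> I \<Longrightarrow> (\<lambda>z. f z i) \<in> D) \<Longrightarrow> (\<lambda>z. \<Sum>i\<in>I. f z i) \<in> D"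
  by (induction I rule: infinite_finite_induct) (auto simp: const pointwise)

lemma pointwise_prod: "(\<And>i. i \<in> I \<Longrightarrow> (\<lambda>z. f z i) \<in> D) \<Longrightarrow> (\<lambda>z. \<Prod>i\<in>I. f z i) \<in> D"
  by (induction I rule: infinite_finite_induct) (auto simp: const pointwise)

lemma pointwise_power: "f \<in> D \<Longrightarrow> (\<lambda>z. f z ^ n) \<in> D"
  by (induction n) (auto simp: const pointwise)

lemma coeff_family: "poly_family D P \<Longrightarrow> (\<lambda>z. coeff (P z) i) \<in> D"
  by (simp add: poly_family_def)

lemma poly_familyI: "(\<And>i. (\<lambda>z. coeff (P z) i) \<in> D) \<Longrightarrow> (\<And>z. degree (P z) \<le> d) \<Longrightarrow> poly_family D P"
  by (auto simp: poly_family_def)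

lemma poly_family_const: "poly_family D (\<lambda>_. p)"
  by (rule poly_familyI[where d = "degree p"]) (auto simp: const)

lemma poly_family_scalar: "f \<in> D \<Longrightarrow> poly_family D (\<lambda>z. [:f z:])"
proof (rule poly_familyI[where d = 0])
  show "(\<lambda>z. coeff [:f z:] i) \<in> D" if "f \<in> D" for i
    using that by (cases i) (simp_all add: const)
qed simp

lemma poly_family_add:
  assumes "poly_family D P" "poly_family D Q"
  shows "poly_family D (\<lambda>z. P z + Q z)"
proof -
  obtain d e where "\<And>z. degree (P z) \<le> d" "\<And>z. degree (Q z) \<le> e"
    using assms unfolding poly_family_def by blast
  then have "degree (P z + Q z) \<le> max d e" for z by (intro degree_add_le) (auto simp: le_max_iff_disj)
  then show ?thesis using assms by (intro poly_familyI) (auto simp: coeff_family pointwise)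
qed

lemma poly_family_mult:
  assumes "poly_family D P" "poly_family D Q"
  shows "poly_family D (\<lambda>z. P z * Q z)"
proof -
  obtain d e where "\<And>z. degree (P z) \<le> d" "\<And>z. degree (Q z) \<le> e"
    using assms unfolding poly_family_def by blast
  then have "degree (P z * Q z) \<le> d + e" for z
    using degree_mult_le[of "P z" "Q z"] by (meson add_mono order_trans)
  then show ?thesis using assms
    by (intro poly_familyI) (auto simp: coeff_mult intro!: pointwise_sum pointwise coeff_family)
qed

lemma poly_family_smult: "f \<in> D \<Longrightarrow> poly_family D P \<Longrightarrow> poly_family D (\<lambda>z. smult (f z) (P z))"
  using poly_family_mult[OF poly_family_scalar, of f P] by simp

lemma poly_family_diff:
  assumes "poly_family D P" "poly_family D Q"
  shows "poly_family D (\<lambda>z. P z - Q z)"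
  using poly_family_add[OF assms(1) poly_family_smult[OF const assms(2), of "- 1"]] by simp

lemma poly_family_sum:
  "(\<And>i. i \<in> I \<Longrightarrow> poly_family D (\<lambda>z. P z i)) \<Longrightarrow> poly_family D (\<lambda>z. \<Sum>i\<in>I. P z i)"
  by (induction I rule: infinite_finite_induct) (auto simp: poly_family_const poly_family_add)

lemma poly_family_prod:
  "(\<And>i. i \<in> I \<Longrightarrow> poly_family D (\<lambda>z. P z i)) \<Longrightarrow> poly_family D (\<lambda>z. \<Prod>i\<in>I. P z i)"
  by (induction I rule: infinite_finite_induct) (auto simp: poly_family_const poly_family_mult)

lemma poly_family_eval:
  assumes "poly_family D P" "f \<in> D"
  shows "(\<lambda>z. poly (P z) (f z)) \<in> D"
proof -
  obtain d where d: "\<And>z. degree (P z) \<le> d" using assms unfolding poly_family_def by blast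
  have "poly (P z) (f z) = (\<Sum>i\<le>d. coeff (P z) i * f z ^ i)" for z
    unfolding poly_altdef using d[of z] by (intro sum.mono_neutral_left) (auto simp: coeff_eq_0)
  then show ?thesis using assms
    by (auto intro!: pointwise_sum pointwise coeff_family pointwise_power)
qed

text \<open>Long division by a monic polynomial of constant degree uses only sums and products, and
  the degree bound of the family limits the number of steps uniformly.\<close>

lemma poly_family_mod:
  assumes P: "poly_family D P" and f: "poly_family D f" "\<And>z. lead_coeff (f z) = 1" "\<And>z. degree (f z) = n"
  shows "poly_family D (\<lambda>z. P z mod f z)"
proof -
  have "(\<lambda>z. coeff (P z mod f z) i) \<in> D" if "poly_family D P" "\<forall>z. \<forall>i\<ge>d. coeff (P z) i = 0" for P d i
    using that
  proof (induction d arbitrary: P)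
    case 0
    then have "P z = 0" for z by (simp add: poly_eq_iff)
    then show ?case by (simp add: const)
  next
    case (Suc d)
    show ?case
    proof (cases "d < n")
      case True
      have "degree (P z) < degree (f z)" for z
        unfolding f(3) using True Suc.prems(2) by (intro degree_less_of_coeffs) auto
      then have "P z mod f z = P z" for z by (rule mod_poly_less)
      then show ?thesis using Suc.prems(1) by (simp add: coeff_family)
    next
      case False
      define P' where "P' z = P z - smult (coeff (P z) d) (monom 1 (d - n) * f z)" for z
      have "poly_family D P'"
        unfolding P'_def using Suc.prems(1) f(1)
        by (intro poly_family_diff poly_family_smult poly_family_mult poly_family_const coeff_family)
      moreover have "\<forall>z. \<forall>i\<ge>d. coeff (P' z) i = 0"
      proof (intro allI impI)
        fix z i assume i: "d \<le> i"
        have lc: "coeff (f z) n = 1" using f(2,3)[of z] by simp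
        show "coeff (P' z) i = 0"
        proof (cases "i = d")
          case True
          then show ?thesis using False lc by (simp add: P'_def coeff_monom_mult)
        next
          case False
          then have "coeff (f z) (i - (d - n)) = 0" using i f(3)[of z] \<open>\<not> d < n\<close> by (intro coeff_eq_0) linarith
          then show ?thesis using False i Suc.prems(2) by (simp add: P'_def coeff_monom_mult)
        qed
      qed
      ultimately have "(\<lambda>z. coeff (P' z mod f z) i) \<in> D" by (rule Suc.IH)
      moreover have "P' z mod f z = P z mod f z" for z
      proof -
        have "P' z = P z - smult (coeff (P z) d) (monom 1 (d - n)) * f z" by (simp add: P'_def)
        then show ?thesis by (metis diff_zero mod_diff_right_eq mod_mult_self2_is_0)
      qed
      ultimately show ?thesis by simp
    qed
  qed
  moreover obtain d where d: "\<And>z. degree (P z) \<le> d" using P unfolding poly_family_def by blast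
  then have "\<forall>z. \<forall>i\<ge>Suc d. coeff (P z) i = 0" by (metis Suc_le_lessD coeff_eq_0 le_less_trans)
  ultimately have c: "(\<lambda>z. coeff (P z mod f z) i) \<in> D" for i using P by blast
  show ?thesis
  proof (rule poly_familyI[OF c])
    fix z
    show "degree (P z mod f z) \<le> n"
      using degree_mod_less[of "f z" "P z"] f(2,3)[of z] by (cases "f z = 0") auto
  qed
qed

lemma det_family:
  assumes "\<And>z. A z \<in> carrier_mat n n" and "\<And>i j. i < n \<Longrightarrow> j < n \<Longrightarrow> (\<lambda>z. A z $$ (i, j)) \<in> D"
  shows "(\<lambda>z. det (A z)) \<in> D"
proof -
  have "det (A z) = (\<Sum>p | p permutes {0..<n}. signof p * (\<Prod>i = 0..<n. A z $$ (i, p i)))" for z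
    using assms(1) by (rule det_def')
  moreover have "(\<lambda>z. \<Sum>p | p permutes {0..<n}. signof p * (\<Prod>i = 0..<n. A z $$ (i, p i))) \<in> D"
    by (intro pointwise_sum pointwise pointwise_prod const assms(2))
      (auto simp: permutes_in_image[of _ "{0..<n}", simplified])
  ultimately show ?thesis by simp
qed

end

section \<open>Curvilinear ideals\<close>

text \<open>The homomorphism from \<open>k[x,y]\<close> to \<open>k[y]\<close> that sends
  \<open>x\<close> to \<open>g(y)\<close> and fixes \<open>y\<close>; the inner variable is replaced
  by \<open>pcompose\<close>.\<close>

definition subst :: "'a::field poly \<Rightarrow> 'a poly poly \<Rightarrow> 'a poly" where
  "subst g p = poly (map_poly (\<lambda>c. pcompose c g) p) [:0, 1:]"

lemma subst_0 [simp]: "subst g 0 = 0"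
  by (simp add: subst_def)

lemma subst_pCons: "subst g (pCons a p) = pcompose a g + [:0, 1:] * subst g p"
  by (simp add: subst_def Polynomial.map_poly_pCons)

lemma subst_add: "subst g (p + q) = subst g p + subst g q"
  by (induction p q rule: poly_induct2) (auto simp: subst_pCons pcompose_add algebra_simps)

lemma subst_smult: "subst g (smult a q) = pcompose a g * subst g q"
  by (induction q) (auto simp: subst_pCons pcompose_mult algebra_simps)

lemma subst_mult: "subst g (p * q) = subst g p * subst g q"
proof (induction p)
  case (pCons a p)
  then show ?case by (simp add: subst_add subst_smult subst_pCons algebra_simps)
qed simp

lemma subst_const: "subst g [:a:] = pcompose a g"
  by (simp add: subst_pCons)

lemma subst_1 [simp]: "subst g 1 = 1"
proof -
  have "subst g 1 = subst g [:1:]" by (subst one_pCons) (rule refl)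
  then show ?thesis by (simp add: subst_const pcompose_1)
qed

lemma subst_uminus: "subst g (- p) = - subst g p"
  using subst_add[of g p "- p"] by (simp add: eq_neg_iff_add_eq_0 add.commute)

lemma subst_diff: "subst g (p - q) = subst g p - subst g q"
  using subst_add[of g p "- q"] by (simp add: subst_uminus)

lemma subst_sum: "subst g (\<Sum>i\<in>I. f i) = (\<Sum>i\<in>I. subst g (f i))"
  by (induction I rule: infinite_finite_induct) (auto simp: subst_add)

lemma subst_power: "subst g (p ^ n) = subst g p ^ n"
  by (induction n) (auto simp: subst_mult)

lemma subst_varx [simp]: "subst g varx = g"
  by (simp add: varx_def subst_const pcompose_pCons)

lemma subst_vary [simp]: "subst g vary = [:0, 1:]"
  by (simp add: vary_def subst_pCons pcompose_1 one_pCons[symmetric])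

lemma subst_scalar: "subst g (smult [:a:] p) = smult a (subst g p)"
  by (simp add: subst_smult)

lemma eval2_subst: "eval2 p (poly g b, b) = poly (subst g p) b"
  unfolding eval2_def
  by (induction p) (auto simp: subst_pCons poly_pcompose)

definition in_y :: "'a::field poly \<Rightarrow> 'a poly poly" where
  "in_y q = map_poly (\<lambda>c. [:c:]) q"

lemma in_y_0 [simp]: "in_y 0 = 0"
  by (simp add: in_y_def)

lemma in_y_pCons: "in_y (pCons a q) = [:[:a:]:] + vary * in_y q"
  by (simp add: in_y_def Polynomial.map_poly_pCons vary_def)

lemma in_y_add: "in_y (p + q) = in_y p + in_y q"
  by (induction p q rule: poly_induct2) (auto simp: in_y_pCons algebra_simps)

lemma in_y_smult: "in_y (smult a q) = [:[:a:]:] * in_y q"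
  by (induction q) (auto simp: in_y_pCons algebra_simps)

lemma in_y_mult: "in_y (p * q) = in_y p * in_y q"
proof (induction p)
  case (pCons a p)
  have "in_y (pCons 0 (p * q)) = vary * in_y (p * q)" by (simp add: in_y_pCons)
  then show ?case using pCons by (simp add: in_y_add in_y_smult in_y_pCons algebra_simps)
qed simp

lemma in_y_1 [simp]: "in_y 1 = 1"
  using in_y_pCons[of 1 0] by (simp add: one_pCons)

lemma in_y_uminus: "in_y (- q) = - in_y q"
  using in_y_add[of q "- q"] by (simp add: eq_neg_iff_add_eq_0 add.commute)

lemma in_y_diff: "in_y (p - q) = in_y p - in_y q"
  using in_y_add[of p "- q"] by (simp add: in_y_uminus)

lemma in_y_sum: "in_y (\<Sum>i\<in>I. f i) = (\<Sum>i\<in>I. in_y (f i))"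
  by (induction I rule: infinite_finite_induct) (auto simp: in_y_add)

lemma in_y_y [simp]: "in_y [:0, 1:] = vary"
  by (simp add: in_y_pCons one_pCons[symmetric])

lemma in_y_power: "in_y (q ^ n) = in_y q ^ n"
  by (induction n) (auto simp: in_y_mult)

lemma in_y_monom: "in_y (monom c j) = smult [:c:] (vary ^ j)"
proof -
  have "monom c j = smult c ([:0, 1:] ^ j)" by (simp add: monom_altdef)
  then show ?thesis by (simp add: in_y_smult in_y_power)
qed

lemma subst_in_y [simp]: "subst g (in_y q) = q"
  by (induction q) (auto simp: in_y_pCons subst_add subst_mult subst_const)

text \<open>Division by \<open>x - g(y)\<close>, which is monic in \<open>x\<close>, carried out by
  Horner's scheme on each of the two polynomial layers.\<close>

lemma subst_decomp: "\<exists>s. p = in_y (subst g p) + (varx - in_y g) * s"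
proof (induction p)
  case 0
  show ?case by (intro exI[of _ 0]) simp
next
  case (pCons a p)
  have "\<exists>s. [:a:] = in_y (pcompose a g) + (varx - in_y g) * s"
  proof (induction a)
    case 0
    show ?case by (intro exI[of _ 0]) simp
  next
    case (pCons c a)
    then obtain s where s: "[:a:] = in_y (pcompose a g) + (varx - in_y g) * s" by blast
    have "[:pCons c a:] = [:[:c:]:] + varx * [:a:]" by (simp add: varx_def)
    also have "\<dots> = in_y (pcompose (pCons c a) g) + (varx - in_y g) * (in_y (pcompose a g) + varx * s)"
      unfolding s by (simp add: pcompose_pCons in_y_add in_y_mult in_y_pCons algebra_simps)
    finally show ?case by blast
  qed
  then obtain s where s: "[:a:] = in_y (pcompose a g) + (varx - in_y g) * s" by blast
  obtain t where t: "p = in_y (subst g p) + (varx - in_y g) * t" using pCons by blast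
  have "pCons a p = [:a:] + vary * p" by (simp add: vary_def)
  also have "\<dots> = in_y (pcompose a g) + (varx - in_y g) * s + vary * (in_y (subst g p) + (varx - in_y g) * t)"
    using s t by simp
  also have "\<dots> = in_y (subst g (pCons a p)) + (varx - in_y g) * (s + vary * t)"
    by (simp add: subst_pCons in_y_add in_y_mult in_y_pCons algebra_simps)
  finally show ?case by blast
qed

section \<open>Ideals of \<open>k[x,y]\<close> and the points of the chart \<open>U\<close>\<close>

interpretation UNIV: class_subring "UNIV :: 'r::comm_ring_1 set"
  by unfold_locales auto

lemma kxy_eq: "kxy = class_ring UNIV"
  by (simp add: ring_of_type_algebra_def class_ring_def)

lemma ideal_kxy_iff:
  "ideal I kxy \<longleftrightarrow> 0 \<in> I \<and> (\<forall>a\<in>I. \<forall>b\<in>I. a + b \<in> I) \<and> (\<forall>c. \<forall>a\<in>I. c * a \<in> I)"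
  unfolding kxy_eq UNIV.ideal_iff by auto

text \<open>The ideal of the graph \<open>x = g(y)\<close> over the subscheme \<open>f(y) = 0\<close> of the line.\<close>

definition graph_ideal :: "'a::field poly \<Rightarrow> 'a poly \<Rightarrow> 'a poly poly set" where
  "graph_ideal f g = {p. f dvd subst g p}"

lemma ideal_graph_ideal: "ideal (graph_ideal f g) kxy"
  unfolding ideal_kxy_iff graph_ideal_def by (auto simp: subst_add subst_mult)

lemma graph_ideal_subset:
  assumes I: "ideal I kxy" and g: "varx - in_y g \<in> I" and f: "in_y f \<in> I"
  shows "graph_ideal f g \<subseteq> I"
proof
  fix p assume "p \<in> graph_ideal f g"
  then obtain q where q: "subst g p = f * q" unfolding graph_ideal_def dvd_def by blast
  obtain s where "p = in_y (subst g p) + (varx - in_y g) * s" using subst_decomp by blast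
  then have "p = in_y q * in_y f + s * (varx - in_y g)" unfolding q by (simp add: in_y_mult mult.commute)
  also have "\<dots> \<in> I" using assms unfolding ideal_kxy_iff by blast
  finally show "p \<in> I" .
qed

lemma vary_power_inj: "inj (\<lambda>j. (vary :: 'a::field poly poly) ^ j)"
proof (rule injI)
  fix i j assume "(vary :: 'a poly poly) ^ i = vary ^ j"
  then have "degree ((vary :: 'a poly poly) ^ i) = degree ((vary :: 'a poly poly) ^ j)" by simp
  then show "i = j" by (simp add: vary_def degree_power_eq)
qed

lemma inv_vary_power [simp]:
  "inv_into UNIV (\<lambda>j. (vary :: 'a::field poly poly) ^ j) (vary ^ i) = i"
  using inv_f_f[OF vary_power_inj, of i] by simp

lemma basis_U_image: "basis_U n = (\<lambda>j. vary ^ j) ` {..<n}"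
  by (auto simp: basis_U_def)

lemma finite_basis_U [simp]: "finite (basis_U n)"
  by (simp add: basis_U_image)

lemma card_basis_U [simp]: "card (basis_U n :: 'a::field poly poly set) = n"
  unfolding basis_U_image using vary_power_inj by (subst card_image) (auto intro: inj_on_subset)

lemma sum_basis_U:
  fixes c :: "'a::field poly poly \<Rightarrow> 'a"
  shows "(\<Sum>b\<in>basis_U n. smult [:c b:] b) = in_y (\<Sum>j<n. monom (c (vary ^ j)) j)"
  unfolding basis_U_image using vary_power_inj
  by (subst sum.reindex) (auto intro: inj_on_subset simp: in_y_sum in_y_monom)

text \<open>Modulo the graph ideal, \<open>p\<close> is congruent to the remainder of
  \<open>p(g(y), y)\<close> by \<open>f\<close>, a combination of the first \<open>n\<close> powers
  of \<open>y\<close>.\<close>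

lemma rep_mod_graph_ideal:
  fixes f g :: "'a::field poly"
  assumes f: "lead_coeff f = 1" "degree f = n"
  shows "rep_mod (graph_ideal f g) (basis_U n) p c \<longleftrightarrow>
    c \<in> extensional (basis_U n) \<and> (\<forall>j<n. c (vary ^ j) = coeff (subst g p mod f) j)"
proof -
  let ?s = "\<Sum>j<n. monom (c (vary ^ j)) j"
  have cs: "coeff ?s j = (if j < n then c (vary ^ j) else 0)" for j by (simp add: coeff_sum)
  have f0: "f \<noteq> 0" using f by auto
  \<comment> \<open>For \<open>n = 0\<close> the empty sum has degree 0, which is not below the
    degree of \<open>f\<close>; then \<open>f = 1\<close> and all remainders vanish.\<close>
  have sm: "?s mod f = ?s"
  proof (cases "n = 0")
    case True
    then have "f = 1" using f by (metis degree_eq_zeroE lead_coeff_pCons(2) one_pCons pCons_eq_0_iff)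
    then show ?thesis using True by simp
  next
    case False
    then have "degree ?s < degree f" unfolding f(2) by (intro degree_less_of_coeffs) (auto simp: cs)
    then show ?thesis by (rule mod_poly_less)
  qed
  have mz: "coeff (subst g p mod f) j = 0" if "j \<ge> n" for j
  proof (cases "n = 0")
    case True
    then have "f = 1" using f by (metis degree_eq_zeroE lead_coeff_pCons(2) one_pCons pCons_eq_0_iff)
    then show ?thesis by simp
  next
    case False
    then have "subst g p mod f = 0 \<or> degree (subst g p mod f) < n" using degree_mod_less[OF f0] f(2) by blast
    then show ?thesis using that by (auto intro: coeff_eq_0)
  qed
  have "p - (\<Sum>b\<in>basis_U n. smult [:c b:] b) \<in> graph_ideal f g \<longleftrightarrow> f dvd subst g p - ?s"
    unfolding sum_basis_U graph_ideal_def by (simp add: subst_diff)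
  also have "\<dots> \<longleftrightarrow> subst g p mod f = ?s" using mod_eq_dvd_iff[of "subst g p" f ?s] unfolding sm by (rule sym)
  also have "\<dots> \<longleftrightarrow> (\<forall>j<n. c (vary ^ j) = coeff (subst g p mod f) j)"
    unfolding poly_eq_iff cs using mz by (auto simp: not_less)
  finally show ?thesis unfolding rep_mod_def by blast
qed

lemma rep_mod_graph_ideal_ex1:
  fixes f g :: "'a::field poly"
  assumes f: "lead_coeff f = 1" "degree f = n"
  shows "\<exists>!c. rep_mod (graph_ideal f g) (basis_U n) p c"
proof -
  let ?c = "restrict (\<lambda>b. coeff (subst g p mod f) (inv_into UNIV (\<lambda>j. vary ^ j) b)) (basis_U n)"
  have c: "?c (vary ^ j) = coeff (subst g p mod f) j" if "j < n" for j
    using that by (auto simp: basis_U_image)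
  show ?thesis
    unfolding rep_mod_graph_ideal[OF f]
  proof (rule ex1I[of _ ?c])
    show "?c \<in> extensional (basis_U n) \<and> (\<forall>j<n. ?c (vary ^ j) = coeff (subst g p mod f) j)"
      by (intro conjI restrict_extensional allI impI c)
    fix d assume "d \<in> extensional (basis_U n) \<and> (\<forall>j<n. d (vary ^ j) = coeff (subst g p mod f) j)"
    then show "d = ?c" using c
      by (intro extensionalityI[of _ "basis_U n"]) (auto simp: basis_U_image)
  qed
qed

lemma graph_ideal_mem_chart:
  fixes f g :: "'a::field poly"
  assumes "lead_coeff f = 1" "degree f = n"
  shows "graph_ideal f g \<in> chart_U n"
  unfolding chart_U_def chart_def basis_mod_def
  using ideal_graph_ideal rep_mod_graph_ideal_ex1[OF assms] by simp

lemma coord_graph_ideal: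
  fixes f g :: "'a::field poly"
  assumes f: "lead_coeff f = 1" "degree f = n" and j: "j < n"
  shows "coord (basis_U n) p (vary ^ j) (graph_ideal f g) = coeff (subst g p mod f) j"
proof -
  have "rep_mod (graph_ideal f g) (basis_U n) p (THE c. rep_mod (graph_ideal f g) (basis_U n) p c)"
    using rep_mod_graph_ideal_ex1[OF f] by (rule theI')
  then show ?thesis using j unfolding coord_def rep_mod_graph_ideal[OF f] by blast
qed

text \<open>Here \<open>g\<close> is the expansion of \<open>x\<close> in powers of
  \<open>y\<close>, and \<open>f\<close> is \<open>y^n\<close> minus its expansion. Any member of
  the ideal reduces to a polynomial in \<open>y\<close> of degree below \<open>n\<close>, which is 0
  because coordinates are unique.\<close>

lemma chart_U_cases:
  fixes I :: "'a::field poly poly set"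
  assumes "I \<in> chart_U n" "n \<ge> 1"
  obtains f g where "lead_coeff f = 1" "degree f = n" "degree g < n" "I = graph_ideal f g"
proof -
  have I: "ideal I kxy" and ex1: "\<And>p. \<exists>!c. rep_mod I (basis_U n) p c"
    using assms(1) unfolding chart_U_def chart_def basis_mod_def by auto
  have I_add: "\<And>a b. a \<in> I \<Longrightarrow> b \<in> I \<Longrightarrow> a + b \<in> I" and I_mult: "\<And>c a. a \<in> I \<Longrightarrow> c * a \<in> I"
    and I_0: "0 \<in> I"
    using I unfolding ideal_kxy_iff by auto
  have ex: "\<exists>c. p - in_y (\<Sum>j<n. monom (c j) j) \<in> I" for p
  proof -
    obtain c where "rep_mod I (basis_U n) p c" using ex1[of p] by blast
    then have "p - in_y (\<Sum>j<n. monom (c (vary ^ j)) j) \<in> I"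
      unfolding rep_mod_def sum_basis_U by simp
    then show ?thesis by (intro exI[of _ "\<lambda>j. c (vary ^ j)"])
  qed
  obtain cx where cx: "varx - in_y (\<Sum>j<n. monom (cx j) j) \<in> I" using ex by blast
  obtain cy where cy: "vary ^ n - in_y (\<Sum>j<n. monom (cy j) j) \<in> I" using ex by blast
  define g where "g = (\<Sum>j<n. monom (cx j) j)"
  define f where "f = monom 1 n - (\<Sum>j<n. monom (cy j) j)"
  have cf: "coeff f j = (if j < n then - cy j else if j = n then 1 else 0)" for j
    by (auto simp: f_def coeff_sum)
  have deg: "degree f = n"
    using cf by (intro antisym degree_le le_degree) auto
  have lc: "lead_coeff f = 1" using cf deg by simp
  have dg: "degree g < n" using assms(2) unfolding g_def
    by (intro degree_less_of_coeffs) (auto simp: coeff_sum)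
  have gI: "varx - in_y g \<in> I" using cx by (simp add: g_def)
  have fI: "in_y f \<in> I"
    using cy by (simp add: f_def in_y_diff in_y_monom flip: one_pCons)
  have "I \<subseteq> graph_ideal f g"
  proof
    fix p assume p: "p \<in> I"
    define r where "r = subst g p mod f"
    obtain s where s: "p = in_y (subst g p) + (varx - in_y g) * s" using subst_decomp by blast
    have "subst g p = subst g p div f * f + r" by (simp add: r_def)
    then have "in_y (subst g p) = in_y (subst g p div f) * in_y f + in_y r"
      by (metis in_y_add in_y_mult)
    then have "in_y r = p + ((- s) * (varx - in_y g) + (- in_y (subst g p div f)) * in_y f)"
      using s by (simp add: algebra_simps)
    also have "\<dots> \<in> I" using p gI fI by (intro I_add I_mult)
    finally have rI: "in_y r \<in> I" .
    have rd: "degree r < n"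
      unfolding r_def using degree_mod_less[of f "subst g p"] deg assms(2) by (cases "f = 0") auto
    define c where "c = restrict (\<lambda>b :: 'a poly poly. coeff r (inv_into UNIV (\<lambda>j. vary ^ j) b)) (basis_U n)"
    have cc: "c (vary ^ j) = coeff r j" if "j < n" for j
      using that by (auto simp: c_def basis_U_image)
    have "r = (\<Sum>j<n. monom (c (vary ^ j)) j)"
      using rd cc by (auto simp: poly_eq_iff coeff_sum coeff_eq_0)
    then have "rep_mod I (basis_U n) 0 c"
      using I_mult[OF rI, of "- 1"] unfolding rep_mod_def sum_basis_U by (simp add: c_def)
    moreover have "rep_mod I (basis_U n) 0 (restrict (\<lambda>_. 0) (basis_U n))"
      unfolding rep_mod_def using I_0 by simp
    ultimately have "c = restrict (\<lambda>_. 0) (basis_U n)" using ex1 by blast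
    then have "coeff r j = 0" if "j < n" for j
      using cc[OF that] that by (auto simp: basis_U_image)
    then have "r = 0" using rd by (intro poly_eqI) (metis coeff_0 coeff_eq_0 less_le_trans not_less)
    then show "p \<in> graph_ideal f g" unfolding graph_ideal_def r_def by (simp add: dvd_eq_mod_eq_0)
  qed
  then have "I = graph_ideal f g" using graph_ideal_subset[OF I gI fI] by blast
  then show ?thesis using that lc deg dg by blast
qed

lemma (in function_algebra) poly_family_subst:
  assumes "poly_family D g"
  shows "poly_family D (\<lambda>z. subst (g z) p)"
proof (induction p)
  case 0
  then show ?case by (simp add: poly_family_const)
next
  case (pCons a p)
  have "poly_family D (\<lambda>z. pcompose a (g z))"
  proof (induction a)
    case 0
    then show ?case by (simp add: poly_family_const)
  next
    case (pCons c a)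
    then show ?case unfolding pcompose_pCons
      using assms by (intro poly_family_add poly_family_mult poly_family_const)
  qed
  then show ?case unfolding subst_pCons
    using pCons by (intro poly_family_add poly_family_mult poly_family_const)
qed

section \<open>Common roots\<close>

text \<open>If the field were finite, the product of all monic linear polynomials plus 1 would be a
  nonconstant polynomial without roots.\<close>

lemma infinite_UNIV_alg_closed: "infinite (UNIV :: 'a::alg_closed_field set)"
proof
  assume fin: "finite (UNIV :: 'a set)"
  define P where "P = (\<Prod>a\<in>UNIV. [:- a, 1 :: 'a:])"
  have P0: "poly P x = 0" for x unfolding P_def using fin by (auto simp: poly_prod)
  have "P \<noteq> 0" unfolding P_def using fin by auto
  have "degree (P + 1) > 0"
  proof (rule ccontr)
    assume "\<not> ?thesis"
    then obtain c where "P + 1 = [:c:]" by (meson degree_eq_zeroE neq0_conv)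
    then have "P = [:c - 1:]" by (metis add_diff_cancel_right' diff_pCons diff_zero one_pCons)
    then have "c - 1 = 0" using P0[of 0] by simp
    then show False using \<open>P = [:c - 1:]\<close> \<open>P \<noteq> 0\<close> by simp
  qed
  then obtain x where "poly (P + 1) x = 0" using alg_closed_imp_poly_has_root by blast
  then show False using P0[of x] by simp
qed

lemma root_imp_factor: "poly p a = 0 \<Longrightarrow> \<exists>q. p = [:- a, 1:] * q"
  for p :: "'a::field poly"
  unfolding poly_eq_0_iff_dvd dvd_def .

lemma smult_one_mat_mult_vec:
  "v \<in> carrier_vec n \<Longrightarrow> (c \<cdot>\<^sub>m 1\<^sub>m n) *\<^sub>v v = c \<cdot>\<^sub>v v" for v :: "'a::field vec"
  by (intro eq_vecI) (auto simp: scalar_prod_def if_distrib[of "\<lambda>x. _ * x"] if_distrib[of "\<lambda>x. x * _"] sum.delta cong: if_cong)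

text \<open>At a root of \<open>F\<close> the value of \<open>G\<close> is nonzero, so
  \<open>q\<close> vanishes there and the linear factor cancels from \<open>F\<close> and
  \<open>q\<close>.\<close>

lemma dvd_of_dvd_mult_no_common_root:
  fixes F G q :: "'a::alg_closed_field poly"
  assumes "F \<noteq> 0" "F dvd G * q" "\<And>a. poly F a = 0 \<Longrightarrow> poly G a \<noteq> 0"
  shows "F dvd q"
  using assms
proof (induction "degree F" arbitrary: F q rule: less_induct)
  case less
  show ?case
  proof (cases "degree F = 0")
    case True
    then obtain c where "F = [:c:]" by (rule degree_eq_zeroE)
    then show ?thesis using less.prems(1) by (simp add: const_poly_dvd_iff dvd_field_iff)
  next
    case False
    then obtain a where a: "poly F a = 0" using alg_closed_imp_poly_has_root by blast
    then obtain F' where F': "F = [:- a, 1:] * F'" using root_imp_factor by blast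
    obtain r where r: "G * q = F * r" using less.prems(2) by (rule dvdE)
    have "poly G a * poly q a = 0" using arg_cong[OF r, of "\<lambda>p. poly p a"] a by simp
    then have "poly q a = 0" using less.prems(3)[OF a] by simp
    then obtain q' where q': "q = [:- a, 1:] * q'" using root_imp_factor by blast
    have "[:- a, 1:] * (G * q') = [:- a, 1:] * (F' * r)" using r unfolding F' q' by (simp only: mult.assoc mult.left_commute)
    moreover have "[:- a, 1:] \<noteq> (0 :: 'a poly)" by simp
    ultimately have "G * q' = F' * r" using mult_left_cancel by blast
    then have "F' dvd G * q'" by simp
    moreover have "F' \<noteq> 0" using less.prems(1) F' by auto
    moreover have "degree F' < degree F"
      using \<open>F' \<noteq> 0\<close> unfolding F' by (subst degree_mult_eq) auto
    moreover have "poly G b \<noteq> 0" if "poly F' b = 0" for b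
      using less.prems(3)[of b] that unfolding F' by simp
    ultimately have "F' dvd q'" using less.hyps[of F' q'] by blast
    then show ?thesis unfolding F' q' by (rule mult_dvd_mono[OF dvd_refl])
  qed
qed

lemma mult_dvd_of_no_common_root:
  fixes F G r :: "'a::alg_closed_field poly"
  assumes "G \<noteq> 0" "F dvd r" "G dvd r" "\<And>a. poly G a = 0 \<Longrightarrow> poly F a \<noteq> 0"
  shows "F * G dvd r"
proof -
  obtain s where s: "r = F * s" using assms(2) by (rule dvdE)
  then have "G dvd s" using assms by (intro dvd_of_dvd_mult_no_common_root[of G F s]) auto
  then show ?thesis unfolding s by (rule mult_dvd_mono[OF dvd_refl])
qed

lemma exists_monic_divisor:
  fixes h :: "'a::alg_closed_field poly"
  assumes "h \<noteq> 0" "s \<le> degree h"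
  shows "\<exists>d. lead_coeff d = 1 \<and> degree d = s \<and> d dvd h"
  using assms
proof (induction s arbitrary: h)
  case 0
  show ?case by (intro exI[of _ 1]) simp
next
  case (Suc s)
  then obtain a where "poly h a = 0" using alg_closed_imp_poly_has_root[of h] by auto
  then obtain h' where h': "h = [:- a, 1:] * h'" using root_imp_factor by blast
  have "h' \<noteq> 0" using Suc.prems(1) h' by auto
  then have "degree h = Suc (degree h')" unfolding h' by (subst degree_mult_eq) auto
  then obtain d where d: "lead_coeff d = 1" "degree d = s" "d dvd h'"
    using Suc.IH[OF \<open>h' \<noteq> 0\<close>] Suc.prems(2) by auto
  have "d \<noteq> 0" using d(1) by auto
  have "lead_coeff ([:- a, 1:] * d) = 1" by (simp only: lead_coeff_mult d(1)) simp
  moreover have "degree ([:- a, 1:] * d) = Suc s" using d(2) \<open>d \<noteq> 0\<close> by (subst degree_mult_eq) auto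
  moreover have "[:- a, 1:] * d dvd h" unfolding h' by (rule mult_dvd_mono[OF dvd_refl d(3)])
  ultimately show ?case by blast
qed

section \<open>Multiplication matrices and resultants\<close>

lemma coeff_mod_ge: "F \<noteq> 0 \<Longrightarrow> degree F \<le> i \<Longrightarrow> coeff (p mod F) i = 0"
  for F :: "'a::field poly"
  using degree_mod_less[of F p] by (auto intro: coeff_eq_0)

lemma sum_smult_mod:
  fixes F :: "'a::field poly"
  shows "(\<Sum>j\<in>J. smult (c j) (P j)) mod F = (\<Sum>j\<in>J. smult (c j) (P j mod F))"
  by (induction J rule: infinite_finite_induct) (auto simp: poly_mod_add_left mod_smult_left)

text \<open>Multiplication by \<open>G\<close> on \<open>k[y] / F\<close> in the basis of powers of
  \<open>y\<close>. For monic \<open>F\<close> its determinant is the resultant of \<open>F\<close>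
  and \<open>G\<close>, and its size does not change when the degree of \<open>G\<close>
  varies.\<close>

definition mult_matrix :: "'a::field poly \<Rightarrow> 'a poly \<Rightarrow> 'a mat" where
  "mult_matrix F G = mat (degree F) (degree F) (\<lambda>(i, j). coeff ((G * monom 1 j) mod F) i)"

lemma mult_matrix_carrier [simp]: "mult_matrix F G \<in> carrier_mat (degree F) (degree F)"
  by (simp add: mult_matrix_def)

text \<open>A kernel vector is a polynomial \<open>q\<close> that \<open>F\<close> does not divide
  although it divides \<open>G q\<close>, which forces a common root. Conversely, evaluation at
  \<open>a\<close>, given by the powers of \<open>a\<close>, is a left eigenvector with eigenvalue
  \<open>G(a)\<close>.\<close>

theorem det_mult_matrix_eq_0_iff:
  fixes F G :: "'a::alg_closed_field poly"
  assumes F: "lead_coeff F = 1"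
  shows "det (mult_matrix F G) = 0 \<longleftrightarrow> (\<exists>a. poly F a = 0 \<and> poly G a = 0)"
proof
  let ?m = "degree F" and ?M = "mult_matrix F G"
  have F0: "F \<noteq> 0" using F by auto
  {
    assume "det ?M = 0"
    then obtain v where v: "v \<in> carrier_vec ?m" "v \<noteq> 0\<^sub>v ?m" "?M *\<^sub>v v = 0\<^sub>v ?m"
      using det_0_iff_vec_prod_zero[OF mult_matrix_carrier] by blast
    define q where "q = (\<Sum>j<?m. monom (v $ j) j)"
    have cq: "coeff q j = (if j < ?m then v $ j else 0)" for j by (simp add: q_def coeff_sum)
    have "G * q = (\<Sum>j<?m. smult (v $ j) (G * monom 1 j))"
      by (simp add: q_def sum_distrib_left smult_monom mult_smult_right[symmetric])
    then have Gq: "G * q mod F = (\<Sum>j<?m. smult (v $ j) ((G * monom 1 j) mod F))"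
      by (simp add: sum_smult_mod)
    have "coeff (G * q mod F) i = 0" for i
    proof (cases "i < ?m")
      case True
      have "0 = (?M *\<^sub>v v) $ i" using v(3) True by simp
      also have "\<dots> = (\<Sum>j = 0..<?m. coeff ((G * monom 1 j) mod F) i * v $ j)"
        using True v(1) by (simp add: mult_matrix_def scalar_prod_def)
      also have "\<dots> = coeff (G * q mod F) i"
        unfolding Gq by (simp add: coeff_sum atLeast0LessThan mult.commute)
      finally show ?thesis by simp
    qed (simp add: coeff_mod_ge F0)
    then have "F dvd G * q" by (simp add: dvd_eq_mod_eq_0 poly_eq_iff)
    moreover have "q \<noteq> 0"
    proof
      assume "q = 0"
      then have "v $ j = 0" if "j < ?m" for j using cq[of j] that by simp
      then have "v = 0\<^sub>v ?m" using v(1) by (intro eq_vecI) auto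
      then show False using v(2) by simp
    qed
    moreover have "\<not> F dvd q"
    proof
      assume "F dvd q"
      then have "?m \<le> degree q" using \<open>q \<noteq> 0\<close> by (rule dvd_imp_degree_le)
      then have "lead_coeff q = 0" using cq by simp
      then show False using \<open>q \<noteq> 0\<close> by simp
    qed
    ultimately show "\<exists>a. poly F a = 0 \<and> poly G a = 0"
      using dvd_of_dvd_mult_no_common_root[OF F0, of G q] by blast
  next
    assume "\<exists>a. poly F a = 0 \<and> poly G a = 0"
    then obtain a where a: "poly F a = 0" "poly G a = 0" by blast
    have m: "?m > 0"
    proof (rule ccontr)
      assume "\<not> ?m > 0"
      then obtain c where "F = [:c:]" by (meson degree_eq_zeroE neq0_conv)
      then show False using a(1) F0 by simp
    qed
    define w where "w = vec ?m (\<lambda>i. a ^ i)"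
    have w: "w \<in> carrier_vec ?m" by (simp add: w_def)
    have "w \<noteq> 0\<^sub>v ?m"
    proof
      assume "w = 0\<^sub>v ?m"
      then have "w $ 0 = 0\<^sub>v ?m $ 0" by simp
      then show False using m by (simp add: w_def)
    qed
    moreover have "?M\<^sup>T *\<^sub>v w = 0\<^sub>v ?m"
    proof (rule eq_vecI)
      fix j assume j: "j < dim_vec (0\<^sub>v ?m :: 'a vec)"
      let ?p = "(G * monom 1 j) mod F"
      have "(?M\<^sup>T *\<^sub>v w) $ j = (\<Sum>i = 0..<?m. coeff ?p i * a ^ i)"
        using j by (simp add: mult_matrix_def scalar_prod_def w_def)
      also have "\<dots> = (\<Sum>i\<le>degree ?p. coeff ?p i * a ^ i)"
      proof (rule sum.mono_neutral_right)
        show "{..degree ?p} \<subseteq> {0..<?m}"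
          using degree_mod_less[OF F0, of "G * monom 1 j"] m by auto
      qed (auto simp: coeff_eq_0)
      also have "\<dots> = poly ?p a" by (simp add: poly_altdef)
      also have "\<dots> = poly (G * monom 1 j) a"
      proof -
        have "poly (G * monom 1 j) a = poly ((G * monom 1 j) div F * F) a + poly ?p a"
          by (metis div_mult_mod_eq poly_add)
        then show ?thesis using a(1) by (simp only: poly_mult) simp
      qed
      finally show "(?M\<^sup>T *\<^sub>v w) $ j = 0\<^sub>v ?m $ j" using a(2) j by simp
    qed (simp add: mult_matrix_def)
    ultimately have "det ?M\<^sup>T = 0"
      using det_0_iff_vec_prod_zero[of "?M\<^sup>T" ?m] w by auto
    then show "det ?M = 0" using det_transpose[OF mult_matrix_carrier] by metis
  }
qed

context function_algebra
begin

lemma mult_matrix_family: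
  assumes "poly_family D F" "\<And>z. lead_coeff (F z) = 1" "\<And>z. degree (F z) = m" "poly_family D G"
    and "i < m" "j < m"
  shows "(\<lambda>z. mult_matrix (F z) (G z) $$ (i, j)) \<in> D"
proof -
  have "poly_family D (\<lambda>z. (G z * monom 1 j) mod F z)"
    using assms by (intro poly_family_mod[where n = m] poly_family_mult poly_family_const)
  then show ?thesis using assms(3,5,6) by (simp add: mult_matrix_def coeff_family)
qed

lemma det_mult_matrix_family:
  assumes "poly_family D F" "\<And>z. lead_coeff (F z) = 1" "\<And>z. degree (F z) = m" "poly_family D G"
  shows "(\<lambda>z. det (mult_matrix (F z) (G z))) \<in> D"
proof (rule det_family)
  show "mult_matrix (F z) (G z) \<in> carrier_mat m m" for z
    using mult_matrix_carrier[of "F z" "G z"] unfolding assms(3) .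
qed (rule mult_matrix_family[OF assms])

end

section \<open>Curves in the Hilbert scheme\<close>

definition poly_functions :: "('a::field \<Rightarrow> 'a) set" where
  "poly_functions = range poly"

interpretation poly_functions: function_algebra "poly_functions :: ('a::field \<Rightarrow> 'a) set"
proof
  have p: "poly p \<in> poly_functions" for p :: "'a poly" by (simp add: poly_functions_def)
  have "1 = poly (1 :: 'a poly)" by (simp add: fun_eq_iff)
  then show "(1 :: 'a \<Rightarrow> 'a) \<in> poly_functions" using p by metis
  have "(\<lambda>_. c) = poly [:c:]" for c :: 'a by (simp add: fun_eq_iff)
  then show "(\<lambda>_. c) \<in> poly_functions" for c :: 'a using p by metis
  fix a b :: "'a \<Rightarrow> 'a" assume "a \<in> poly_functions" "b \<in> poly_functions"
  then obtain q r where qr: "a = poly q" "b = poly r" by (auto simp: poly_functions_def)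
  have "a + b = poly (q + r)" "a * b = poly (q * r)" by (auto simp: qr fun_eq_iff)
  then show "a + b \<in> poly_functions" "a * b \<in> poly_functions" using p by metis+
next
  fix a :: "'a \<Rightarrow> 'a" assume "a \<in> poly_functions"
  then obtain q where "a = poly q" by (auto simp: poly_functions_def)
  then have "- a = poly (- q)" by (auto simp: fun_eq_iff)
  then show "- a \<in> poly_functions" by (simp add: poly_functions_def)
qed

lemma finite_zeros_poly_functions:
  assumes "f \<in> poly_functions" "f t \<noteq> 0"
  shows "finite {t. f t = 0}"
proof -
  obtain p where p: "f = poly p" using assms(1) by (auto simp: poly_functions_def)
  then have "p \<noteq> 0" using assms(2) by auto
  then show ?thesis unfolding p by (rule poly_roots_finite)
qed

text \<open>Column \<open>j\<close> holds the residue of \<open>b j\<close> in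
  \<open>k[y] / f\<close>; thus the matrix compares \<open>B\<close> with the basis of powers of
  \<open>y\<close>.\<close>

definition chart_matrix ::
  "(nat \<Rightarrow> 'a::field poly poly) \<Rightarrow> 'a poly \<Rightarrow> 'a poly \<Rightarrow> 'a mat" where
  "chart_matrix b f g = mat (degree f) (degree f) (\<lambda>(i, j). coeff (subst g (b j) mod f) i)"

definition residue_vec :: "'a::field poly \<Rightarrow> 'a poly \<Rightarrow> 'a poly poly \<Rightarrow> 'a vec" where
  "residue_vec f g p = vec (degree f) (\<lambda>i. coeff (subst g p mod f) i)"

lemma chart_matrix_carrier [simp]: "chart_matrix b f g \<in> carrier_mat (degree f) (degree f)"
  by (simp add: chart_matrix_def)

lemma rep_mod_iff_chart_matrix:
  fixes f g :: "'a::field poly"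
  assumes f: "lead_coeff f = 1" and b: "bij_betw b {..<degree f} B"
  shows "rep_mod (graph_ideal f g) B p c \<longleftrightarrow>
    c \<in> extensional B \<and> chart_matrix b f g *\<^sub>v vec (degree f) (\<lambda>j. c (b j)) = residue_vec f g p"
proof -
  let ?n = "degree f"
  have f0: "f \<noteq> 0" using f by auto
  have "(\<Sum>u\<in>B. smult [:c u:] u) = (\<Sum>j<?n. smult [:c (b j):] (b j))"
    using sum.reindex_bij_betw[OF b, of "\<lambda>u. smult [:c u:] u"] by simp
  then have "subst g (p - (\<Sum>u\<in>B. smult [:c u:] u)) =
      subst g p - (\<Sum>j<?n. smult (c (b j)) (subst g (b j)))"
    by (simp add: subst_diff subst_sum subst_smult)
  then have "p - (\<Sum>u\<in>B. smult [:c u:] u) \<in> graph_ideal f g \<longleftrightarrow>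
      subst g p mod f = (\<Sum>j<?n. smult (c (b j)) (subst g (b j))) mod f"
    unfolding graph_ideal_def by (simp add: mod_eq_dvd_iff)
  also have "\<dots> \<longleftrightarrow> (\<forall>i. coeff (subst g p mod f) i = (\<Sum>j<?n. c (b j) * coeff (subst g (b j) mod f) i))"
    by (simp add: sum_smult_mod poly_eq_iff coeff_sum)
  also have "\<dots> \<longleftrightarrow> (\<forall>i<?n. coeff (subst g p mod f) i = (\<Sum>j<?n. c (b j) * coeff (subst g (b j) mod f) i))"
    using coeff_mod_ge[OF f0] by (metis (no_types, lifting) mult_zero_right not_less sum.neutral)
  also have "\<dots> \<longleftrightarrow> chart_matrix b f g *\<^sub>v vec ?n (\<lambda>j. c (b j)) = residue_vec f g p"
    unfolding vec_eq_iff
    by (auto simp: chart_matrix_def residue_vec_def scalar_prod_def atLeast0LessThan mult.commute)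
  finally show ?thesis unfolding rep_mod_def by blast
qed

text \<open>Coordinates with respect to \<open>B\<close> solve a linear system with this matrix.
  Cramer's rule writes them as polynomial expressions over the determinant, for an arbitrary
  chart.\<close>

lemma basis_mod_iff_det_chart_matrix:
  fixes f g :: "'a::field poly"
  assumes f: "lead_coeff f = 1" and b: "bij_betw b {..<degree f} B" and B: "finite B"
  shows "basis_mod (graph_ideal f g) B \<longleftrightarrow> det (chart_matrix b f g) \<noteq> 0" (is "?l \<longleftrightarrow> ?r")
    and "det (chart_matrix b f g) \<noteq> 0 \<Longrightarrow> j < degree f \<Longrightarrow>
      coord B p (b j) (graph_ideal f g) * det (chart_matrix b f g) =
      (adj_mat (chart_matrix b f g) *\<^sub>v residue_vec f g p) $ j"
proof -
  let ?n = "degree f" and ?T = "chart_matrix b f g"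
  let ?A = "adj_mat ?T"
  have T: "?T \<in> carrier_mat ?n ?n" by simp
  note adj = adj_mat[OF T]
  have r: "residue_vec f g p \<in> carrier_vec ?n" for p by (simp add: residue_vec_def)
  note rep = rep_mod_iff_chart_matrix[OF f b]
  have bj: "b j \<in> B" if "j < ?n" for j using b that by (auto simp: bij_betw_def)
  have binv: "inv_into {..<?n} b (b j) = j" if "j < ?n" for j
    using b that by (simp add: bij_betw_inv_into_left)
  have vec_c: "vec ?n (\<lambda>j. restrict (\<lambda>u. v $ (inv_into {..<?n} b u)) B (b j)) = v"
    if "v \<in> carrier_vec ?n" for v
    using that bj binv by (intro eq_vecI) auto
  have solve: "det ?T \<cdot>\<^sub>v v = ?A *\<^sub>v residue_vec f g p"
    if "v \<in> carrier_vec ?n" "?T *\<^sub>v v = residue_vec f g p" for v p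
  proof -
    have "?A *\<^sub>v residue_vec f g p = (?A * ?T) *\<^sub>v v"
      using that adj(1) T by (simp add: assoc_mult_mat_vec[OF adj(1) T that(1)])
    also have "\<dots> = det ?T \<cdot>\<^sub>v v" unfolding adj(3)
      using that(1) by (simp add: smult_one_mat_mult_vec)
    finally show ?thesis by simp
  qed
  have unique: "\<exists>!c. rep_mod (graph_ideal f g) B p c"
    and crd: "\<And>j. j < ?n \<Longrightarrow> coord B p (b j) (graph_ideal f g) * det ?T = (?A *\<^sub>v residue_vec f g p) $ j"
    if d: "det ?T \<noteq> 0" for p
  proof -
    let ?v = "inverse (det ?T) \<cdot>\<^sub>v (?A *\<^sub>v residue_vec f g p)"
    let ?c = "restrict (\<lambda>u. ?v $ (inv_into {..<?n} b u)) B"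
    have w: "?A *\<^sub>v residue_vec f g p \<in> carrier_vec ?n" for p
      by (rule mult_mat_vec_carrier[OF adj(1) r])
    then have v: "?v \<in> carrier_vec ?n" by simp
    have "vec ?n (\<lambda>j. ?c (b j)) = ?v" by (rule vec_c[OF v])
    moreover have "?T *\<^sub>v ?v = residue_vec f g p"
    proof -
      have "?T *\<^sub>v ?v = inverse (det ?T) \<cdot>\<^sub>v (?T *\<^sub>v (?A *\<^sub>v residue_vec f g p))"
        by (rule mult_mat_vec[OF T w])
      also have "?T *\<^sub>v (?A *\<^sub>v residue_vec f g p) = det ?T \<cdot>\<^sub>v residue_vec f g p"
        using assoc_mult_mat_vec[OF T adj(1) r, of p] unfolding adj(2) using r[of p]
        by (simp add: smult_one_mat_mult_vec)
      finally show ?thesis using d by (simp add: smult_smult_assoc)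
    qed
    ultimately have ex: "rep_mod (graph_ideal f g) B p ?c" unfolding rep by simp
    have uni: "c (b j) * det ?T = (?A *\<^sub>v residue_vec f g p) $ j"
      if "rep_mod (graph_ideal f g) B p c" "j < ?n" for c j
    proof -
      have "det ?T \<cdot>\<^sub>v vec ?n (\<lambda>j. c (b j)) = ?A *\<^sub>v residue_vec f g p"
        using that(1) unfolding rep by (intro solve) auto
      then have "(det ?T \<cdot>\<^sub>v vec ?n (\<lambda>j. c (b j))) $ j = (?A *\<^sub>v residue_vec f g p) $ j" by simp
      then show ?thesis using that(2) by (simp add: mult.commute)
    qed
    show ex1: "\<exists>!c. rep_mod (graph_ideal f g) B p c"
    proof (rule ex1I[of _ ?c])
      show "rep_mod (graph_ideal f g) B p ?c" by (rule ex)
      fix c assume c: "rep_mod (graph_ideal f g) B p c"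
      have "c u = ?c u" if u: "u \<in> B" for u
      proof -
        obtain j where j: "j < ?n" "u = b j" using b u unfolding bij_betw_def by auto
        then have "c u * det ?T = ?c u * det ?T" using uni[OF c j(1)] uni[OF ex j(1)] by simp
        then show ?thesis using d by simp
      qed
      then show "c = ?c" using c unfolding rep_mod_def by (intro extensionalityI[of _ B]) auto
    qed
    show "coord B p (b j) (graph_ideal f g) * det ?T = (?A *\<^sub>v residue_vec f g p) $ j" if "j < ?n" for j
      unfolding coord_def using uni[OF theI'[OF ex1] that] .
  qed
  then show "det ?T \<noteq> 0 \<Longrightarrow> j < ?n \<Longrightarrow>
      coord B p (b j) (graph_ideal f g) * det ?T = (?A *\<^sub>v residue_vec f g p) $ j" by blast
  show "?l \<longleftrightarrow> ?r"
  proof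
    assume ?r
    then show ?l unfolding basis_mod_def using unique B by blast
  next
    assume l: ?l
    show ?r
    proof
      assume "det ?T = 0"
      then obtain v where v: "v \<in> carrier_vec ?n" "v \<noteq> 0\<^sub>v ?n" "?T *\<^sub>v v = 0\<^sub>v ?n"
        using det_0_iff_vec_prod_zero[OF T] by blast
      have r0: "residue_vec f g 0 = 0\<^sub>v ?n" by (intro eq_vecI) (auto simp: residue_vec_def)
      let ?c = "restrict (\<lambda>u. v $ (inv_into {..<?n} b u)) B"
      have "vec ?n (\<lambda>j. ?c (b j)) = v" by (rule vec_c[OF v(1)])
      then have "rep_mod (graph_ideal f g) B 0 ?c" unfolding rep r0 using v(3) by simp
      moreover have "rep_mod (graph_ideal f g) B 0 (restrict (\<lambda>_. 0) B)"
        unfolding rep_mod_def graph_ideal_def by simp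
      ultimately have c0: "?c = restrict (\<lambda>_. 0) B" using l unfolding basis_mod_def by blast
      have "v $ j = 0" if "j < ?n" for j
        using fun_cong[OF c0, of "b j"] bj[OF that] binv[OF that] by simp
      then have "v = 0\<^sub>v ?n" using v(1) by (intro eq_vecI) auto
      then show False using v(2) by simp
    qed
  qed
qed

locale curve =
  fixes f g :: "'a::field \<Rightarrow> 'a poly" and n :: nat
  assumes f: "poly_family poly_functions f" "\<And>t. lead_coeff (f t) = 1" "\<And>t. degree (f t) = n"
    and g: "poly_family poly_functions g"
begin

abbreviation pt where "pt t \<equiv> graph_ideal (f t) (g t)"

text \<open>The determinant of the chart and, where it does not vanish, \<open>\<phi>\<close> times
  a power of it are given by polynomials in the parameter. Neither polynomial vanishes at
  \<open>t0\<close>, so each has finitely many zeros.\<close>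

lemma finite_complement_basic_open:
  assumes B: "finite B" "card B = n" and \<phi>: "\<phi> \<in> regular_functions B"
    and t0: "pt t0 \<in> chart B" "\<phi> (pt t0) \<noteq> 0"
  shows "finite {t. pt t \<notin> {I \<in> chart B. \<phi> I \<noteq> 0}}"
proof -
  obtain b where b: "bij_betw b {..<n} B"
    using ex_bij_betw_nat_finite[OF B(1)] B(2) by (auto simp: atLeast0LessThan)
  have bt: "bij_betw b {..<degree (f t)} B" for t using b f(3) by simp
  let ?T = "\<lambda>t. chart_matrix b (f t) (g t)"
  have T: "?T t \<in> carrier_mat n n" for t using chart_matrix_carrier[of b "f t" "g t"] f(3) by simp
  have fam: "(\<lambda>t. coeff (subst (g t) p mod f t) i) \<in> poly_functions" for p i
    by (intro poly_functions.coeff_family poly_functions.poly_family_mod[where n = n]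
        poly_functions.poly_family_subst f g)
  have Tent: "(\<lambda>t. ?T t $$ (i, j)) \<in> poly_functions" if "i < n" "j < n" for i j
    using that fam[of "b j" i] by (simp add: chart_matrix_def f(3))
  have detT: "(\<lambda>t. det (?T t)) \<in> poly_functions"
    by (rule poly_functions.det_family[OF T Tent])
  have adjT: "(\<lambda>t. adj_mat (?T t) $$ (i, j)) \<in> poly_functions" if ij: "i < n" "j < n" for i j
  proof -
    have "(\<lambda>t. det (mat_delete (?T t) j i)) \<in> poly_functions"
    proof (rule poly_functions.det_family)
      show "mat_delete (?T t) j i \<in> carrier_mat (n - 1) (n - 1)" for t
        using T by (rule mat_delete_carrier)
      fix k l assume kl: "k < n - 1" "l < n - 1"
      have Tdim: "dim_row (?T t) = n" "dim_col (?T t) = n" for t using T[of t] by auto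
      have "(\<lambda>t. mat_delete (?T t) j i $$ (k, l)) =
          (\<lambda>t. ?T t $$ (if k < j then k else Suc k, if l < i then l else Suc l))"
        using kl by (simp add: mat_delete_def Tdim)
      then show "(\<lambda>t. mat_delete (?T t) j i $$ (k, l)) \<in> poly_functions"
        using kl by (auto intro!: Tent)
    qed
    then have "(\<lambda>t. (- 1) ^ (j + i) * det (mat_delete (?T t) j i)) \<in> poly_functions"
      by (intro poly_functions.pointwise poly_functions.const)
    moreover have "adj_mat (?T t) $$ (i, j) = (- 1) ^ (j + i) * det (mat_delete (?T t) j i)" for t
      using T[of t] ij by (auto simp: adj_mat_def cofactor_def)
    ultimately show ?thesis by simp
  qed
  \<comment> \<open>The exponent \<open>k\<close> counts the denominators collected: one for a
    coordinate, and the total of both summands or factors otherwise.\<close>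
  have rep: "\<exists>k P. P \<in> poly_functions \<and> (\<forall>t. det (?T t) \<noteq> 0 \<longrightarrow> \<psi> (pt t) * det (?T t) ^ k = P t)"
    if "\<psi> \<in> regular_functions B" for \<psi>
    using that
  proof (induction rule: regular_functions.induct)
    case (const c)
    show ?case by (intro exI[of _ 0] exI[of _ "\<lambda>_. c"]) (simp add: poly_functions.const)
  next
    case (coord u p)
    obtain j where j: "j < n" "u = b j" using b coord unfolding bij_betw_def by auto
    define P where "P t = (\<Sum>i<n. adj_mat (?T t) $$ (j, i) * coeff (subst (g t) p mod f t) i)" for t
    have "P \<in> poly_functions" unfolding P_def
      using adjT[OF j(1)] fam by (intro poly_functions.pointwise_sum poly_functions.pointwise) auto
    moreover have "coord B p u (pt t) * det (?T t) ^ 1 = P t" if d: "det (?T t) \<noteq> 0" for t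
    proof -
      have "coord B p u (pt t) * det (?T t) = (adj_mat (?T t) *\<^sub>v residue_vec (f t) (g t) p) $ j"
        using basis_mod_iff_det_chart_matrix(2)[OF f(2) bt B(1) d] j by (simp add: f(3))
      also have "\<dots> = P t"
        using j(1) adj_mat(1)[OF T, of t] unfolding P_def residue_vec_def
        by (auto simp: scalar_prod_def f(3) atLeast0LessThan)
      finally show ?thesis by simp
    qed
    ultimately show ?case by blast
  next
    case (add \<psi> \<chi>)
    then obtain k P l Q where P: "P \<in> poly_functions" "\<And>t. det (?T t) \<noteq> 0 \<Longrightarrow> \<psi> (pt t) * det (?T t) ^ k = P t"
      and Q: "Q \<in> poly_functions" "\<And>t. det (?T t) \<noteq> 0 \<Longrightarrow> \<chi> (pt t) * det (?T t) ^ l = Q t" by metis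
    have "(\<lambda>t. P t * det (?T t) ^ l + Q t * det (?T t) ^ k) \<in> poly_functions"
      using P(1) Q(1) detT by (intro poly_functions.pointwise poly_functions.pointwise_power)
    moreover have "(\<psi> (pt t) + \<chi> (pt t)) * det (?T t) ^ (k + l) = P t * det (?T t) ^ l + Q t * det (?T t) ^ k"
      if "det (?T t) \<noteq> 0" for t
      using P(2)[OF that, symmetric] Q(2)[OF that, symmetric] by (simp add: power_add algebra_simps)
    ultimately show ?case by blast
  next
    case (mult \<psi> \<chi>)
    then obtain k P l Q where P: "P \<in> poly_functions" "\<And>t. det (?T t) \<noteq> 0 \<Longrightarrow> \<psi> (pt t) * det (?T t) ^ k = P t"
      and Q: "Q \<in> poly_functions" "\<And>t. det (?T t) \<noteq> 0 \<Longrightarrow> \<chi> (pt t) * det (?T t) ^ l = Q t" by metis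
    have "(\<lambda>t. P t * Q t) \<in> poly_functions"
      using P(1) Q(1) by (intro poly_functions.pointwise)
    moreover have "(\<psi> (pt t) * \<chi> (pt t)) * det (?T t) ^ (k + l) = P t * Q t"
      if "det (?T t) \<noteq> 0" for t
      using P(2)[OF that, symmetric] Q(2)[OF that, symmetric] by (simp add: power_add algebra_simps)
    ultimately show ?case by blast
  qed
  obtain k P where P: "P \<in> poly_functions" "\<And>t. det (?T t) \<noteq> 0 \<Longrightarrow> \<phi> (pt t) * det (?T t) ^ k = P t"
    using rep[OF \<phi>] by blast
  have chart: "pt t \<in> chart B \<longleftrightarrow> det (?T t) \<noteq> 0" for t
    unfolding chart_def using ideal_graph_ideal basis_mod_iff_det_chart_matrix(1)[OF f(2) bt B(1)] by blast
  have d0: "det (?T t0) \<noteq> 0" using t0(1) chart by blast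
  have "P t0 \<noteq> 0" using P(2)[OF d0, symmetric] t0(2) d0 by simp
  then have "finite ({t. det (?T t) = 0} \<union> {t. P t = 0})"
    using finite_zeros_poly_functions[OF detT d0] finite_zeros_poly_functions[OF P(1)] by blast
  moreover have "{t. pt t \<notin> {I \<in> chart B. \<phi> I \<noteq> 0}} \<subseteq> {t. det (?T t) = 0} \<union> {t. P t = 0}"
    using chart P(2) by fastforce
  ultimately show ?thesis by (rule rev_finite_subset)
qed

text \<open>This plays the role of irreducibility of the line: an open set through one point of the
  curve can be intersected with any finite list of generic conditions on the parameter.\<close>

lemma finite_complement_open:
  assumes "openin (hilb_zariski n) U" "pt t0 \<in> U"
  shows "finite {t. pt t \<notin> U}"
proof -
  have "generate_topology_on {{I \<in> chart B. \<phi> I \<noteq> 0} |B \<phi>. finite B \<and> card B = n \<and> \<phi> \<in> regular_functions B} U"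
    using assms(1) unfolding hilb_zariski_def openin_topology_generated_by_iff .
  then show ?thesis using assms(2)
  proof (induction arbitrary: t0 rule: generate_topology_on.induct)
    case (Int a b)
    then have "finite ({t. pt t \<notin> a} \<union> {t. pt t \<notin> b})" by blast
    then show ?case by (rule rev_finite_subset) blast
  next
    case (UN K)
    then obtain k where k: "k \<in> K" "pt t0 \<in> k" by blast
    then have "finite {t. pt t \<notin> k}" using UN by blast
    then show ?case by (rule rev_finite_subset) (use k in blast)
  next
    case (Basis s)
    then obtain B \<phi> where s: "s = {I \<in> chart B. \<phi> I \<noteq> 0}" "finite B" "card B = n" "\<phi> \<in> regular_functions B"
      by blast
    then show ?case using Basis.prems finite_complement_basic_open[OF s(2,3,4), of t0] by simp
  qed simp
qed

end

section \<open>Equations for the subvarieties\<close>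

text \<open>A point of \<open>U\<close> is a pair \<open>(f, g)\<close> standing for the ideal \<open>(f(y), x - g(y))\<close>. A subscheme
  \<open>I\<^sub>3\<close> of the labels forces \<open>y\<^sup>d\<close> to divide \<open>f\<close> and \<open>y\<^sup>w\<close> to divide \<open>g\<close>, with the following
  exponents; the points on the \<open>y\<close>-axis contribute a common factor \<open>h\<close> of degree \<open>s\<close>.\<close>

definition pairs :: "nat \<Rightarrow> nat \<Rightarrow> nat \<Rightarrow> nat \<Rightarrow> ('a::field poly \<times> 'a poly) set" where
  "pairs n s d w = {(f, g). lead_coeff f = 1 \<and> degree f = n \<and> degree g < n \<and>
     (\<exists>h. s \<le> degree h \<and> monom 1 d * h dvd f \<and> monom 1 w * h dvd g)}"

text \<open>For \<open>+1\<close> with \<open>u = 0\<close> the free point lies on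
  \<open>y = 0\<close> with arbitrary \<open>x\<close>, so \<open>f\<close> is divisible by
  \<open>y\<close> and \<open>g\<close> is unrestricted. For \<open>+1\<close> with
  \<open>u >= 2\<close> the ideals in \<open>U\<close> are \<open>(y^u, x - c y^(u-1))\<close>,
  which leaves one more coefficient of \<open>g\<close> free than \<open>+0\<close> does.\<close>

fun y_exponents :: "nat \<Rightarrow> plus_label \<Rightarrow> nat \<times> nat" where
  "y_exponents u Plus0 = (u, u)"
| "y_exponents u Plus1 = (if u = 0 then (1, 0) else (u, u - 1))"

lemma lead_coeff_monom_1_mult: "lead_coeff (monom 1 d * p) = lead_coeff p"
  for p :: "'a::field poly"
  unfolding lead_coeff_mult by (simp add: Polynomial.degree_monom_eq)

lemma degree_monom_1_mult: "p \<noteq> 0 \<Longrightarrow> degree (monom 1 d * p) = d + degree p"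
  for p :: "'a::field poly"
  using degree_mult_eq[of "monom 1 d" p] by (simp add: Polynomial.degree_monom_eq)

text \<open>A monic divisor of degree exactly \<open>s\<close> can replace the common factor. The
  count \<open>n - w - s = t + d - w\<close> then bounds \<open>q\<close>; stating it through
  vanishing coefficients includes the case that \<open>q\<close> must be 0.\<close>

lemma pairs_decomp:
  fixes f g :: "'a::alg_closed_field poly"
  assumes fg: "(f, g) \<in> pairs n s d w" and n: "n = s + d + t" and w: "w \<le> d" "1 \<le> n"
  obtains h e q where "lead_coeff h = 1" "degree h = s" "lead_coeff e = 1" "degree e = t"
    "f = monom 1 d * (h * e)" "g = monom 1 w * (h * q)" "\<And>i. t + d - w \<le> i \<Longrightarrow> coeff q i = 0"
proof -
  obtain h' where f: "lead_coeff f = 1" "degree f = n" "degree g < n"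
    and h': "s \<le> degree h'" "monom 1 d * h' dvd f" "monom 1 w * h' dvd g"
    using fg unfolding pairs_def by blast
  have f0: "f \<noteq> 0" using f by auto
  have "h' \<noteq> 0" using h'(2) f0 by auto
  then obtain h where h: "lead_coeff h = 1" "degree h = s" "h dvd h'"
    using exists_monic_divisor h'(1) by blast
  have h0: "h \<noteq> 0" using h(1) by auto
  have "monom 1 d * h dvd f" using h'(2) mult_dvd_mono[OF dvd_refl h(3)] by (rule dvd_trans[rotated])
  then obtain e where "f = monom 1 d * h * e" by (rule dvdE)
  then have e: "f = monom 1 d * (h * e)" by (simp only: mult.assoc)
  have "monom 1 w * h dvd g" using h'(3) mult_dvd_mono[OF dvd_refl h(3)] by (rule dvd_trans[rotated])
  then obtain q where "g = monom 1 w * h * q" by (rule dvdE)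
  then have q: "g = monom 1 w * (h * q)" by (simp only: mult.assoc)
  have e0: "e \<noteq> 0" using f0 e by auto
  have "lead_coeff f = lead_coeff h * lead_coeff e"
    unfolding e lead_coeff_monom_1_mult by (rule lead_coeff_mult)
  then have le: "lead_coeff e = 1" using f(1) h(1) by simp
  have "degree f = d + (s + degree e)"
    unfolding e using h0 e0 h(2) degree_monom_1_mult[of "h * e" d] degree_mult_eq[of h e] by simp
  then have de: "degree e = t" using f(2) n by simp
  have "coeff q i = 0" if "t + d - w \<le> i" for i
  proof (cases "q = 0")
    case False
    have "degree g = w + (s + degree q)"
      unfolding q using h0 False h(2) degree_monom_1_mult[of "h * q" w] degree_mult_eq[of h q] by simp
    then have "degree q < i" using f(3) n w that by linarith
    then show ?thesis by (rule coeff_eq_0)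
  qed simp
  then show ?thesis using that h(1,2) le de e q by blast
qed

lemma pairsI:
  fixes h e q :: "'a::field poly"
  assumes h: "lead_coeff h = 1" "degree h = s" and e: "lead_coeff e = 1" "degree e = t"
    and q: "\<And>i. t + d - w \<le> i \<Longrightarrow> coeff q i = 0" and n: "n = s + d + t" and w: "w \<le> d" "1 \<le> n"
  shows "(monom 1 d * (h * e), monom 1 w * (h * q)) \<in> pairs n s d w"
proof -
  have h0: "h \<noteq> 0" and e0: "e \<noteq> 0" using h e by auto
  have "lead_coeff (monom 1 d * (h * e)) = 1"
  proof -
    have "lead_coeff (h * e) = 1" unfolding lead_coeff_mult h(1) e(1) by simp
    then show ?thesis unfolding lead_coeff_monom_1_mult .
  qed
  moreover have "degree (monom 1 d * (h * e)) = n"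
    using h0 e0 h(2) e(2) n degree_monom_1_mult[of "h * e" d] degree_mult_eq[of h e] by simp
  moreover have "degree (monom 1 w * (h * q)) < n"
  proof (cases "q = 0")
    case False
    have "degree q < t + d - w" using q[of "degree q"] False by (cases "t + d - w \<le> degree q") auto
    moreover have "degree (monom 1 w * (h * q)) = w + (s + degree q)"
      using h0 False h(2) degree_monom_1_mult[of "h * q" w] degree_mult_eq[of h q] by simp
    ultimately show ?thesis using n w by linarith
  qed (use w in simp)
  moreover have "monom 1 d * h dvd monom 1 d * (h * e)" "monom 1 w * h dvd monom 1 w * (h * q)"
    by (simp_all only: mult.assoc[symmetric] dvd_triv_left)
  ultimately show ?thesis using h(2) unfolding pairs_def by blast
qed

subsection \<open>Coordinates on the chart\<close>

text \<open>Together with \<open>g_of\<close> this inverts the passage from \<open>(f, g)\<close> to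
  the graph ideal, with coefficients that are visibly regular functions. It is defined for every set
  \<open>I\<close>, and is monic of degree \<open>n\<close> also outside the chart.\<close>

definition f_of :: "nat \<Rightarrow> 'a::field poly poly set \<Rightarrow> 'a poly" where
  "f_of n I = monom 1 n - (\<Sum>j<n. monom (coord (basis_U n) (vary ^ n) (vary ^ j) I) j)"

definition g_of :: "nat \<Rightarrow> 'a::field poly poly set \<Rightarrow> 'a poly" where
  "g_of n I = (\<Sum>j<n. monom (coord (basis_U n) varx (vary ^ j) I) j)"

lemma coeff_f_of: "coeff (f_of n I) i =
    (if i < n then - coord (basis_U n) (vary ^ n) (vary ^ i) I else if i = n then 1 else 0)"
  by (auto simp: f_of_def coeff_sum)

lemma coeff_g_of: "coeff (g_of n I) i = (if i < n then coord (basis_U n) varx (vary ^ i) I else 0)"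
  by (auto simp: g_of_def coeff_sum)

lemma degree_f_of: "degree (f_of n I) = n"
  by (intro antisym degree_le le_degree) (auto simp: coeff_f_of)

lemma f_of_graph_ideal:
  assumes f: "lead_coeff f = 1" "degree f = n"
  shows "f_of n (graph_ideal f g) = f"
proof (rule poly_eqI)
  fix i
  have f0: "f \<noteq> 0" using f by auto
  show "coeff (f_of n (graph_ideal f g)) i = coeff f i"
  proof (cases "i < n")
    case True
    have deg: "degree (monom 1 n - f) < n"
      using True f by (intro degree_less_of_coeffs) (auto simp: coeff_eq_0 le_less)
    have s: "subst g (vary ^ n) = monom 1 n" by (simp add: subst_power monom_altdef)
    have "monom 1 n mod f = (monom 1 n - f) mod f" by (simp add: mod_eq_dvd_iff)
    also have "\<dots> = monom 1 n - f" using deg f(2) by (intro mod_poly_less) simp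
    finally show ?thesis using True
      by (simp add: coeff_f_of coord_graph_ideal[OF f] s)
  next
    case False
    then show ?thesis using f by (auto simp: coeff_f_of coeff_eq_0)
  qed
qed

lemma g_of_graph_ideal:
  assumes f: "lead_coeff f = 1" "degree f = n" and g: "degree g < n"
  shows "g_of n (graph_ideal f g) = g"
proof (rule poly_eqI)
  fix i
  have "g mod f = g" using g f by (intro mod_poly_less) simp
  then show "coeff (g_of n (graph_ideal f g)) i = coeff g i"
    using g by (auto simp: coeff_g_of coord_graph_ideal[OF f] coeff_eq_0)
qed

lemma function_algebra_regular_functions: "function_algebra (regular_functions B)"
proof
  have one: "1 = (\<lambda>I. 1)" by (simp add: fun_eq_iff)
  show "1 \<in> regular_functions B" unfolding one by (rule regular_functions.const)
  show "(\<lambda>_. c) \<in> regular_functions B" for c by (rule regular_functions.const)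
  fix a b assume a: "a \<in> regular_functions B"
  have "- a = (\<lambda>I. (- 1) * a I)" by (simp add: fun_eq_iff)
  then show "- a \<in> regular_functions B"
    using regular_functions.mult[OF regular_functions.const a] by metis
  assume "b \<in> regular_functions B"
  then show "a + b \<in> regular_functions B" "a * b \<in> regular_functions B"
    using a regular_functions.add regular_functions.mult by (auto simp: plus_fun_def times_fun_def)
qed

interpretation regular: function_algebra "regular_functions B"
  by (rule function_algebra_regular_functions)

lemma poly_family_f_of: "poly_family (regular_functions (basis_U n)) (f_of n :: 'a::field poly poly set \<Rightarrow> 'a poly)"
proof (rule regular.poly_familyI[where d = n])
  fix i
  show "(\<lambda>I :: 'a poly poly set. coeff (f_of n I) i) \<in> regular_functions (basis_U n)"
  proof (cases "i < n")
    case True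
    then have "vary ^ i \<in> (basis_U n :: 'a poly poly set)" by (auto simp: basis_U_def)
    then show ?thesis using True unfolding coeff_f_of
      by (auto intro!: regular.pointwise(4) regular_functions.coord)
  qed (simp add: coeff_f_of regular.const)
qed (simp add: degree_f_of)

lemma poly_family_g_of: "poly_family (regular_functions (basis_U n)) (g_of n :: 'a::field poly poly set \<Rightarrow> 'a poly)"
proof (rule regular.poly_familyI[where d = n])
  fix i
  show "(\<lambda>I :: 'a poly poly set. coeff (g_of n I) i) \<in> regular_functions (basis_U n)"
  proof (cases "i < n")
    case True
    then have "vary ^ i \<in> (basis_U n :: 'a poly poly set)" by (auto simp: basis_U_def)
    then show ?thesis using True unfolding coeff_g_of by (auto intro!: regular_functions.coord)
  qed (simp add: coeff_g_of regular.const)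
qed (auto intro: degree_le simp: coeff_g_of)

lemma (in function_algebra) poly_family_shift:
  assumes "poly_family D P"
  shows "poly_family D (\<lambda>z. poly_shift d (P z))"
proof -
  obtain k where k: "\<And>z. degree (P z) \<le> k" using assms unfolding poly_family_def by blast
  show ?thesis
  proof (rule poly_familyI[where d = k])
    show "(\<lambda>z. coeff (poly_shift d (P z)) i) \<in> D" for i
      using coeff_family[OF assms] by (simp add: coeff_poly_shift)
    show "degree (poly_shift d (P z)) \<le> k" for z
      using k[of z] by (intro degree_le) (auto simp: coeff_poly_shift coeff_eq_0)
  qed
qed

lemma poly_shift_monom_mult: "poly_shift d (monom 1 d * p) = p"
  for p :: "'a::field poly"
  by (rule poly_eqI) (simp add: coeff_poly_shift coeff_monom_mult)

lemma monom_mult_poly_shift: "monom 1 d dvd p \<Longrightarrow> monom 1 d * poly_shift d p = p"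
  for p :: "'a::field poly"
  by (auto elim!: dvdE simp: poly_shift_monom_mult)

text \<open>The equations: vanishing low coefficients of \<open>f\<close> and \<open>g\<close>, and in addition the resultant
  of \<open>f / y\<^sup>d\<close> and \<open>g / y\<^sup>w\<close> if \<open>s = 1\<close>, or proportionality of \<open>f / y\<^sup>d\<close> and \<open>g / y\<^sup>w\<close> if \<open>t = 0\<close>.\<close>

lemma pairs_closed:
  fixes f g :: "'a::alg_closed_field poly"
  assumes f: "lead_coeff f = 1" "degree f = n" and g: "degree g < n"
    and no: "(f, g) \<notin> pairs n s d w" and n: "n = s + d + t" and w: "w \<le> d" "d \<le> Suc w" "1 \<le> n"
    and st: "s = 0 \<or> s = 1 \<or> t = 0"
  shows "\<exists>\<phi>\<in>regular_functions (basis_U n). \<phi> (graph_ideal f g) \<noteq> 0 \<and>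
    (\<forall>(f', g')\<in>pairs n s d w. \<phi> (graph_ideal f' g') = 0)"
proof -
  let ?R = "regular_functions (basis_U n) :: ('a poly poly set \<Rightarrow> 'a) set"
  note of_f = f_of_graph_ideal[OF f, of g] and of_g = g_of_graph_ideal[OF f g]
  have of_f': "f_of n (graph_ideal f' g') = f'" and of_g': "g_of n (graph_ideal f' g') = g'"
    if "(f', g') \<in> pairs n s d w" for f' g' :: "'a poly"
    using that unfolding pairs_def by (auto intro: f_of_graph_ideal g_of_graph_ideal)
  have div: "monom 1 d dvd f'" "monom 1 w dvd g'" if "(f', g') \<in> pairs n s d w" for f' g' :: "'a poly"
    using that unfolding pairs_def by (auto intro: dvd_mult_left)
  show ?thesis
  proof (cases "monom 1 d dvd f \<and> monom 1 w dvd g")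
    case False
    then consider k where "k < d" "coeff f k \<noteq> 0" | k where "k < w" "coeff g k \<noteq> 0"
      unfolding monom_1_dvd_iff' by blast
    then show ?thesis
    proof cases
      case 1
      show ?thesis
      proof (intro bexI[of _ "\<lambda>I. coeff (f_of n I) k"] conjI ballI)
        show "(\<lambda>I. coeff (f_of n I) k) \<in> ?R" by (rule regular.coeff_family[OF poly_family_f_of])
        show "coeff (f_of n (graph_ideal f g)) k \<noteq> 0" using 1 of_f by simp
        show "case z of (f', g') \<Rightarrow> coeff (f_of n (graph_ideal f' g')) k = 0"
          if z: "z \<in> pairs n s d w" for z :: "'a poly \<times> 'a poly"
        proof (cases z)
          case (Pair f' g')
          then show ?thesis using of_f'[of f' g'] div(1)[of f' g'] z 1(1) by (simp add: monom_1_dvd_iff')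
        qed
      qed
    next
      case 2
      show ?thesis
      proof (intro bexI[of _ "\<lambda>I. coeff (g_of n I) k"] conjI ballI)
        show "(\<lambda>I. coeff (g_of n I) k) \<in> ?R" by (rule regular.coeff_family[OF poly_family_g_of])
        show "coeff (g_of n (graph_ideal f g)) k \<noteq> 0" using 2 of_g by simp
        show "case z of (f', g') \<Rightarrow> coeff (g_of n (graph_ideal f' g')) k = 0"
          if z: "z \<in> pairs n s d w" for z :: "'a poly \<times> 'a poly"
        proof (cases z)
          case (Pair f' g')
          then show ?thesis using of_g'[of f' g'] div(2)[of f' g'] z 2(1) by (simp add: monom_1_dvd_iff')
        qed
      qed
    qed
  next
    case True
    define F where "F = poly_shift d f"
    define G where "G = poly_shift w g"
    have fF: "f = monom 1 d * F" and gG: "g = monom 1 w * G"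
      using True monom_mult_poly_shift unfolding F_def G_def by metis+
    have F0: "F \<noteq> 0" using f(1) fF by auto
    have degF: "degree F = s + t" using f(2) n degree_monom_1_mult[OF F0, of d] unfolding fF by simp
    have notdvd: "\<not> (h dvd F \<and> h dvd G)" if "s \<le> degree h" for h
    proof
      assume "h dvd F \<and> h dvd G"
      then have "monom 1 d * h dvd f" "monom 1 w * h dvd g"
        unfolding fF gG by (auto intro: mult_dvd_mono)
      then show False using no f g that unfolding pairs_def by blast
    qed
    have s0: "s \<noteq> 0" using notdvd[of 1] by auto
    show ?thesis
    proof (cases "t = 0")
      case False
      then have s: "s = 1" using st s0 by simp
      \<comment> \<open>An explicit form of the shifted polynomial, which shows it to be monic of
        constant degree at every \<open>I\<close>, also outside the chart, as a family of
        determinants requires.\<close>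
      define Fz where "Fz I = monom 1 (s + t) + (\<Sum>i<s + t. monom (coeff (f_of n I) (i + d)) i)"
        for I :: "'a poly poly set"
      have cFz: "coeff (Fz I) i = (if i < s + t then coeff (f_of n I) (i + d) else if i = s + t then 1 else 0)"
        for I i by (auto simp: Fz_def coeff_sum)
      have Fz: "Fz I = poly_shift d (f_of n I)" for I
        using n by (intro poly_eqI) (auto simp: cFz coeff_poly_shift coeff_f_of)
      have dFz: "degree (Fz I) = s + t" for I
        by (intro antisym degree_le le_degree) (auto simp: cFz)
      have lFz: "lead_coeff (Fz I) = 1" for I by (simp add: dFz cFz)
      let ?\<phi> = "\<lambda>I :: 'a poly poly set. det (mult_matrix (poly_shift d (f_of n I)) (poly_shift w (g_of n I)))"
      show ?thesis
      proof (intro bexI[of _ ?\<phi>] conjI ballI)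
        show "?\<phi> \<in> ?R"
        proof (rule regular.det_mult_matrix_family)
          show "lead_coeff (poly_shift d (f_of n I)) = 1" for I :: "'a poly poly set"
            using lFz[of I] unfolding Fz .
          show "degree (poly_shift d (f_of n I)) = s + t" for I :: "'a poly poly set"
            using dFz[of I] unfolding Fz .
        qed (intro regular.poly_family_shift poly_family_f_of poly_family_g_of)+
        have "\<not> (\<exists>a. poly F a = 0 \<and> poly G a = 0)"
        proof
          assume "\<exists>a. poly F a = 0 \<and> poly G a = 0"
          then obtain a where "[:- a, 1:] dvd F" "[:- a, 1:] dvd G" by (auto simp: poly_eq_0_iff_dvd)
          then show False using notdvd[of "[:- a, 1:]"] s by simp
        qed
        moreover have "lead_coeff F = 1"
          using f(1) unfolding fF lead_coeff_monom_1_mult .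
        ultimately show "?\<phi> (graph_ideal f g) \<noteq> 0"
          unfolding of_f of_g F_def[symmetric] G_def[symmetric] by (simp add: det_mult_matrix_eq_0_iff)
        fix z :: "'a poly \<times> 'a poly" assume z: "z \<in> pairs n s d w"
        obtain f' g' where z': "z = (f', g')" by (cases z)
        obtain h where h: "1 \<le> degree h" "monom 1 d * h dvd f'" "monom 1 w * h dvd g'"
          and f': "lead_coeff f' = 1"
          using z s unfolding z' pairs_def by blast
        obtain a where a: "poly h a = 0" using alg_closed_imp_poly_has_root[of h] h(1) by auto
        obtain r where r: "f' = monom 1 d * (h * r)"
          using h(2) unfolding dvd_def mult.assoc by blast
        obtain r' where r': "g' = monom 1 w * (h * r')"
          using h(3) unfolding dvd_def mult.assoc by blast
        have "lead_coeff (h * r) = 1" using f' unfolding r lead_coeff_monom_1_mult .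
        then have "det (mult_matrix (h * r) (h * r')) = 0"
          using a by (subst det_mult_matrix_eq_0_iff) auto
        then show "case z of (f', g') \<Rightarrow> ?\<phi> (graph_ideal f' g') = 0"
          using of_f' of_g' z unfolding z' by (simp add: r r' poly_shift_monom_mult)
      qed
    next
      case t: True
      \<comment> \<open>On \<open>pairs\<close> the polynomial \<open>f / y^d\<close> is monic of
        degree \<open>s\<close> and \<open>g / y^w\<close> is a constant multiple of it. The
        constant is the coefficient of \<open>g / y^w\<close> at \<open>s\<close>, so
        proportionality becomes a polynomial equation in each degree \<open>i\<close>.\<close>
      define c where "c = coeff G s"
      define \<phi> where "\<phi> i I = coeff (poly_shift w (g_of n I)) i -
        coeff (poly_shift w (g_of n I)) s * coeff (poly_shift d (f_of n I)) i"
        for i and I :: "'a poly poly set"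
      have reg: "\<phi> i \<in> ?R" for i
        unfolding \<phi>_def by (intro regular.pointwise regular.coeff_family regular.poly_family_shift
            poly_family_f_of poly_family_g_of)
      have "G \<noteq> smult c F"
      proof
        assume "G = smult c F"
        then have "F dvd G" by (simp add: dvd_smult)
        then show False using notdvd[of F] degF by simp
      qed
      then obtain i where "coeff G i \<noteq> coeff (smult c F) i" by (auto simp: poly_eq_iff)
      then have "\<phi> i (graph_ideal f g) \<noteq> 0"
        unfolding \<phi>_def of_f of_g F_def[symmetric] G_def[symmetric] by (simp add: c_def)
      moreover have "\<phi> i (graph_ideal f' g') = 0" if z: "(f', g') \<in> pairs n s d w" for f' g' :: "'a poly"
      proof -
        obtain h e q where h: "lead_coeff h = 1" "degree h = s" "lead_coeff e = 1" "degree e = t"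
          "f' = monom 1 d * (h * e)" "g' = monom 1 w * (h * q)" "\<And>i. t + d - w \<le> i \<Longrightarrow> coeff q i = 0"
          using pairs_decomp[OF z n w(1,3)] by metis
        have "e = 1" using h(3,4) t by (metis degree_eq_zeroE lead_coeff_pCons(2) one_pCons pCons_eq_0_iff)
        \<comment> \<open>From \<open>t = 0\<close> and \<open>d \<le> Suc w\<close>, at most the
          constant coefficient of \<open>q\<close> can be nonzero.\<close>
        have "degree q = 0" using h(7) t w(2) by (intro le_zero_eq[THEN iffD1] degree_le) auto
        then obtain b where "q = [:b:]" by (rule degree_eq_zeroE)
        then have "poly_shift w g' = smult b h" "poly_shift d f' = h"
          unfolding h(5,6) poly_shift_monom_mult using \<open>e = 1\<close> by auto
        then show ?thesis using h(1,2) unfolding \<phi>_def of_f'[OF z] of_g'[OF z] by simp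
      qed
      ultimately show ?thesis using reg by blast
    qed
  qed
qed

subsection \<open>The subvarieties inside the equations\<close>

interpretation poly_vs: vector_space "smult :: 'a::field \<Rightarrow> 'a poly \<Rightarrow> 'a poly"
  by unfold_locales (auto simp: smult_add_right smult_add_left)

text \<open>The residues of the basis elements stay distinct and independent in the space of
  polynomials of degree below that of \<open>h\<close>. This links the cardinality in
  \<open>hilb\<close> to the degree of a generator.\<close>

lemma card_le_of_basis_mod:
  fixes h :: "'a::field poly"
  assumes h: "h \<noteq> 0" and B: "basis_mod (graph_ideal h g) B"
  shows "card B \<le> degree h"
proof -
  let ?r = "\<lambda>p. subst g p mod h"
  have fin: "finite B" and ex1: "\<And>p. \<exists>!c. rep_mod (graph_ideal h g) B p c"
    using B by (auto simp: basis_mod_def)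
  have zero: "c u = 0" if "(\<Sum>b\<in>B. smult (c b) (?r b)) = 0" "u \<in> B" for c u
  proof -
    have "subst g (\<Sum>b\<in>B. smult [:c b:] b) mod h = (\<Sum>b\<in>B. smult (c b) (subst g b)) mod h"
      by (simp add: subst_sum subst_smult)
    also have "\<dots> = 0" using that(1) by (simp add: sum_smult_mod)
    finally have "h dvd subst g (\<Sum>b\<in>B. smult [:c b:] b)" by (simp add: dvd_eq_mod_eq_0)
    then have "h dvd subst g (0 - (\<Sum>b\<in>B. smult [:c b:] b))" unfolding subst_diff by simp
    then have "rep_mod (graph_ideal h g) B 0 (restrict c B)"
      unfolding rep_mod_def graph_ideal_def by simp
    moreover have "rep_mod (graph_ideal h g) B 0 (restrict (\<lambda>_. 0) B)"
      unfolding rep_mod_def graph_ideal_def by simp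
    ultimately have "restrict c B = restrict (\<lambda>_. 0) B" using ex1 by blast
    then show ?thesis using that(2) by (metis restrict_apply')
  qed
  have inj: "inj_on ?r B"
  proof (rule inj_onI, rule ccontr)
    fix u v assume uv: "u \<in> B" "v \<in> B" "?r u = ?r v" "u \<noteq> v"
    let ?c = "\<lambda>b. if b = u then 1 else if b = v then - 1 else 0 :: 'a"
    have "(\<Sum>b\<in>B. smult (?c b) (?r b)) = (\<Sum>b\<in>{u, v}. smult (?c b) (?r b))"
      using fin uv by (intro sum.mono_neutral_right) auto
    also have "\<dots> = 0" using uv by simp
    finally show False using zero[of ?c u] uv(1) by simp
  qed
  have "poly_vs.independent (?r ` B)"
    unfolding poly_vs.independent_explicit_module
  proof (intro allI impI)
    fix S c v assume S: "finite S" "S \<subseteq> ?r ` B" "(\<Sum>v\<in>S. smult (c v) v) = 0" "v \<in> S"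
    obtain u where u: "u \<in> B" "v = ?r u" using S by blast
    let ?c = "\<lambda>b. if ?r b \<in> S then c (?r b) else 0"
    have "(\<Sum>b\<in>B. smult (?c b) (?r b)) = (\<Sum>w\<in>?r ` B. smult (if w \<in> S then c w else 0) w)"
      by (simp add: sum.reindex[OF inj])
    also have "\<dots> = (\<Sum>w\<in>S. smult (c w) w)"
      using fin S(1,2) by (intro sum.mono_neutral_cong_right) auto
    finally show "c v = 0" using zero[of ?c u] S(3,4) u by simp
  qed
  moreover have "?r ` B \<subseteq> poly_vs.span ((\<lambda>j. monom 1 j) ` {..<degree h})"
  proof clarify
    fix b
    have "?r b = (\<Sum>j<degree h. monom (coeff (?r b) j) j)"
      using coeff_mod_ge[OF h, of _ "subst g b"] by (intro poly_eqI) (auto simp: coeff_sum not_less)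
    then have "?r b = (\<Sum>j<degree h. smult (coeff (?r b) j) (monom 1 j))"
      by (simp add: smult_monom)
    also have "\<dots> \<in> poly_vs.span ((\<lambda>j. monom 1 j) ` {..<degree h})"
      by (intro poly_vs.span_sum poly_vs.span_scale poly_vs.span_base) auto
    finally show "?r b \<in> poly_vs.span ((\<lambda>j. monom 1 j) ` {..<degree h})" .
  qed
  ultimately have "card (?r ` B) \<le> card ((\<lambda>j. monom 1 j :: 'a poly) ` {..<degree h})"
    using poly_vs.independent_span_bound[of "(\<lambda>j. monom 1 j) ` {..<degree h}"] by blast
  also have "\<dots> \<le> degree h" using card_image_le[of "{..<degree h}"] by fastforce
  finally show ?thesis unfolding card_image[OF inj] .
qed

text \<open>An ideal containing \<open>x\<close> is determined by its trace on \<open>k[y]\<close>;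
  a nonzero element of least degree generates the trace.\<close>

lemma ideal_line_generator:
  fixes I :: "'a::field poly poly set"
  assumes I: "ideal I kxy" "varx \<in> I" and f: "in_y f \<in> I" "f \<noteq> 0"
  obtains h where "h \<noteq> 0" "I = graph_ideal h 0"
proof -
  have I0: "0 \<in> I" and I_add: "\<And>a b. a \<in> I \<Longrightarrow> b \<in> I \<Longrightarrow> a + b \<in> I"
    and I_mult: "\<And>c a. a \<in> I \<Longrightarrow> c * a \<in> I"
    using I(1) unfolding ideal_kxy_iff by auto
  obtain h where h: "in_y h \<in> I \<and> h \<noteq> 0" and hmin: "\<And>h'. in_y h' \<in> I \<and> h' \<noteq> 0 \<Longrightarrow> degree h \<le> degree h'"
    using ex_has_least_nat[of "\<lambda>h. in_y h \<in> I \<and> h \<noteq> 0" f degree] f by blast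
  have "I \<subseteq> graph_ideal h 0"
  proof
    fix p assume p: "p \<in> I"
    obtain s where s: "p = in_y (subst 0 p) + (varx - in_y 0) * s" using subst_decomp by blast
    have "in_y (subst 0 p mod h) = p + ((- s) * varx + (- in_y (subst 0 p div h)) * in_y h)"
    proof -
      have "in_y (subst 0 p) = in_y (subst 0 p div h) * in_y h + in_y (subst 0 p mod h)"
        by (metis in_y_add in_y_mult div_mult_mod_eq)
      then show ?thesis using s by (simp add: algebra_simps)
    qed
    also have "\<dots> \<in> I" using p I(2) h by (intro I_add I_mult) auto
    finally have "in_y (subst 0 p mod h) \<in> I" .
    then have "subst 0 p mod h = 0"
      using hmin[of "subst 0 p mod h"] degree_mod_less[of h "subst 0 p"] h by force
    then show "p \<in> graph_ideal h 0" by (simp add: graph_ideal_def dvd_eq_mod_eq_0)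
  qed
  moreover have "graph_ideal h 0 \<subseteq> I" using I h by (intro graph_ideal_subset) auto
  ultimately show ?thesis using that h by blast
qed

lemma eval2_in_y: "eval2 (in_y q) (a, b) = poly q b"
  using eval2_subst[of "in_y q" "[:a:]" b] by simp

lemma in_y_mem_graph_ideal [simp]: "in_y q \<in> graph_ideal f g \<longleftrightarrow> f dvd q"
  by (simp add: graph_ideal_def)

text \<open>The difference \<open>p(g(y), y) - p(g'(y), y)\<close> is divisible by
  \<open>g - g'\<close>, hence by \<open>f\<close>.\<close>

lemma graph_ideal_cong:
  fixes g g' :: "'a::field poly"
  assumes "f dvd g - g'"
  shows "graph_ideal f g = graph_ideal f g'"
proof -
  have "(g - g') dvd subst g p - subst g' p" for p
  proof (induction p)
    case (pCons a p)
    have "(g - g') dvd pcompose a g - pcompose a g'"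
    proof (induction a)
      case (pCons c a)
      have "pcompose (pCons c a) g - pcompose (pCons c a) g' =
          (g - g') * pcompose a g + g' * (pcompose a g - pcompose a g')"
        by (simp add: pcompose_pCons algebra_simps)
      then show ?case using pCons by (simp only: dvd_add dvd_mult dvd_triv_left)
    qed simp
    moreover have "subst g (pCons a p) - subst g' (pCons a p) =
        (pcompose a g - pcompose a g') + [:0, 1:] * (subst g p - subst g' p)"
      unfolding subst_pCons by (simp only: algebra_simps)
    ultimately show ?case using pCons by (simp only: dvd_add dvd_mult)
  qed simp
  then have "f dvd subst g p - subst g' p" for p using assms dvd_trans by blast
  then have "f dvd subst g p \<longleftrightarrow> f dvd subst g' p" for p
    using dvd_add_right_iff[of f "subst g p - subst g' p" "subst g' p"] by simp
  then show ?thesis by (simp add: graph_ideal_def)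
qed

lemma genideal_kxy_subset:
  "ideal J kxy \<Longrightarrow> A \<subseteq> J \<Longrightarrow> genideal kxy A \<subseteq> J"
  unfolding genideal_def by blast

lemma graph_relation_mem: "varx - in_y g \<in> graph_ideal f g"
  by (simp add: graph_ideal_def subst_diff)

lemma factor_W_ideal:
  assumes "I \<in> factor_W u i"
  shows "ideal I kxy"
proof -
  have "ideal UNIV (kxy :: 'a poly poly ring)" by (simp add: ideal_kxy_iff)
  moreover have "ideal (genideal kxy A) kxy" for A :: "'a poly poly set"
    unfolding kxy_eq by (rule ring.genideal_ideal[OF cring.axioms(1)[OF UNIV.cring]]) simp
  ultimately show ?thesis
    using assms by (cases i) (auto split: if_splits simp: hilb_sub_def hilb_def)
qed

text \<open>A member of the family that contains some \<open>x - g\<close> is compared with a graph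
  ideal over a power of \<open>y\<close>, or, for \<open>+1\<close> with \<open>u = 0\<close>, with
  the line \<open>y = 0\<close>; the exponents are read off there.\<close>

lemma factor_W_divisibility:
  fixes f g :: "'a::field poly"
  assumes I: "I \<in> factor_W u i" and i: "i = Plus1 \<Longrightarrow> u \<noteq> 1" and dw: "y_exponents u i = (d, w)"
    and f: "in_y f \<in> I" and g: "varx - in_y g \<in> I"
  shows "monom 1 d dvd f \<and> monom 1 w dvd g"
proof -
  have one: "monom 1 0 = (1 :: 'a poly)" by simp
  \<comment> \<open>Both \<open>x - g\<close> and \<open>x - r\<close> lie in the larger ideal, so
    \<open>y^k\<close> divides \<open>r - g\<close>, and \<open>y^w\<close> passes from
    \<open>r\<close> to \<open>g\<close>.\<close>
  have case0: "monom 1 k dvd f \<and> monom 1 w dvd g"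
    if sub: "I \<subseteq> graph_ideal (monom 1 k) r" and r: "monom 1 w dvd r" "w \<le> k" for k r
  proof -
    have "monom 1 k dvd f" using f sub by auto
    moreover have "monom 1 k dvd r - g"
      using g sub by (auto simp: graph_ideal_def subst_diff)
    moreover have "monom 1 w dvd (monom 1 k :: 'a poly)"
      using r(2) by (auto simp: monom_1_dvd_iff')
    ultimately have "monom 1 k dvd f" "monom 1 w dvd r - g" by (auto intro: dvd_trans)
    then show ?thesis using dvd_diff[OF r(1), of "r - g"] by simp
  qed
  show ?thesis
  proof (cases i)
    case Plus0
    then have w: "d = u" "w = u" using dw by auto
    have vy: "vary ^ u \<in> graph_ideal (monom 1 u) (0 :: 'a poly)"
      by (simp add: graph_ideal_def subst_power monom_altdef)
    have vx: "varx \<in> graph_ideal (monom 1 u) (0 :: 'a poly)" by (simp add: graph_ideal_def)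
    show ?thesis
    proof (cases "u = 0")
      case True
      then show ?thesis using w by (simp add: one)
    next
      case False
      then have "I = genideal kxy {varx, vary ^ u}" using I Plus0 by simp
      then have "I \<subseteq> graph_ideal (monom 1 u) 0"
        using genideal_kxy_subset[OF ideal_graph_ideal[of "monom 1 u" "0 :: 'a poly"], of "{varx, vary ^ u}"]
          vx vy by simp
      then show ?thesis using case0[of u 0] w by simp
    qed
  next
    case Plus1
    show ?thesis
    proof (cases "u = 0")
      case True
      then have w: "d = 1" "w = 0" using dw Plus1 by auto
      have I': "I \<in> hilb 1" "vary \<in> I" using I True Plus1 by (auto simp: hilb_sub_def)
      have id: "ideal I kxy" and "\<exists>B. card B = 1 \<and> basis_mod I B" using I'(1) by (auto simp: hilb_def)
      then obtain b where b: "basis_mod I {b}" by (metis card_1_singletonE)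
      have "I \<noteq> UNIV"
      proof
        assume "I = UNIV"
        then have "rep_mod I {b} 0 (restrict (\<lambda>_. 0) {b})" "rep_mod I {b} 0 (restrict (\<lambda>_. 1) {b})"
          by (auto simp: rep_mod_def)
        then have "restrict (\<lambda>_. 0 :: 'a) {b} = restrict (\<lambda>_. 1) {b}"
          using b unfolding basis_mod_def by blast
        then have "restrict (\<lambda>_. 0 :: 'a) {b} b = restrict (\<lambda>_. 1) {b} b" by simp
        then show False by simp
      qed
      have I_add: "\<And>a b. a \<in> I \<Longrightarrow> b \<in> I \<Longrightarrow> a + b \<in> I" and I_mult: "\<And>c a. a \<in> I \<Longrightarrow> c * a \<in> I"
        using id unfolding ideal_kxy_iff by auto
      \<comment> \<open>As \<open>y\<close> lies in \<open>I\<close>, so does the constant term of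
        \<open>f\<close>; if nonzero it would be a unit.\<close>
      have "coeff f 0 = 0"
      proof (rule ccontr)
        assume c: "coeff f 0 \<noteq> 0"
        obtain c r where f': "f = pCons c r" by (cases f)
        then have c0: "c \<noteq> 0" using c by simp
        have "[:[:c:]:] = in_y f + (- in_y r) * vary" by (simp add: f' in_y_pCons)
        also have "\<dots> \<in> I" using f I'(2) by (intro I_add I_mult)
        finally have "[:[:inverse c:]:] * [:[:c:]:] \<in> I" by (rule I_mult)
        then have "1 \<in> I" using c0 by (simp add: one_pCons)
        then have "p * 1 \<in> I" for p by (rule I_mult)
        then show False using \<open>I \<noteq> UNIV\<close> by auto
      qed
      then show ?thesis using w by (simp add: monom_1_dvd_iff' one)
    next
      case False
      then have u: "u \<ge> 2" using i Plus1 by auto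
      then have w: "d = u" "w = u - 1" using dw Plus1 by auto
      obtain a b where ab: "(a, b) \<noteq> (0 :: 'a, 0 :: 'a)"
        and Ieq: "I = genideal kxy {vary ^ u, varx * vary, varx ^ 2, smult [:a:] (vary ^ (u - 1)) + smult [:b:] varx}"
        using I Plus1 False by auto
      show ?thesis
      proof (cases "b = 0")
        case True
        \<comment> \<open>For \<open>b = 0\<close> the ideal is \<open>(y^(u-1), x y, x^2)\<close>,
          which contains no \<open>x - g\<close>: in its members the part free of \<open>y\<close>
          is divisible by \<open>x^2\<close>, whereas \<open>x - g\<close> has a term linear in
          \<open>x\<close>.\<close>
        let ?N = "{p :: 'a poly poly. monom 1 2 dvd coeff p 0}"
        have "ideal ?N kxy"
          unfolding ideal_kxy_iff by (auto simp: coeff_mult)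
        moreover have "coeff (vary ^ k :: 'a poly poly) 0 = 0" if "k > 0" for k
          using that by (cases k) (auto simp: vary_def coeff_mult)
        then have "{vary ^ u, varx * vary, varx ^ 2, smult [:a:] (vary ^ (u - 1)) + smult [:b:] varx} \<subseteq> ?N"
          using u True by (auto simp: coeff_mult varx_def vary_def power2_eq_square monom_altdef)
        ultimately have "I \<subseteq> ?N" unfolding Ieq by (rule genideal_kxy_subset)
        then have "monom 1 2 dvd coeff (varx - in_y g) 0" using g by blast
        then have "coeff (coeff (varx - in_y g) 0) 1 = 0" by (simp add: monom_1_dvd_iff')
        moreover have "coeff (in_y g) 0 = [:coeff g 0:]" by (simp add: in_y_def coeff_map_poly)
        ultimately show ?thesis by (simp add: varx_def)
      next
        case b: False
        \<comment> \<open>For \<open>b \<noteq> 0\<close> the last generator can be solved for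
          \<open>x\<close>, giving \<open>x = c y^(u-1)\<close>.\<close>
        define c where "c = - (a / b)"
        let ?r = "monom c (u - 1)"
        let ?J = "graph_ideal (monom 1 u) ?r"
        have le: "monom 1 u dvd (monom x k :: 'a poly)" if "u \<le> k" for k x
          using that by (auto simp: monom_1_dvd_iff')
        have yk: "subst ?r (vary ^ k) = monom 1 k" for k by (simp add: subst_power monom_altdef)
        have "vary ^ u \<in> ?J" unfolding graph_ideal_def mem_Collect_eq yk by simp
        moreover have "varx * vary \<in> ?J"
        proof -
          have "?r * [:0, 1:] = monom c u" using u by (cases u) (auto simp: monom_Suc)
          then show ?thesis using le by (simp add: graph_ideal_def subst_mult)
        qed
        moreover have "varx ^ 2 \<in> ?J"
          using u le by (auto simp: graph_ideal_def subst_mult power2_eq_square mult_monom)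
        moreover have "smult [:a:] (vary ^ (u - 1)) + smult [:b:] varx \<in> ?J"
          unfolding graph_ideal_def mem_Collect_eq subst_add subst_scalar yk
          using b by (simp add: smult_monom c_def add_monom)
        ultimately have "I \<subseteq> ?J" unfolding Ieq
          by (intro genideal_kxy_subset ideal_graph_ideal) simp
        moreover have "monom 1 w dvd ?r" using w by (auto simp: monom_1_dvd_iff')
        ultimately show ?thesis using case0[of u ?r] w by simp
      qed
    qed
  qed
qed

text \<open>The first factor is \<open>(x, h)\<close>, and avoiding the origin means
  \<open>h(0) \<noteq> 0\<close>. Thus \<open>h\<close> has no root in common with a power of
  \<open>y\<close>, and the two divisibilities can be multiplied.\<close>

lemma image_subset_pairs:
  fixes f g :: "'a::alg_closed_field poly"
  assumes f: "lead_coeff f = 1" "degree f = n" and g: "degree g < n"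
    and I1: "I1 \<in> hilb_sub s {varx} {(0, 0)}" and I3: "I3 \<in> factor_W u i"
    and i: "i = Plus1 \<Longrightarrow> u \<noteq> 1" and dw: "y_exponents u i = (d, w)"
    and eq: "graph_ideal f g = I1 \<inter> I2 \<inter> I3"
  shows "(f, g) \<in> pairs n s d w"
proof -
  have f0: "f \<noteq> 0" using f by auto
  have mem: "in_y f \<in> I1" "in_y f \<in> I3" "varx - in_y g \<in> I1" "varx - in_y g \<in> I3"
    using eq graph_relation_mem[of g f] in_y_mem_graph_ideal[of f f g] by auto
  have id1: "ideal I1 kxy" and x1: "varx \<in> I1" and z1: "zero_locus I1 \<inter> {(0, 0)} = {}"
    using I1 by (auto simp: hilb_sub_def hilb_def)
  obtain B where B: "card B = s" "basis_mod I1 B" using I1 by (auto simp: hilb_sub_def hilb_def)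
  obtain h where h: "h \<noteq> 0" "I1 = graph_ideal h 0"
    using ideal_line_generator[OF id1 x1 mem(1) f0] by metis
  have hf: "h dvd f" and hg: "h dvd g"
    using mem(1,3) unfolding h(2) by (auto simp: graph_ideal_def subst_diff)
  have deg: "s \<le> degree h" using card_le_of_basis_mod[of h 0 B] h B by simp
  have h0: "poly h 0 \<noteq> 0"
  proof
    assume h0: "poly h 0 = 0"
    have "eval2 p (0, 0) = 0" if "p \<in> I1" for p
    proof -
      have "h dvd subst 0 p" using that unfolding h(2) by (simp add: graph_ideal_def)
      then have "poly (subst 0 p) 0 = 0" using h0 by (auto elim!: dvdE)
      then show ?thesis using eval2_subst[of p 0 0] by simp
    qed
    then show False using z1 by (auto simp: zero_locus_def)
  qed
  have nr: "poly (monom 1 k) a \<noteq> 0" if "poly h a = 0" for a and k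
    using that h0 by (auto simp: poly_monom)
  have "monom 1 d dvd f" "monom 1 w dvd g" using factor_W_divisibility[OF I3 i dw mem(2,4)] by auto
  then have "monom 1 d * h dvd f" "monom 1 w * h dvd g"
    using mult_dvd_of_no_common_root[OF h(1)] hf hg nr by blast+
  then show ?thesis using f g deg unfolding pairs_def by blast
qed

lemma graph_ideal_mem_hilb: "lead_coeff f = 1 \<Longrightarrow> degree f = n \<Longrightarrow> graph_ideal f g \<in> hilb n"
  using graph_ideal_mem_chart[of f n g] card_basis_U
  unfolding hilb_def chart_U_def chart_def by blast

text \<open>Modulo \<open>y^d\<close> at most one term of \<open>g\<close> survives: none for
  \<open>+0\<close>, the value \<open>g(0)\<close> for \<open>+1\<close> with \<open>u = 0\<close>,
  and a multiple of \<open>y^(u-1)\<close> for \<open>u >= 2\<close>.\<close>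

lemma factor_W_mem:
  fixes g :: "'a::field poly"
  assumes i: "i = Plus1 \<Longrightarrow> u \<noteq> 1" and dw: "y_exponents u i = (d, w)" and g: "monom 1 w dvd g"
    and g0: "i = Plus1 \<Longrightarrow> u = 0 \<Longrightarrow> poly g 0 \<noteq> 0"
  shows "graph_ideal (monom 1 d) g \<in> factor_W u i"
proof (cases i)
  case Plus0
  then have w: "d = u" "w = u" using dw by auto
  show ?thesis
  proof (cases "u = 0")
    case True
    then show ?thesis using w Plus0 by (auto simp: graph_ideal_def)
  next
    case False
    let ?G = "{varx, vary ^ u :: 'a poly poly}"
    have id: "ideal (genideal kxy ?G) kxy"
      by (rule factor_W_ideal[where i = Plus0 and u = u]) (simp add: False)
    have "?G \<subseteq> genideal kxy ?G" unfolding genideal_def by blast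
    moreover have "in_y (monom 1 u) = (vary ^ u :: 'a poly poly)" by (simp add: in_y_monom flip: one_pCons)
    ultimately have "graph_ideal (monom 1 u) 0 \<subseteq> genideal kxy ?G"
      using id by (intro graph_ideal_subset) auto
    moreover have "genideal kxy ?G \<subseteq> graph_ideal (monom 1 u) 0"
      by (intro genideal_kxy_subset ideal_graph_ideal)
        (auto simp: graph_ideal_def subst_power monom_altdef)
    moreover have "graph_ideal (monom 1 u) g = graph_ideal (monom 1 u) 0"
      using g w by (intro graph_ideal_cong) simp
    ultimately show ?thesis using w Plus0 False by auto
  qed
next
  case Plus1
  show ?thesis
  proof (cases "u = 0")
    case True
    then have w: "d = 1" using dw Plus1 by auto
    have y: "monom 1 1 = ([:0, 1:] :: 'a poly)" by (simp add: monom_altdef)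
    have "graph_ideal [:0, 1:] g \<in> hilb 1" by (rule graph_ideal_mem_hilb) auto
    then have "graph_ideal (monom 1 1) g \<in> hilb 1" unfolding y .
    moreover have "vary \<in> graph_ideal (monom 1 1) g" unfolding y by (simp add: graph_ideal_def)
    moreover have "(0, 0) \<notin> zero_locus (graph_ideal (monom 1 1) g)"
    proof
      assume "(0, 0) \<in> zero_locus (graph_ideal (monom 1 1) g)"
      then have "eval2 (varx - in_y g) (0, 0) = 0"
        using graph_relation_mem by (auto simp: zero_locus_def)
      moreover have "eval2 (varx - in_y g) (0, 0) = - poly g 0"
        using eval2_subst[of "varx - in_y g" 0 0] by (simp add: subst_diff)
      ultimately show False using g0 Plus1 True by simp
    qed
    ultimately show ?thesis using Plus1 True w by (simp add: hilb_sub_def)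
  next
    case False
    then have u: "u \<ge> 2" using i Plus1 by auto
    then have w: "d = u" "w = u - 1" using dw Plus1 by auto
    obtain q where q: "g = monom 1 (u - 1) * q" using g w by (auto elim: dvdE)
    \<comment> \<open>This is the coefficient of \<open>g\<close> at \<open>u - 1\<close>; the ideal
      is the point \<open>[- c, 1]\<close> of the projective line.\<close>
    define c where "c = coeff q 0"
    let ?r = "monom c (u - 1)"
    let ?G = "{vary ^ u, varx * vary, varx ^ 2, smult [:- c:] (vary ^ (u - 1)) + smult [:1:] varx}"
    have "monom 1 u dvd g - ?r"
      unfolding monom_1_dvd_iff'
    proof (intro allI impI)
      fix k assume "k < u"
      then show "coeff (g - ?r) k = 0"
        by (cases "k = u - 1") (auto simp: q coeff_monom_mult c_def)
    qed
    then have eq: "graph_ideal (monom 1 u) g = graph_ideal (monom 1 u) ?r" by (rule graph_ideal_cong)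
    have W: "genideal kxy ?G \<in> factor_W u Plus1" using False by auto (metis one_neq_zero)
    have id: "ideal (genideal kxy ?G) kxy" by (rule factor_W_ideal[OF W])
    have sub: "?G \<subseteq> genideal kxy ?G" unfolding genideal_def by blast
    have yr: "in_y (monom a k) = smult [:a:] (vary ^ k)" for a :: 'a and k by (rule in_y_monom)
    have yu: "in_y (monom 1 u) = (vary ^ u :: 'a poly poly)" by (simp add: in_y_monom flip: one_pCons)
    have rel: "varx - in_y ?r = smult [:- c:] (vary ^ (u - 1)) + smult [:1:] varx"
      by (simp add: yr flip: one_pCons) (metis minus_pCons minus_zero smult_minus_left)
    have 1: "graph_ideal (monom 1 u) ?r \<subseteq> genideal kxy ?G"
      using sub by (intro graph_ideal_subset[OF id]) (auto simp only: yu rel)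
    have le: "monom 1 u dvd (monom x k :: 'a poly)" if "u \<le> k" for k x
      using that by (auto simp: monom_1_dvd_iff')
    have "?G \<subseteq> graph_ideal (monom 1 u) ?r"
    proof -
      have "vary ^ u \<in> graph_ideal (monom 1 u) ?r"
        by (simp add: graph_ideal_def subst_power monom_altdef)
      moreover have "varx * vary \<in> graph_ideal (monom 1 u) ?r"
      proof -
        have "?r * [:0, 1:] = monom c u" using u by (cases u) (auto simp: monom_Suc)
        then show ?thesis using le by (simp add: graph_ideal_def subst_mult)
      qed
      moreover have "varx ^ 2 \<in> graph_ideal (monom 1 u) ?r"
        using u le by (auto simp: graph_ideal_def subst_mult power2_eq_square mult_monom)
      moreover have "smult [:- c:] (vary ^ (u - 1)) + smult [:1:] varx \<in> graph_ideal (monom 1 u) ?r"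
        unfolding rel[symmetric] by (rule graph_relation_mem)
      ultimately show ?thesis by simp
    qed
    then have "genideal kxy ?G \<subseteq> graph_ideal (monom 1 u) ?r"
      by (intro genideal_kxy_subset ideal_graph_ideal)
    with 1 eq have "graph_ideal (monom 1 u) g = genideal kxy ?G" by blast
    then show ?thesis using W Plus1 w(1) by simp
  qed
qed

text \<open>The factors \<open>h\<close>, \<open>e\<close> and \<open>y^d\<close> have pairwise no
  common roots, so divisibility by the product splits and the graph ideal is an intersection. On
  \<open>h\<close> the graph lies in \<open>x = 0\<close> because \<open>h\<close> divides
  \<open>g\<close>; over the roots of \<open>e\<close> it avoids both axes.\<close>

lemma generic_mem_image:
  fixes h e g :: "'a::alg_closed_field poly"
  assumes h: "lead_coeff h = 1" "degree h = s" "h dvd g" "poly h 0 \<noteq> 0"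
    and e: "lead_coeff e = 1" "degree e = t" "poly e 0 \<noteq> 0"
    and eg: "\<And>a. poly e a = 0 \<Longrightarrow> poly g a \<noteq> 0"
    and i: "i = Plus1 \<Longrightarrow> u \<noteq> 1" and dw: "y_exponents u i = (d, w)" and g: "monom 1 w dvd g"
    and g0: "i = Plus1 \<Longrightarrow> u = 0 \<Longrightarrow> poly g 0 \<noteq> 0"
  shows "\<exists>I1 I2 I3. graph_ideal (monom 1 d * (h * e)) g = I1 \<inter> I2 \<inter> I3 \<and>
    I1 \<in> hilb_sub s {varx} {(0, 0)} \<and> I2 \<in> hilb_sub t {} {(a, b). a * b = 0} \<and> I3 \<in> factor_W u i"
proof (intro exI conjI)
  let ?f = "monom 1 d * (h * e)"
  have h0: "h \<noteq> 0" and e0: "e \<noteq> 0" using h(1) e(1) by auto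
  have he: "poly h a \<noteq> 0" if "poly e a = 0" for a
    using eg[OF that] h(3) by (auto elim!: dvdE)
  have ed: "poly (monom 1 d) a \<noteq> 0" if "poly (h * e) a = 0" for a
    using that h(4) e(3) by (auto simp: poly_monom)
  have iff: "?f dvd r \<longleftrightarrow> h dvd r \<and> e dvd r \<and> monom 1 d dvd r" for r
  proof
    assume f: "?f dvd r"
    have "h dvd ?f" "e dvd ?f" "monom 1 d dvd ?f" by simp_all
    then show "h dvd r \<and> e dvd r \<and> monom 1 d dvd r" using f dvd_trans by blast
  next
    assume r: "h dvd r \<and> e dvd r \<and> monom 1 d dvd r"
    then have "h * e dvd r" using he by (intro mult_dvd_of_no_common_root[OF e0]) auto
    then show "?f dvd r" using r ed h0 e0 mult_dvd_of_no_common_root[of "h * e" "monom 1 d" r] by auto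
  qed
  show "graph_ideal ?f g = graph_ideal h g \<inter> graph_ideal e g \<inter> graph_ideal (monom 1 d) g"
    unfolding graph_ideal_def using iff by blast
  show "graph_ideal (monom 1 d) g \<in> factor_W u i" by (rule factor_W_mem[OF i dw g g0])
  show "graph_ideal h g \<in> hilb_sub s {varx} {(0, 0)}"
  proof -
    have "eval2 (in_y h) (0, 0) \<noteq> 0" using h(4) by (simp add: eval2_in_y)
    moreover have "in_y h \<in> graph_ideal h g" by simp
    ultimately have "(0, 0) \<notin> zero_locus (graph_ideal h g)" unfolding zero_locus_def by blast
    moreover have "varx \<in> graph_ideal h g" using h(3) by (simp add: graph_ideal_def)
    ultimately show ?thesis using graph_ideal_mem_hilb[OF h(1,2)] by (simp add: hilb_sub_def)
  qed
  show "graph_ideal e g \<in> hilb_sub t {} {(a, b). a * b = 0}"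
  proof -
    have "a * b \<noteq> 0" if z: "(a, b) \<in> zero_locus (graph_ideal e g)" for a b
    proof -
      have "in_y e \<in> graph_ideal e g" by simp
      then have "eval2 (in_y e) (a, b) = 0" using z by (auto simp: zero_locus_def)
      then have eb: "poly e b = 0" by (simp add: eval2_in_y)
      have "eval2 (varx - in_y g) (a, b) = 0"
        using z graph_relation_mem[of g e] by (auto simp: zero_locus_def)
      moreover have "eval2 (varx - in_y g) (a, b) = a - poly g b"
        using eval2_subst[of "varx - in_y g" "[:a:]" b] by (simp add: subst_diff)
      ultimately have "a = poly g b" by simp
      then show ?thesis using eb eg[OF eb] e(3) by auto
    qed
    then show ?thesis using graph_ideal_mem_hilb[OF e(1,2)] by (auto simp: hilb_sub_def)
  qed
qed

section \<open>Segments of polynomials and the description of \<open>Y\<close> by pairs\<close>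

lemma linear_power_monic:
  fixes a :: "'a::field"
  shows "lead_coeff ([:a, 1:] ^ n) = 1" "degree ([:a, 1:] ^ n) = n"
proof -
  show "lead_coeff ([:a, 1:] ^ n) = 1" unfolding lead_coeff_power by simp
  show "degree ([:a, 1:] ^ n) = n" by (rule degree_linear_power)
qed

lemma monic_segment:
  fixes p q :: "'a::field poly"
  assumes "lead_coeff p = 1" "degree p = n" "lead_coeff q = 1" "degree q = n"
  shows "lead_coeff (p + smult t (q - p)) = 1" "degree (p + smult t (q - p)) = n"
proof -
  have c: "coeff (p + smult t (q - p)) i = 0" if "i > n" for i
    using that assms by (simp add: coeff_eq_0)
  have l: "coeff (p + smult t (q - p)) n = 1" using assms by auto
  show d: "degree (p + smult t (q - p)) = n"
    using c l by (intro antisym degree_le le_degree) auto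
  show "lead_coeff (p + smult t (q - p)) = 1" unfolding d by (rule l)
qed

lemma poly_family_segment: "poly_family poly_functions (\<lambda>t. p + smult t (q - p))"
  for p q :: "'a::field poly"
proof -
  have "poly [:0, 1 :: 'a:] \<in> poly_functions" unfolding poly_functions_def by blast
  moreover have "poly [:0, 1:] = (\<lambda>t :: 'a. t)" by (simp add: fun_eq_iff)
  ultimately have "(\<lambda>t :: 'a. t) \<in> poly_functions" by simp
  then show ?thesis
    by (intro poly_functions.poly_family_add poly_functions.poly_family_const poly_functions.poly_family_smult)
qed

lemma topspace_hilb_zariski: "chart_U n \<subseteq> topspace (hilb_zariski n)"
proof -
  have "{I \<in> chart (basis_U n). (\<lambda>I. 1) I \<noteq> (0 :: 'a)} \<subseteq> topspace (hilb_zariski n)"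
    unfolding hilb_zariski_def topology_generated_by_topspace
    using regular_functions.const[of 1 "basis_U n"] by (intro Union_upper) (auto intro!: exI[of _ "basis_U n"] exI[of _ "\<lambda>I. 1"])
  then show ?thesis by (simp add: chart_U_def)
qed

lemma openin_basic:
  "finite B \<Longrightarrow> card B = n \<Longrightarrow> \<phi> \<in> regular_functions B \<Longrightarrow> openin (hilb_zariski n) {I \<in> chart B. \<phi> I \<noteq> 0}"
  unfolding hilb_zariski_def openin_topology_generated_by_iff
  by (intro generate_topology_on.Basis) blast

theorem subvariety_eq:
  assumes n: "n = s + d + t" "1 \<le> n" and st: "s = 0 \<or> s = 1 \<or> t = 0"
    and i: "i = Plus1 \<Longrightarrow> u \<noteq> 1" and dw: "y_exponents u i = (d, w)"
  shows "subvariety n s u t i = (\<lambda>(f, g). graph_ideal f g) ` (pairs n s d w :: ('a::alg_closed_field poly \<times> 'a poly) set)"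
    (is "?Y = ?Z")
proof -
  have w: "w \<le> d" "d \<le> Suc w" using dw by (cases i; auto split: if_splits)+
  define S where "S = {I1 \<inter> I2 \<inter> I3 |I1 I2 I3. I1 \<in> hilb_sub s {varx} {(0, 0)} \<and>
    I2 \<in> hilb_sub t {} {(a, b). a * b = (0 :: 'a)} \<and> I3 \<in> factor_W u i}"
  have Y: "?Y = (hilb_zariski n closure_of S) \<inter> chart_U n" by (simp add: subvariety_def S_def)
  show ?thesis
  proof
    show "?Y \<subseteq> ?Z"
    proof
      fix I assume I: "I \<in> ?Y"
      then have IU: "I \<in> chart_U n" and Icl: "I \<in> hilb_zariski n closure_of S" unfolding Y by auto
      obtain f g where f: "lead_coeff f = 1" "degree f = n" and g: "degree g < n" and Ifg: "I = graph_ideal f g"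
        using chart_U_cases[OF IU n(2)] by metis
      have "(f, g) \<in> pairs n s d w"
      proof (rule ccontr)
        assume "(f, g) \<notin> pairs n s d w"
        then obtain \<phi> where \<phi>: "\<phi> \<in> regular_functions (basis_U n)" "\<phi> (graph_ideal f g) \<noteq> 0"
          and vanish: "\<And>f' g'. (f', g') \<in> pairs n s d w \<Longrightarrow> \<phi> (graph_ideal f' g') = 0"
          using pairs_closed[OF f g _ n(1) w n(2) st] by blast
        let ?O = "{I \<in> chart (basis_U n). \<phi> I \<noteq> 0}"
        have op: "openin (hilb_zariski n) ?O" by (rule openin_basic[OF _ _ \<phi>(1)]) auto
        have IO: "I \<in> ?O" using IU \<phi>(2) Ifg by (simp add: chart_U_def)
        have "\<forall>T. I \<in> T \<and> openin (hilb_zariski n) T \<longrightarrow> (\<exists>y. y \<in> S \<and> y \<in> T)"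
          using Icl unfolding in_closure_of by (rule conjunct2)
        then have "I \<in> ?O \<and> openin (hilb_zariski n) ?O \<longrightarrow> (\<exists>y. y \<in> S \<and> y \<in> ?O)" by (rule spec)
        then have "\<exists>y. y \<in> S \<and> y \<in> ?O" using conjI[OF IO op] by (rule mp)
        then obtain J where J: "J \<in> S" "J \<in> ?O" by (elim exE conjE)
        then have JU: "J \<in> chart_U n" by (simp add: chart_U_def)
        obtain f' g' where f': "lead_coeff f' = 1" "degree f' = n" and g': "degree g' < n"
          and Jfg: "J = graph_ideal f' g'"
          using chart_U_cases[OF JU n(2)] by metis
        obtain I1 I2 I3 where "J = I1 \<inter> I2 \<inter> I3" "I1 \<in> hilb_sub s {varx} {(0, 0)}" "I3 \<in> factor_W u i"
          using J(1) unfolding S_def by blast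
        then have "(f', g') \<in> pairs n s d w"
          using image_subset_pairs[OF f' g' _ _ i dw] Jfg by blast
        then show False using vanish J(2) Jfg by blast
      qed
      then show "I \<in> ?Z" unfolding Ifg by (auto intro: rev_image_eqI)
    qed
  next
    show "?Z \<subseteq> ?Y"
    proof clarify
      fix f g :: "'a poly" assume fg: "(f, g) \<in> pairs n s d w"
      obtain h e q where h: "lead_coeff h = 1" "degree h = s" and e: "lead_coeff e = 1" "degree e = t"
        and f: "f = monom 1 d * (h * e)" and g: "g = monom 1 w * (h * q)"
        and q: "\<And>i. t + d - w \<le> i \<Longrightarrow> coeff q i = 0"
        using pairs_decomp[OF fg n(1) w(1) n(2)] by metis
      \<comment> \<open>The far end of the segment has 1 as the only possible root of
        \<open>h1\<close> and \<open>c\<close> as the only possible root of \<open>e1\<close>, so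
        all generic conditions hold there. The factor \<open>q1\<close> is 0 only if no coefficient
        is allowed; then \<open>t = 0\<close> and \<open>e1\<close> has no roots.\<close>
      obtain c :: 'a where c: "c \<noteq> 0" "c \<noteq> 1"
        using ex_new_if_finite[OF infinite_UNIV_alg_closed, of "{0, 1}"] by auto
      define h1 where "h1 = [:- 1, 1 :: 'a:] ^ s"
      define e1 where "e1 = [:- c, 1:] ^ t"
      define q1 where "q1 = (if t + d - w = 0 then 0 else 1 :: 'a poly)"
      have h1: "lead_coeff h1 = 1" "degree h1 = s"
        unfolding h1_def by (rule linear_power_monic)+
      have e1: "lead_coeff e1 = 1" "degree e1 = t"
        unfolding e1_def by (rule linear_power_monic)+
      define ht where "ht z = h + smult z (h1 - h)" for z
      define et where "et z = e + smult z (e1 - e)" for z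
      define qt where "qt z = q + smult z (q1 - q)" for z
      note hl = monic_segment[OF h h1, folded ht_def] and el = monic_segment[OF e e1, folded et_def]
      have fam: "poly_family poly_functions ht" "poly_family poly_functions et" "poly_family poly_functions qt"
        unfolding ht_def et_def qt_def by (rule poly_family_segment)+
      have qt: "coeff (qt z) j = 0" if "t + d - w \<le> j" for z j
        using that q[of j] by (auto simp: qt_def q1_def)
      define ft where "ft z = monom 1 d * (ht z * et z)" for z
      define gt where "gt z = monom 1 w * (ht z * qt z)" for z
      have pr: "(ft z, gt z) \<in> pairs n s d w" for z
        unfolding ft_def gt_def by (rule pairsI[OF hl el qt n(1) w(1) n(2)])
      have ftm: "lead_coeff (ft z) = 1" "degree (ft z) = n" for z
        using pr[of z] by (auto simp: pairs_def)
      have famf: "poly_family poly_functions ft" unfolding ft_def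
        by (intro poly_functions.poly_family_mult poly_functions.poly_family_const fam)
      have famg: "poly_family poly_functions gt" unfolding gt_def
        by (intro poly_functions.poly_family_mult poly_functions.poly_family_const fam)
      have at0: "ft 0 = f" "gt 0 = g" by (simp_all add: ft_def gt_def ht_def et_def qt_def f g)
      interpret curve ft gt n by unfold_locales (fact famf ftm famg)+
      have at1: "ht 1 = h1" "et 1 = e1" "qt 1 = q1" by (simp_all add: ht_def et_def qt_def)
      \<comment> \<open>The hypotheses of the generic case as nonvanishing polynomials in the
        parameter: \<open>h(0)\<close>, \<open>e(0)\<close>, the resultant of \<open>e\<close> and
        \<open>g\<close>, and \<open>g(0)\<close> where the label asks for it, with 1 as a
        placeholder otherwise.\<close>
      define C1 where "C1 z = poly (ht z) 0" for z
      define C2 where "C2 z = poly (et z) 0" for z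
      define C3 where "C3 z = det (mult_matrix (et z) (gt z))" for z
      define C4 where "C4 z = (if i = Plus1 \<and> u = 0 then poly (gt z) 0 else 1)" for z
      have "C1 \<in> poly_functions" "C2 \<in> poly_functions" "C3 \<in> poly_functions" "C4 \<in> poly_functions"
      proof -
        show "C1 \<in> poly_functions" "C2 \<in> poly_functions" unfolding C1_def C2_def
          by (intro poly_functions.poly_family_eval fam poly_functions.const)+
        show "C3 \<in> poly_functions" unfolding C3_def
          by (rule poly_functions.det_mult_matrix_family[OF fam(2) el famg])
        show "C4 \<in> poly_functions"
        proof (cases "i = Plus1 \<and> u = 0")
          case True
          then show ?thesis unfolding C4_def
            by (auto intro!: poly_functions.poly_family_eval famg poly_functions.const)
        next
          case False
          then have "C4 = (\<lambda>_. 1)" by (auto simp: C4_def)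
          then show ?thesis by (simp add: poly_functions.const)
        qed
      qed
      moreover have "C1 1 \<noteq> 0" by (simp add: C1_def at1 h1_def)
      moreover have "C2 1 \<noteq> 0" using c by (simp add: C2_def at1 e1_def)
      moreover have "C3 1 \<noteq> 0"
      proof -
        have "poly (gt 1) a \<noteq> 0" if a: "poly e1 a = 0" for a
        proof -
          have "a = c" "t \<noteq> 0" using a by (auto simp: e1_def)
          then have "q1 = 1" using w by (simp add: q1_def)
          then show ?thesis using c \<open>a = c\<close> by (simp add: gt_def at1 h1_def poly_monom)
        qed
        then show ?thesis using det_mult_matrix_eq_0_iff[OF e1(1)] by (auto simp: C3_def at1)
      qed
      moreover have "C4 1 \<noteq> 0"
      proof (cases "i = Plus1 \<and> u = 0")
        case True
        then have "d = 1" "w = 0" using dw by auto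
        then show ?thesis by (simp add: C4_def gt_def at1 h1_def q1_def)
      qed (auto simp: C4_def)
      ultimately have fin: "finite ({z. C1 z = 0} \<union> {z. C2 z = 0} \<union> {z. C3 z = 0} \<union> {z. C4 z = 0})"
        using finite_zeros_poly_functions by blast
      have inS: "pt z \<in> S" if z: "C1 z \<noteq> 0" "C2 z \<noteq> 0" "C3 z \<noteq> 0" "C4 z \<noteq> 0" for z
      proof -
        have "\<exists>I1 I2 I3. graph_ideal (monom 1 d * (ht z * et z)) (gt z) = I1 \<inter> I2 \<inter> I3 \<and>
          I1 \<in> hilb_sub s {varx} {(0, 0)} \<and> I2 \<in> hilb_sub t {} {(a, b). a * b = 0} \<and> I3 \<in> factor_W u i"
        proof (rule generic_mem_image[OF hl _ _ el _ _ i dw])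
          show "ht z dvd gt z" "monom 1 w dvd gt z" by (simp_all add: gt_def)
          show "poly (ht z) 0 \<noteq> 0" "poly (et z) 0 \<noteq> 0" using z by (simp_all add: C1_def C2_def)
          show "poly (gt z) a \<noteq> 0" if "poly (et z) a = 0" for a
            using z(3) that det_mult_matrix_eq_0_iff[OF el(1)] by (auto simp: C3_def)
          show "poly (gt z) 0 \<noteq> 0" if "i = Plus1" "u = 0" using z(4) that by (simp add: C4_def)
        qed
        then show ?thesis unfolding S_def ft_def by blast
      qed
      have "graph_ideal f g \<in> chart_U n"
        using graph_ideal_mem_chart[OF ftm[of 0], of g] by (simp add: at0)
      moreover have "graph_ideal f g \<in> hilb_zariski n closure_of S"
        unfolding in_closure_of
      proof (intro conjI allI impI)
        show "graph_ideal f g \<in> topspace (hilb_zariski n)"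
          using topspace_hilb_zariski calculation by blast
        fix T assume T: "graph_ideal f g \<in> T \<and> openin (hilb_zariski n) T"
        then have "finite {z. pt z \<notin> T}"
          by (intro finite_complement_open[of T 0]) (auto simp: at0)
        then have "finite ({z. pt z \<notin> T} \<union> ({z. C1 z = 0} \<union> {z. C2 z = 0} \<union> {z. C3 z = 0} \<union> {z. C4 z = 0}))"
          using fin by blast
        from ex_new_if_finite[OF infinite_UNIV_alg_closed this]
        obtain z where z: "z \<notin> {z. pt z \<notin> T} \<union> ({z. C1 z = 0} \<union> {z. C2 z = 0} \<union> {z. C3 z = 0} \<union> {z. C4 z = 0})"
          by (rule exE)
        have "pt z \<in> S" by (rule inS) (use z in simp_all)
        moreover have "pt z \<in> T" using z by simp
        ultimately show "\<exists>y. y \<in> S \<and> y \<in> T" by (intro exI[of _ "pt z"] conjI)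
      qed
      ultimately show "graph_ideal f g \<in> ?Y" unfolding Y by blast
    qed
  qed
qed

section \<open>Coordinate rings\<close>

lemma function_algebra_adjoin_constants: "function_algebra (adjoin constants S)"
proof (intro function_algebra.intro function_algebra_axioms.intro constants.class_subring_adjoin)
  show "(\<lambda>_. c) \<in> adjoin constants S" for c by (rule adjoin.base) simp
qed

text \<open>A polynomial ring fits the format with the generator 0, whose monic relation is the
  variable itself, of degree 1.\<close>

lemma free_basis_zero:
  fixes V :: "('x \<Rightarrow> 'a::field) set"
  assumes "finite V" "\<And>w. \<exists>z. \<forall>v\<in>V. v z = w v"
  shows "free_basis V 0 1"
proof -
  interpret A: function_algebra "adjoin constants V" by (rule function_algebra_adjoin_constants)
  have "coeffs_in (adjoin constants V) [:0, 1:]"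
    unfolding coeffs_in_pCons using A.coeffs_in_ring(1) by simp
  moreover have "p = 0" if "degree p < 1" "poly p 0 = 0" for p :: "('x \<Rightarrow> 'a) poly"
    using that by (cases p) (auto split: if_splits)
  ultimately show ?thesis
    unfolding free_basis_def using assms by (auto intro!: exI[of _ "[:0, 1:]"])
qed

locale pair_coordinates =
  fixes n s d w t :: nat and z0 :: "'a::alg_closed_field poly \<times> 'a poly"
  assumes z0: "z0 \<in> pairs n s d w" and n: "n = s + d + t" "1 \<le> n" and w: "w \<le> d" "d \<le> Suc w"
begin

text \<open>Functions on \<open>pairs n s d w\<close> are extended to the whole type by their value at \<open>z0\<close>.\<close>

definition proj :: "'a poly \<times> 'a poly \<Rightarrow> 'a poly \<times> 'a poly" where
  "proj z = (if z \<in> pairs n s d w then z else z0)"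

definition cf :: "nat \<Rightarrow> 'a poly \<times> 'a poly \<Rightarrow> 'a" where
  "cf j z = coeff (fst (proj z)) j"

definition cg :: "nat \<Rightarrow> 'a poly \<times> 'a poly \<Rightarrow> 'a" where
  "cg j z = coeff (snd (proj z)) j"

definition point :: "'a poly \<times> 'a poly \<Rightarrow> 'a poly poly set" where
  "point z = graph_ideal (fst (proj z)) (snd (proj z))"

lemma proj_mem: "proj z \<in> pairs n s d w"
  using z0 by (simp add: proj_def)

lemma proj_props: "lead_coeff (fst (proj z)) = 1" "degree (fst (proj z)) = n" "degree (snd (proj z)) < n"
  using proj_mem[of z] by (auto simp: pairs_def split: prod.splits)

lemma coords_of_pair:
  assumes "(f, g) \<in> pairs n s d w"
  shows "cf j (f, g) = coeff f j" "cg j (f, g) = coeff g j"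
  using assms by (simp_all add: cf_def cg_def proj_def)

lemma cf_regular: "\<exists>\<phi>\<in>regular_functions (basis_U n). cf j = (\<lambda>z. \<phi> (point z))"
  using regular.coeff_family[OF poly_family_f_of, of n j] f_of_graph_ideal[OF proj_props(1,2)]
  by (intro bexI[of _ "\<lambda>I. coeff (f_of n I) j"]) (auto simp: cf_def point_def)

lemma cg_regular: "\<exists>\<phi>\<in>regular_functions (basis_U n). cg j = (\<lambda>z. \<phi> (point z))"
  using regular.coeff_family[OF poly_family_g_of, of n j] g_of_graph_ideal[OF proj_props]
  by (intro bexI[of _ "\<lambda>I. coeff (g_of n I) j"]) (auto simp: cg_def point_def)

lemma zero_regular: "\<exists>\<phi>\<in>regular_functions (basis_U n). 0 = (\<lambda>z. \<phi> (point z))"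
  using regular_functions.const[of 0] by (intro bexI[of _ "\<lambda>_. 0"]) (auto simp: fun_eq_iff)

text \<open>The coordinates of a graph ideal are coefficients of remainders by \<open>f\<close>, so
  every regular function is a polynomial in the coefficients of \<open>f\<close> and
  \<open>g\<close>. These generate \<open>K[V, g]\<close>, and \<open>V\<close>, \<open>g\<close>
  come from regular functions; composing with \<open>f_of\<close> and \<open>g_of\<close> is the
  isomorphism.\<close>

lemma cohen_macaulayI:
  assumes free: "free_basis V g m"
    and cf: "\<And>j. cf j \<in> adjoin constants (insert g V)"
    and cg: "\<And>j. cg j \<in> adjoin constants (insert g V)"
    and reg: "\<And>v. v \<in> insert g V \<Longrightarrow> \<exists>\<phi>\<in>regular_functions (basis_U n). v = (\<lambda>z. \<phi> (point z))"
  shows "cohen_macaulay n ((\<lambda>(f, g). graph_ideal f g) ` (pairs n s d w :: ('a poly \<times> 'a poly) set))"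
proof -
  let ?C = "adjoin constants (insert g V)"
  let ?Z = "pairs n s d w :: ('a poly \<times> 'a poly) set"
  let ?Y = "(\<lambda>(f, g). graph_ideal f g) ` ?Z"
  let ?R = "coordinate_ring (basis_U n) ?Y"
  interpret C: function_algebra ?C by (rule function_algebra_adjoin_constants)
  have C_reg: "\<exists>\<phi>\<in>regular_functions (basis_U n). c = (\<lambda>z. \<phi> (point z))" if "c \<in> ?C" for c
    using that
  proof (induction rule: adjoin.induct)
    case (base a)
    show ?case
    proof (cases "a \<in> insert g V")
      case False
      then obtain k where "a = (\<lambda>_. k)" using base by (auto simp: constants_def)
      then show ?thesis using regular_functions.const[of k] by (intro bexI[of _ "\<lambda>_. k"]) auto
    qed (rule reg)
  next
    case (add a b)
    then obtain \<phi> \<chi> where "\<phi> \<in> regular_functions (basis_U n)" "a = (\<lambda>z. \<phi> (point z))"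
      "\<chi> \<in> regular_functions (basis_U n)" "b = (\<lambda>z. \<chi> (point z))" by blast
    then show ?case using regular_functions.add[of \<phi> _ \<chi>]
      by (intro bexI[of _ "\<lambda>I. \<phi> I + \<chi> I"]) (auto simp: fun_eq_iff)
  next
    case (mult a b)
    then obtain \<phi> \<chi> where "\<phi> \<in> regular_functions (basis_U n)" "a = (\<lambda>z. \<phi> (point z))"
      "\<chi> \<in> regular_functions (basis_U n)" "b = (\<lambda>z. \<chi> (point z))" by blast
    then show ?case using regular_functions.mult[of \<phi> _ \<chi>]
      by (intro bexI[of _ "\<lambda>I. \<phi> I * \<chi> I"]) (auto simp: fun_eq_iff)
  qed
  have famf: "poly_family ?C (\<lambda>z. fst (proj z))"
    using cf proj_props(2) by (intro C.poly_familyI[where d = n]) (auto simp: cf_def[abs_def])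
  have famg: "poly_family ?C (\<lambda>z. snd (proj z))"
    using cg less_imp_le[OF proj_props(3)] by (intro C.poly_familyI[where d = n]) (auto simp: cg_def[abs_def])
  have reg_C: "(\<lambda>z. \<phi> (point z)) \<in> ?C" if "\<phi> \<in> regular_functions (basis_U n)" for \<phi>
    using that
  proof (induction rule: regular_functions.induct)
    case (coord b p)
    then obtain j where j: "b = vary ^ j" "j < n" by (auto simp: basis_U_def)
    have "poly_family ?C (\<lambda>z. subst (snd (proj z)) p mod fst (proj z))"
      using proj_props(1,2) by (intro C.poly_family_mod[where n = n] C.poly_family_subst famf famg)
    then show ?case
      unfolding point_def j(1) coord_graph_ideal[OF proj_props(1,2) j(2)] by (rule C.coeff_family)
  qed (auto intro: C.const C.pointwise)
  define h where "h c = restrict (\<lambda>I. c (f_of n I, g_of n I)) ?Y" for c :: "'a poly \<times> 'a poly \<Rightarrow> 'a"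
  have at: "(f_of n (point z), g_of n (point z)) = proj z" for z
    unfolding point_def by (simp add: f_of_graph_ideal[OF proj_props(1,2)] g_of_graph_ideal[OF proj_props])
  have pY: "point z \<in> ?Y" for z
    unfolding point_def using proj_mem[of z] by (auto intro!: rev_image_eqI split: prod.splits)
  have Yp: "\<exists>z\<in>?Z. I = point z \<and> proj z = z" if "I \<in> ?Y" for I
    using that by (auto simp: point_def proj_def intro!: bexI)
  have hp: "h (\<lambda>z. \<phi> (point z)) = restrict \<phi> ?Y" for \<phi>
  proof
    fix I
    show "h (\<lambda>z. \<phi> (point z)) I = restrict \<phi> ?Y I"
    proof (cases "I \<in> ?Y")
      case True
      from Yp[OF this] obtain z where "I = point z" "proj z = z" by blast
      then show ?thesis using at[of z] True by (simp add: h_def)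
    next
      case False
      then show ?thesis by (simp add: h_def)
    qed
  qed
  have hinj: "c z = h c (point z)" if c: "c \<in> ?C" for c z
  proof -
    obtain \<phi> where "c = (\<lambda>z. \<phi> (point z))" using C_reg[OF c] by blast
    then show ?thesis using pY hp[of \<phi>] by simp
  qed
  have "h \<in> ring_iso (class_ring ?C) ?R"
    unfolding ring_iso_def
  proof (intro CollectI conjI ring_hom_memI)
    fix a b assume a: "a \<in> carrier (class_ring ?C)"
    then show "h a \<in> carrier ?R"
      using C_reg[of a] hp by (auto simp: coordinate_ring_def)
    show "h (a \<otimes>\<^bsub>class_ring ?C\<^esub> b) = h a \<otimes>\<^bsub>?R\<^esub> h b"
      by (auto simp: coordinate_ring_def h_def fun_eq_iff)
    show "h (a \<oplus>\<^bsub>class_ring ?C\<^esub> b) = h a \<oplus>\<^bsub>?R\<^esub> h b"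
      by (auto simp: coordinate_ring_def h_def fun_eq_iff)
  next
    show "h \<one>\<^bsub>class_ring ?C\<^esub> = \<one>\<^bsub>?R\<^esub>" by (auto simp: coordinate_ring_def h_def fun_eq_iff)
    show "bij_betw h (carrier (class_ring ?C)) (carrier ?R)"
      unfolding bij_betw_def
    proof
      show "inj_on h (carrier (class_ring ?C))"
      proof (rule inj_onI)
        fix a b assume ab: "a \<in> carrier (class_ring ?C)" "b \<in> carrier (class_ring ?C)" "h a = h b"
        show "a = b"
        proof
          fix z
          show "a z = b z" using hinj[of a z] hinj[of b z] ab by simp
        qed
      qed
      show "h ` carrier (class_ring ?C) = carrier ?R"
      proof
        show "h ` carrier (class_ring ?C) \<subseteq> carrier ?R"
          using C_reg hp by (fastforce simp: coordinate_ring_def)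
        show "carrier ?R \<subseteq> h ` carrier (class_ring ?C)"
        proof
          fix r assume "r \<in> carrier ?R"
          then obtain \<phi> where "\<phi> \<in> regular_functions (basis_U n)" "r = restrict \<phi> ?Y"
            by (auto simp: coordinate_ring_def)
          then show "r \<in> h ` carrier (class_ring ?C)"
            using reg_C[of \<phi>] hp[of \<phi>] by (intro image_eqI[of _ _ "\<lambda>z. \<phi> (point z)"]) auto
        qed
      qed
    qed
  qed
  moreover have "h 0 = \<zero>\<^bsub>?R\<^esub>" by (auto simp: coordinate_ring_def h_def fun_eq_iff)
  ultimately show ?thesis
    unfolding cohen_macaulay_def
    by (rule cohen_macaulay_functions[OF infinite_UNIV_alg_closed free])
qed

lemma decomp:
  obtains h e q where "lead_coeff h = 1" "degree h = s" "lead_coeff e = 1" "degree e = t"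
    "\<And>j. cf j z = (if j < d then 0 else coeff (h * e) (j - d))"
    "\<And>j. cg j z = (if j < w then 0 else coeff (h * q) (j - w))"
    "\<And>i. t + d - w \<le> i \<Longrightarrow> coeff q i = 0"
proof -
  obtain f g where fg: "proj z = (f, g)" by (cases "proj z")
  then have "(f, g) \<in> pairs n s d w" using proj_mem[of z] by simp
  then obtain h e q where "lead_coeff h = 1" "degree h = s" "lead_coeff e = 1" "degree e = t"
    "f = monom 1 d * (h * e)" "g = monom 1 w * (h * q)" "\<And>i. t + d - w \<le> i \<Longrightarrow> coeff q i = 0"
    using pairs_decomp[OF _ n(1) w(1) n(2)] by metis
  then show ?thesis using that[of h e q] by (simp add: cf_def cg_def fg coeff_monom_mult)
qed

lemma cf_const:
  shows "cf j = (if j < d then 0 else if j = n then 1 else if n < j then 0 else cf j)"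
proof
  fix z
  obtain h e q where h: "lead_coeff h = 1" "degree h = s" "lead_coeff e = 1" "degree e = t"
    and c: "\<And>j. cf j z = (if j < d then 0 else coeff (h * e) (j - d))"
    using decomp[of z] by metis
  have "h \<noteq> 0" "e \<noteq> 0" using h by auto
  then have deg: "degree (h * e) = s + t" using h by (simp add: degree_mult_eq)
  have "lead_coeff (h * e) = 1" unfolding lead_coeff_mult h(1,3) by simp
  then have "coeff (h * e) (s + t) = 1" unfolding deg .
  moreover have "coeff (h * e) i = 0" if "s + t < i" for i using that deg by (intro coeff_eq_0) simp
  ultimately show "cf j z = (if j < d then 0 else if j = n then 1 else if n < j then 0 else cf j) z"
    using c[of j] n(1) by auto
qed

lemma cf_mem:
  assumes "\<And>j. j < s + t \<Longrightarrow> cf (d + j) \<in> S"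
  shows "cf j \<in> adjoin constants S"
proof -
  interpret A: function_algebra "adjoin constants S" by (rule function_algebra_adjoin_constants)
  consider "j < d" | "d \<le> j" "j < n" | "j = n" | "n < j" by linarith
  then show ?thesis
  proof cases
    case 2
    then have "cf (d + (j - d)) \<in> S" using n(1) by (intro assms) auto
    then show ?thesis using 2 by (auto intro: adjoin.base)
  next
    case 1
    then have "cf j = 0" using cf_const[of j] by simp
    then show ?thesis by simp
  next
    case 3
    have "\<not> n < d" using n(1) by linarith
    then have "cf j = 1" using cf_const[of n] 3 by simp
    then show ?thesis by simp
  next
    case 4
    have "\<not> n < d" using n(1) by linarith
    then have "cf j = 0" using cf_const[of j] 4 by simp
    then show ?thesis by simp
  qed
qed

text \<open>The common factor is 1, so the coefficients of \<open>f / y^d\<close> below the leading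
  one and all \<open>n - w\<close> coefficients of \<open>g / y^w\<close> vary
  independently.\<close>

lemma cohen_macaulay_s_0:
  assumes s: "s = 0"
  shows "cohen_macaulay n ((\<lambda>(f, g). graph_ideal f g) ` (pairs n s d w :: ('a poly \<times> 'a poly) set))"
proof (rule cohen_macaulayI)
  let ?V = "(\<lambda>j. cf (d + j)) ` {..<t} \<union> (\<lambda>j. cg (w + j)) ` {..<n - w}"
  show "free_basis ?V 0 1"
  proof (rule free_basis_zero)
    fix W :: "('a poly \<times> 'a poly \<Rightarrow> 'a) \<Rightarrow> 'a"
    define F where "F = monom 1 t + (\<Sum>j<t. monom (W (cf (d + j))) j)"
    define G where "G = (\<Sum>j<n - w. monom (W (cg (w + j))) j)"
    have cF: "coeff F j = (if j < t then W (cf (d + j)) else if j = t then 1 else 0)" for j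
      by (auto simp: F_def coeff_sum)
    have cG: "coeff G j = (if j < n - w then W (cg (w + j)) else 0)" for j
      by (simp add: G_def coeff_sum)
    have dF: "degree F = t" by (intro antisym degree_le le_degree) (auto simp: cF)
    have "(monom 1 d * (1 * F), monom 1 w * (1 * G)) \<in> pairs n s d w"
      using n w s by (intro pairsI[where t = t]) (auto simp: dF cF cG)
    then have "(monom 1 d * F, monom 1 w * G) \<in> pairs n s d w" by simp
    note c = coords_of_pair[OF this]
    show "\<exists>z. \<forall>v\<in>?V. v z = W v"
      by (intro exI[of _ "(monom 1 d * F, monom 1 w * G)"]) (auto simp: c coeff_monom_mult cF cG)
  qed simp
  interpret A: function_algebra "adjoin constants (insert 0 ?V)" by (rule function_algebra_adjoin_constants)
  show "cf j \<in> adjoin constants (insert 0 ?V)" for j by (rule cf_mem) (auto simp: s)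
  show "cg j \<in> adjoin constants (insert 0 ?V)" for j
  proof -
    consider "j < w" | "w \<le> j" "j < n" | "n \<le> j" by linarith
    then show ?thesis
    proof cases
      case 1
      have "cg j z = 0" for z by (rule decomp[of z]) (use 1 in simp)
      then have "cg j = 0" by (simp add: fun_eq_iff)
      then show ?thesis by simp
    next
      case 2
      have "cg (w + (j - w)) \<in> (\<lambda>j. cg (w + j)) ` {..<n - w}"
        by (rule image_eqI[of _ _ "j - w"]) (use 2 in auto)
      then have "cg j \<in> ?V" using 2 by simp
      then show ?thesis by (intro adjoin.base) blast
    next
      case 3
      have "cg j z = 0" for z unfolding cg_def using proj_props(3)[of z] 3 by (intro coeff_eq_0) simp
      then have "cg j = 0" by (simp add: fun_eq_iff)
      then show ?thesis by simp
    qed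
  qed
  show "\<exists>\<phi>\<in>regular_functions (basis_U n). v = (\<lambda>z. \<phi> (point z))" if "v \<in> insert 0 ?V" for v
    using that cf_regular cg_regular zero_regular by blast
qed

text \<open>Now \<open>g / y^w\<close> is a constant multiple of the monic \<open>f / y^d\<close>.
  The constant is the coefficient of \<open>g\<close> at \<open>w + s\<close>; it is a free
  coordinate if \<open>w < d\<close> and 0 if \<open>w = d\<close>.\<close>

lemma cohen_macaulay_t_0:
  assumes t: "t = 0"
  shows "cohen_macaulay n ((\<lambda>(f, g). graph_ideal f g) ` (pairs n s d w :: ('a poly \<times> 'a poly) set))"
proof (rule cohen_macaulayI)
  let ?V = "(\<lambda>j. cf (d + j)) ` {..<s} \<union> (if w < d then {cg (w + s)} else {})"
  show "free_basis ?V 0 1"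
  proof (rule free_basis_zero)
    fix W :: "('a poly \<times> 'a poly \<Rightarrow> 'a) \<Rightarrow> 'a"
    define F where "F = monom 1 s + (\<Sum>j<s. monom (W (cf (d + j))) j)"
    define q where "q = (if w < d then [:W (cg (w + s)):] else 0)"
    have cF: "coeff F j = (if j < s then W (cf (d + j)) else if j = s then 1 else 0)" for j
      by (auto simp: F_def coeff_sum)
    have dF: "degree F = s" by (intro antisym degree_le le_degree) (auto simp: cF)
    have "(monom 1 d * (F * 1), monom 1 w * (F * q)) \<in> pairs n s d w"
      using n w t by (intro pairsI[where t = t]) (auto simp: dF cF q_def coeff_pCons split: nat.splits)
    then have p: "(monom 1 d * F, monom 1 w * (F * q)) \<in> pairs n s d w" by simp
    note c = coords_of_pair[OF p]
    have "coeff (F * q) s = W (cg (w + s))" if "w < d" using that by (simp add: q_def cF)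
    then show "\<exists>z. \<forall>v\<in>?V. v z = W v"
      by (intro exI[of _ "(monom 1 d * F, monom 1 w * (F * q))"])
        (auto simp: c coeff_monom_mult cF split: if_splits)
  qed simp
  interpret A: function_algebra "adjoin constants (insert 0 ?V)" by (rule function_algebra_adjoin_constants)
  show cf: "cf j \<in> adjoin constants (insert 0 ?V)" for j by (rule cf_mem) (auto simp: t)
  show "cg j \<in> adjoin constants (insert 0 ?V)" for j
  proof -
    have eq: "cg j z = (if j < w \<or> w = d then 0 else cg (w + s) z * cf (d + (j - w)) z)" for z
    proof -
      obtain h e q where h: "lead_coeff h = 1" "degree h = s" "lead_coeff e = 1" "degree e = t"
        and cf: "\<And>j. cf j z = (if j < d then 0 else coeff (h * e) (j - d))"
        and cg: "\<And>j. cg j z = (if j < w then 0 else coeff (h * q) (j - w))"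
        and q: "\<And>i. t + d - w \<le> i \<Longrightarrow> coeff q i = 0" using decomp[of z] by metis
      have e1: "e = 1" using h(3,4) t by (metis degree_eq_zeroE lead_coeff_pCons(2) one_pCons pCons_eq_0_iff)
      have "degree q = 0" using q t w(2) by (intro le_zero_eq[THEN iffD1] degree_le) auto
      then obtain b where b: "q = [:b:]" by (rule degree_eq_zeroE)
      show ?thesis
      proof (cases "w = d")
        case True
        then have "b = 0" using q[of 0] t b by simp
        then show ?thesis using True cg b by simp
      next
        case False
        have "coeff h s = 1" using h(1,2) by simp
        then have cgs: "cg (w + s) z = b" by (simp add: cg b)
        have cfh: "cf (d + k) z = coeff h k" for k by (simp add: cf e1)
        show ?thesis unfolding cgs cfh using False by (simp add: cg b mult.commute)
      qed
    qed
    show ?thesis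
    proof (cases "j < w \<or> w = d")
      case True
      then have "cg j = 0" using eq by (simp add: fun_eq_iff)
      then show ?thesis by simp
    next
      case False
      then have e: "cg j = cg (w + s) * cf (d + (j - w))" using eq by (simp add: fun_eq_iff)
      have "cg (w + s) \<in> adjoin constants (insert 0 ?V)"
        using False w by (auto intro!: adjoin.base)
      then show ?thesis unfolding e using cf by (rule A.mult_mem)
    qed
  qed
  show "\<exists>\<phi>\<in>regular_functions (basis_U n). v = (\<lambda>z. \<phi> (point z))" if "v \<in> insert 0 ?V" for v
    using that cf_regular cg_regular zero_regular by (auto split: if_splits)
qed

lemma cohen_macaulay_s_1:
  assumes s: "s = 1"
  shows "cohen_macaulay n ((\<lambda>(f, g). graph_ideal f g) ` (pairs n s d w :: ('a poly \<times> 'a poly) set))"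
proof -
  define m where "m = Suc t"
  define l where "l = n - w"
  define V where "V = (\<lambda>j. cf (d + j)) ` {..<m} \<union> (\<lambda>j. cg (w + j)) ` {1..<l}"
  have nm: "n = d + m" using n s by (simp add: m_def)
  \<comment> \<open>\<open>l\<close> is the number of coefficients of \<open>g / y^w\<close>, which
    is \<open>m\<close> or \<open>m + 1\<close>.\<close>
  have l: "l = m + d - w" "m \<le> l" "l \<le> Suc m" "1 \<le> m" using nm w by (auto simp: l_def m_def)
  define F where "F z = monom 1 m + (\<Sum>j<m. monom (cf (d + j) z) j)" for z
  define G where "G z = (\<Sum>j=1..<l. monom (cg (w + j) z) j)" for z
  have cF: "coeff (F z) j = (if j < m then cf (d + j) z else if j = m then 1 else 0)" for z j
    by (auto simp: F_def coeff_sum)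
  have cG: "coeff (G z) j = (if 1 \<le> j \<and> j < l then cg (w + j) z else 0)" for z j
    by (auto simp: G_def coeff_sum)
  have dF: "degree (F z) = m" for z by (intro antisym degree_le le_degree) (auto simp: cF)
  have lF: "lead_coeff (F z) = 1" for z by (simp add: dF cF)
  interpret A: function_algebra "adjoin constants V" by (rule function_algebra_adjoin_constants)
  have VF: "cf (d + j) \<in> adjoin constants V" if "j < m" for j
    using that by (intro adjoin.base) (auto simp: V_def)
  have VG: "cg (w + j) \<in> adjoin constants V" if "1 \<le> j" "j < l" for j
    using that by (intro adjoin.base) (auto simp: V_def)
  have famF: "poly_family (adjoin constants V) F"
  proof (rule A.poly_familyI[where d = m])
    show "(\<lambda>z. coeff (F z) i) \<in> adjoin constants V" for i
      using VF[of i] by (cases "i < m"; cases "i = m") (simp_all add: cF A.const)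
  qed (simp add: dF)
  have famG: "poly_family (adjoin constants V) G"
  proof (rule A.poly_familyI[where d = l])
    show "(\<lambda>z. coeff (G z) i) \<in> adjoin constants V" for i
      using VG[of i] by (cases "1 \<le> i \<and> i < l") (auto simp: cG A.const)
  qed (auto intro!: degree_le simp: cG)
  text \<open>The points of \<open>pairs n 1 d w\<close> are the pairs \<open>(y\<^sup>d P, y\<^sup>w (Q - Q(a)))\<close> with \<open>P(a) = 0\<close>.\<close>
  have mk: "(monom 1 d * P, monom 1 w * (Q - [:poly Q a:])) \<in> pairs n s d w"
    if P: "lead_coeff P = 1" "degree P = m" "poly P a = 0" and Q: "\<And>j. l \<le> j \<Longrightarrow> coeff Q j = 0" for P Q a
  proof -
    let ?h = "[:- a, 1:]"
    have "?h dvd P" using P(3) by (simp add: poly_eq_0_iff_dvd)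
    then have "monom 1 d * ?h dvd monom 1 d * P" by (rule mult_dvd_mono[OF dvd_refl])
    moreover have "?h dvd Q - [:poly Q a:]" by (simp add: poly_eq_0_iff_dvd[symmetric])
    then have "monom 1 w * ?h dvd monom 1 w * (Q - [:poly Q a:])" by (rule mult_dvd_mono[OF dvd_refl])
    moreover have "lead_coeff (monom 1 d * P) = 1" unfolding lead_coeff_monom_1_mult by (rule P(1))
    moreover have "degree (monom 1 d * P) = n"
      using degree_monom_1_mult[of P d] P(1,2) nm by fastforce
    moreover have "degree (monom 1 w * (Q - [:poly Q a:])) < n"
    proof (rule degree_less_of_coeffs)
      fix k assume k: "n \<le> k"
      then have "l \<le> k - w" "k - w \<noteq> 0" using l(2,4) by (auto simp: l_def)
      then show "coeff (monom 1 w * (Q - [:poly Q a:])) k = 0"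
        using Q[of "k - w"] by (auto simp: coeff_monom_mult coeff_pCons split: nat.splits)
    qed (use n(2) in linarith)
    moreover have "s \<le> degree ?h" by (simp add: s)
    ultimately show ?thesis unfolding pairs_def by blast
  qed
  have mk_coords: "cf (d + j) (monom 1 d * P, monom 1 w * (Q - [:poly Q a:])) = coeff P j"
    "cg (w + j) (monom 1 d * P, monom 1 w * (Q - [:poly Q a:])) = (if j = 0 then coeff Q 0 - poly Q a else coeff Q j)"
    if "lead_coeff P = 1" "degree P = m" "poly P a = 0" "\<And>j. l \<le> j \<Longrightarrow> coeff Q j = 0" for P Q a j
    using coords_of_pair[OF mk[OF that]] by (auto simp: coeff_monom_mult coeff_pCons split: nat.splits)
  \<comment> \<open>\<open>F\<close> is \<open>f / y^d\<close>, and \<open>G\<close> is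
    \<open>g / y^w\<close> without its constant term \<open>cg w\<close>. A root of the linear
    common factor is a common root of \<open>F\<close> and \<open>G + cg w\<close>.\<close>
  have root: "\<exists>a. poly (F z) a = 0 \<and> cg w z = - poly (G z) a" for z
  proof -
    obtain h e q where h: "lead_coeff h = 1" "degree h = s" "lead_coeff e = 1" "degree e = t"
      and cf: "\<And>j. cf j z = (if j < d then 0 else coeff (h * e) (j - d))"
      and cg: "\<And>j. cg j z = (if j < w then 0 else coeff (h * q) (j - w))"
      and q: "\<And>i. t + d - w \<le> i \<Longrightarrow> coeff q i = 0" using decomp[of z] by metis
    obtain a where a: "poly h a = 0" using alg_closed_imp_poly_has_root[of h] h(2) s by auto
    have "h \<noteq> 0" "e \<noteq> 0" using h by auto
    then have deg: "degree (h * e) = m" using h s by (simp add: degree_mult_eq m_def)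
    have "lead_coeff (h * e) = 1" unfolding lead_coeff_mult h(1,3) by simp
    then have "coeff (h * e) m = 1" unfolding deg .
    then have "F z = h * e"
      using deg by (intro poly_eqI) (auto simp: cF cf coeff_eq_0)
    moreover have "G z + [:cg w z:] = h * q"
    proof (rule poly_eqI)
      fix j
      have "coeff (h * q) j = 0" if "l \<le> j"
      proof (cases "q = 0")
        case False
        have "degree q < t + d - w" using q[of "degree q"] False by (cases "t + d - w \<le> degree q") auto
        then have "degree (h * q) < j"
          using degree_mult_le[of h q] h(2) s that l(1) by (simp add: m_def)
        then show ?thesis by (rule coeff_eq_0)
      qed simp
      then show "coeff (G z + [:cg w z:]) j = coeff (h * q) j"
        using cg[of "w + j"] by (cases j) (auto simp: cG cg not_less)
    qed
    then have "poly (G z + [:cg w z:]) a = 0" using a by simp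
    then have "cg w z = - poly (G z) a" by (simp add: eq_neg_iff_add_eq_0 add.commute)
    ultimately show ?thesis using a by auto
  qed
  have "free_basis V (cg w) m"
    unfolding free_basis_def
  proof (intro conjI allI impI)
    show "finite V" by (simp add: V_def)
    show "0 < m" by (simp add: m_def)
    fix W :: "('a poly \<times> 'a poly \<Rightarrow> 'a) \<Rightarrow> 'a"
    define P where "P = monom 1 m + (\<Sum>j<m. monom (W (cf (d + j))) j)"
    define Q where "Q = (\<Sum>j=1..<l. monom (W (cg (w + j))) j)"
    have cP: "coeff P j = (if j < m then W (cf (d + j)) else if j = m then 1 else 0)" for j
      by (auto simp: P_def coeff_sum)
    have cQ: "coeff Q j = (if 1 \<le> j \<and> j < l then W (cg (w + j)) else 0)" for j
      by (auto simp: Q_def coeff_sum)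
    have dP: "degree P = m" by (intro antisym degree_le le_degree) (auto simp: cP)
    have lP: "lead_coeff P = 1" by (simp add: dP cP)
    obtain a where a: "poly P a = 0" using alg_closed_imp_poly_has_root[of P] dP l(4) by auto
    have "coeff Q j = 0" if "l \<le> j" for j using that by (simp add: cQ)
    note c = mk_coords[OF lP dP a this]
    show "\<exists>z. \<forall>v\<in>V. v z = W v"
      by (intro exI[of _ "(monom 1 d * P, monom 1 w * (Q - [:poly Q a:]))"])
        (auto simp: V_def c cP cQ)
  next
    \<comment> \<open>As a polynomial in \<open>T\<close> this is the determinant of
      \<open>T\<close> plus multiplication by \<open>G\<close>, that is, the resultant of
      \<open>F\<close> and \<open>G + T\<close>; as a characteristic polynomial it is monic of
      degree \<open>m\<close>.\<close>
    define cp where "cp z = char_poly (- mult_matrix (F z) (G z))" for z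
    have Mc: "mult_matrix (F z) (G z) \<in> carrier_mat m m" for z
      using mult_matrix_carrier[of "F z" "G z"] unfolding dF .
    have cpm: "degree (cp z) = m" "coeff (cp z) m = 1" for z
      using degree_monic_char_poly[of "- mult_matrix (F z) (G z)" m] Mc[of z] by (auto simp: cp_def)
    have cp_fam: "(\<lambda>z. coeff (cp z) i) \<in> adjoin constants V" for i
    proof -
      let ?E = "\<lambda>z i j. (if i = j then [:0, 1:] else 0) + [:mult_matrix (F z) (G z) $$ (i, j):]"
      have eq: "cp z = (\<Sum>p | p permutes {0..<m}. signof p * (\<Prod>i = 0..<m. ?E z i (p i)))" for z
      proof -
        have c: "char_poly_matrix (- mult_matrix (F z) (G z)) \<in> carrier_mat m m" using Mc[of z] by simp
        have "cp z = (\<Sum>p | p permutes {0..<m}. signof p *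
            (\<Prod>i = 0..<m. char_poly_matrix (- mult_matrix (F z) (G z)) $$ (i, p i)))"
          unfolding cp_def char_poly_def by (rule det_def'[OF c])
        moreover have "char_poly_matrix (- mult_matrix (F z) (G z)) $$ (i, j) = ?E z i j"
          if "i < m" "j < m" for i j
          using that Mc[of z] by (auto simp: char_poly_matrix_def)
        ultimately show ?thesis
          by (auto simp: permutes_in_image[of _ "{0..<m}", simplified] intro!: sum.cong prod.cong)
      qed
      have "poly_family (adjoin constants V) (\<lambda>z. ?E z i j)" if "i < m" "j < m" for i j
        using A.mult_matrix_family[OF famF lF dF famG that]
        by (intro A.poly_family_add A.poly_family_const A.poly_family_scalar)
      then have "poly_family (adjoin constants V)
          (\<lambda>z. \<Sum>p | p permutes {0..<m}. signof p * (\<Prod>i = 0..<m. ?E z i (p i)))"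
        by (intro A.poly_family_sum A.poly_family_mult A.poly_family_prod A.poly_family_const)
          (auto simp: permutes_in_image[of _ "{0..<m}", simplified])
      also have "(\<lambda>z. \<Sum>p | p permutes {0..<m}. signof p * (\<Prod>i = 0..<m. ?E z i (p i))) = cp"
        by (rule ext) (rule eq[symmetric])
      finally have "poly_family (adjoin constants V) cp" .
      then show ?thesis by (rule A.coeff_family)
    qed
    define p where "p = (\<Sum>i\<le>m. monom (\<lambda>z. coeff (cp z) i) i)"
    have cp: "coeff p i = (if i \<le> m then (\<lambda>z. coeff (cp z) i) else 0)" for i
      by (simp add: p_def coeff_sum)
    have "coeff p m = 1" by (simp add: cp cpm fun_eq_iff)
    then have dp: "degree p = m" by (intro antisym degree_le le_degree) (auto simp: cp)
    have "coeffs_in (adjoin constants V) p"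
      unfolding coeffs_in_def cp using cp_fam by simp
    moreover have "lead_coeff p = 1" by (simp add: dp \<open>coeff p m = 1\<close>)
    moreover have "poly p (cg w) = 0"
    proof
      fix z
      have "map_poly (\<lambda>h. h z) p = cp z"
        using cpm[of z] by (intro poly_eqI) (auto simp: coeff_map_poly cp coeff_eq_0)
      then have "poly p (cg w) z = poly (cp z) (cg w z)" by (simp add: poly_fun_apply)
      also have "\<dots> = det (- char_matrix (- mult_matrix (F z) (G z)) (cg w z))"
        unfolding cp_def using Mc[of z] by (intro char_poly_matrix[of _ m]) simp
      \<comment> \<open>Adding a constant to \<open>G\<close> adds the same multiple of the identity
        to its multiplication matrix, since \<open>monom 1 j\<close> is already reduced modulo
        \<open>F\<close>.\<close>
      also have "- char_matrix (- mult_matrix (F z) (G z)) (cg w z) = mult_matrix (F z) (G z + [:cg w z:])"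
      proof (rule eq_matI)
        fix i j assume ij: "i < dim_row (mult_matrix (F z) (G z + [:cg w z:]))"
          "j < dim_col (mult_matrix (F z) (G z + [:cg w z:]))"
        then have ij: "i < m" "j < m" by (simp_all add: mult_matrix_def dF)
        have "[:cg w z:] * monom 1 j mod F z = monom (cg w z) j"
        proof -
          have "[:cg w z:] * monom 1 j = monom (cg w z) j" by (simp add: smult_monom)
          moreover have "degree (monom (cg w z) j) < degree (F z)"
            using degree_monom_le[of "cg w z" j] ij dF by (simp add: le_less_trans)
          ultimately show ?thesis by (simp add: mod_poly_less)
        qed
        then have "(G z + [:cg w z:]) * monom 1 j mod F z = (G z * monom 1 j) mod F z + monom (cg w z) j"
          by (simp only: distrib_right poly_mod_add_left)
        then show "(- char_matrix (- mult_matrix (F z) (G z)) (cg w z)) $$ (i, j) =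
            mult_matrix (F z) (G z + [:cg w z:]) $$ (i, j)"
          using ij by (auto simp: char_matrix_def mult_matrix_def dF)
      qed (auto simp: char_matrix_def mult_matrix_def)
      also have "det (mult_matrix (F z) (G z + [:cg w z:])) = 0"
        using root[of z] by (subst det_mult_matrix_eq_0_iff[OF lF]) auto
      finally show "poly p (cg w) z = 0 z" by simp
    qed
    ultimately show "\<exists>p. coeffs_in (adjoin constants V) p \<and> lead_coeff p = 1 \<and> degree p = m \<and> poly p (cg w) = 0"
      using dp by blast
  next
    fix p assume p: "coeffs_in (adjoin constants V) p" "degree p < m" "poly p (cg w) = 0"
    text \<open>Where \<open>F\<close> has distinct roots with distinct values of \<open>G\<close>, the relation has more roots than
      its degree; every other point is a limit of such points along a segment.\<close>
    have "coeff p k z0 = 0" for k z0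
    proof -
      obtain r0 where r0: "F z0 = (\<Prod>i<m. [:- r0 i, 1:])"
      proof -
        obtain A where A: "size A = degree (F z0)" "F z0 = smult (lead_coeff (F z0)) (\<Prod>x\<in>#A. [:- x, 1:])"
          using alg_closed_imp_factorization[of "F z0"] lF[of z0] by fastforce
        obtain xs where xs: "mset xs = A" using ex_mset by blast
        have "F z0 = (\<Prod>x\<leftarrow>xs. [:- x, 1:])"
          using A(2) lF[of z0] by (simp add: xs[symmetric] prod_mset_prod_list[symmetric])
        also have "\<dots> = (\<Prod>i<m. [:- (xs ! i), 1:])"
        proof -
          have "length xs = m" using A(1) dF[of z0] unfolding xs[symmetric] by simp
          then show ?thesis by (simp add: prod.list_conv_set_nth atLeast0LessThan)
        qed
        finally show ?thesis using that by blast
      qed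
      obtain r1 :: "nat \<Rightarrow> 'a" where r1: "inj r1"
        using infinite_countable_subset[OF infinite_UNIV_alg_closed] by blast
      \<comment> \<open>The polynomial \<open>y\<close> separates distinct roots, and
        \<open>l >= 2\<close> permits it as soon as \<open>m >= 2\<close>. For \<open>m = 1\<close>
        there is nothing to separate, and \<open>l\<close> may be 1, so 0 is taken.\<close>
      define Q1 where "Q1 = (if m = 1 then 0 else [:0, 1 :: 'a:])"
      \<comment> \<open>The roots are moved instead of the coefficients, so that each root is itself
        a polynomial function of the parameter.\<close>
      define r where "r i x = r0 i + x * (r1 i - r0 i)" for i x
      define P where "P x = (\<Prod>i<m. [:- r i x, 1:])" for x
      define Q where "Q x = G z0 + smult x (Q1 - G z0)" for x
      \<comment> \<open>The same \<open>P\<close> and \<open>Q\<close> with the common root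
        \<open>r i x\<close> selected. The points for different \<open>i\<close> agree in all
        coordinates of \<open>V\<close> and can differ only in \<open>cg w\<close>.\<close>
      define Z where "Z i x = (monom 1 d * P x, monom 1 w * (Q x - [:poly (Q x) (r i x):]))" for i x
      have lP: "lead_coeff (P x) = 1" for x unfolding P_def by (simp add: lead_coeff_prod)
      have dP: "degree (P x) = m" for x unfolding P_def by (subst degree_prod_eq_sum_degree) auto
      have rP: "poly (P x) (r i x) = 0" if "i < m" for i x
        unfolding P_def using that by (auto simp: poly_prod)
      have cQ: "coeff (Q x) j = 0" if "l \<le> j" for x j
        using that l(2,4) by (auto simp: Q_def Q1_def cG coeff_pCons split: nat.splits)
      have Zc: "cf (d + j) (Z i x) = coeff (P x) j"
        "cg (w + j) (Z i x) = (if j = 0 then coeff (Q x) 0 - poly (Q x) (r i x) else coeff (Q x) j)"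
        if "i < m" for i j x
        unfolding Z_def using mk_coords[OF lP dP rP[OF that] cQ] by blast+
      have idp: "(\<lambda>x :: 'a. x) \<in> poly_functions"
      proof -
        have "poly [:0, 1 :: 'a:] \<in> poly_functions" unfolding poly_functions_def by blast
        moreover have "poly [:0, 1:] = (\<lambda>x :: 'a. x)" by (simp add: fun_eq_iff)
        ultimately show ?thesis by simp
      qed
      have rfam: "r i \<in> poly_functions" for i
        unfolding r_def by (intro poly_functions.pointwise poly_functions.const idp)
      have Pfam: "poly_family poly_functions P"
      proof -
        have "poly_family poly_functions (\<lambda>x. [:- r i x, 1:])" for i
        proof -
          have "[:- r i x, 1:] = [:0, 1:] - [:r i x:]" for x by simp
          then show ?thesis using rfam[of i]
            by (simp only:) (intro poly_functions.poly_family_diff poly_functions.poly_family_const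
                poly_functions.poly_family_scalar)
        qed
        then show ?thesis unfolding P_def by (intro poly_functions.poly_family_prod)
      qed
      have Qfam: "poly_family poly_functions Q" unfolding Q_def by (rule poly_family_segment)
      have a_fam: "(\<lambda>x. a (Z 0 x)) \<in> poly_functions" if "a \<in> adjoin constants V" for a
        using that
      proof (induction rule: adjoin.induct)
        case (base a)
        consider c where "a = (\<lambda>_. c)" | j where "j < m" "a = cf (d + j)"
          | j where "1 \<le> j" "j < l" "a = cg (w + j)"
          using base by (auto simp: V_def constants_def)
        then show ?case
        proof cases
          case 1
          then show ?thesis by (simp add: poly_functions.const)
        next
          case 2
          then show ?thesis using Zc(1)[of 0] l(4) poly_functions.coeff_family[OF Pfam] by simp
        next
          case 3
          then show ?thesis using Zc(2)[of 0] l(4) poly_functions.coeff_family[OF Qfam] by simp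
        qed
      qed (auto intro: poly_functions.pointwise)
      have a_const: "a (Z i x) = a (Z 0 x)" if "a \<in> adjoin constants V" "i < m" for a i x
        using that(1)
      proof (rule adjoin_constants_cong)
        fix v assume "v \<in> V"
        then show "v (Z i x) = v (Z 0 x)"
          unfolding V_def using Zc[of i] Zc[of 0] that(2) l(4) by auto
      qed
      define b where "b j x = coeff p j (Z 0 x)" for j x
      have b_fam: "b j \<in> poly_functions" for j
        unfolding b_def using a_fam[OF coeffs_inD[OF p(1)]] .
      \<comment> \<open>Nonzero exactly when the values of \<open>Q\<close> at the \<open>m\<close>
        roots are pairwise different, so that the points \<open>Z i x\<close> have \<open>m\<close>
        different values of \<open>cg w\<close>.\<close>
      define \<Delta> where "\<Delta> x = (\<Prod>i<m. \<Prod>j<i. poly (Q x) (r i x) - poly (Q x) (r j x))" for x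
      have D_fam: "\<Delta> \<in> poly_functions"
        unfolding \<Delta>_def
        by (intro poly_functions.pointwise_prod poly_functions.pointwise poly_functions.poly_family_eval Qfam rfam)
      have "\<Delta> 1 \<noteq> 0"
      proof -
        have "poly (Q 1) (r i 1) \<noteq> poly (Q 1) (r j 1)" if "i < m" "j < i" for i j
          using that r1 by (auto simp: Q_def Q1_def r_def inj_def)
        then show ?thesis by (simp add: \<Delta>_def)
      qed
      then have finD: "finite {x. \<Delta> x = 0}" by (rule finite_zeros_poly_functions[OF D_fam])
      \<comment> \<open>The coefficients of \<open>p\<close> agree at all points
        \<open>Z i x\<close>; specialized there, \<open>p\<close> has \<open>m\<close> different
        roots but degree below \<open>m\<close>.\<close>
      have b0: "b k x = 0" if D: "\<Delta> x \<noteq> 0" for x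
      proof -
        define q where "q = map_poly (\<lambda>h. h (Z 0 x)) p"
        have cq: "coeff q j = b j x" for j by (simp add: q_def coeff_map_poly b_def)
        have roots: "poly q (- poly (Q x) (r i x) + coeff (Q x) 0) = 0" if i: "i < m" for i
        proof -
          have "map_poly (\<lambda>h. h (Z i x)) p = q"
            using a_const[OF coeffs_inD[OF p(1)] i] by (intro poly_eqI) (simp add: coeff_map_poly q_def)
          then have "poly q (cg w (Z i x)) = poly p (cg w) (Z i x)" by (simp add: poly_fun_apply)
          also have "\<dots> = 0" by (simp add: p(3))
          finally show ?thesis using Zc(2)[OF i, of 0] by simp
        qed
        have "q = 0"
        proof (rule ccontr)
          assume q0: "q \<noteq> 0"
          let ?v = "\<lambda>i. - poly (Q x) (r i x) + coeff (Q x) 0"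
          have "poly (Q x) (r i x) \<noteq> poly (Q x) (r j x)" if "i < m" "j < i" for i j
            using D that by (auto simp: \<Delta>_def)
          then have "inj_on ?v {..<m}"
            by (intro linorder_inj_onI) (auto, metis)
          then have "m = card (?v ` {..<m})" by (simp add: card_image)
          also have "\<dots> \<le> card {y. poly q y = 0}"
            using roots by (intro card_mono poly_roots_finite q0) auto
          also have "\<dots> \<le> degree q" by (rule card_poly_roots_bound[OF q0])
          also have "\<dots> \<le> degree p" unfolding q_def by (rule degree_map_poly_le)
          finally show False using p(2) by simp
        qed
        then show ?thesis using cq[of k] by simp
      qed
      have "b k 0 = 0"
      proof (rule ccontr)
        assume "b k 0 \<noteq> 0"
        then have "finite {x. b k x = 0}" by (rule finite_zeros_poly_functions[OF b_fam])
        then have "finite ({x. b k x = 0} \<union> {x. \<Delta> x = 0})" using finD by blast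
        moreover have "{x. b k x = 0} \<union> {x. \<Delta> x = 0} = UNIV" using b0 by blast
        ultimately show False using infinite_UNIV_alg_closed[where 'a = 'a] by simp
      qed
      \<comment> \<open>At parameter 0 the point need not be \<open>z0\<close>, since another common
        root may have been selected; but it has the same coordinates in \<open>V\<close>, on which
        the coefficients of \<open>p\<close> depend.\<close>
      moreover have "b k 0 = coeff p k z0"
        unfolding b_def using coeffs_inD[OF p(1), of k]
      proof (rule adjoin_constants_cong)
        have P0: "P 0 = F z0" by (simp add: P_def r_def r0)
        have Q0: "Q 0 = G z0" by (simp add: Q_def)
        fix v assume "v \<in> V"
        then show "v (Z 0 0) = v z0"
          unfolding V_def using Zc[of 0 _ 0] l(4) by (auto simp: P0 Q0 cF cG)
      qed
      ultimately show ?thesis by simp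
    qed
    then show "p = 0" by (intro poly_eqI) (simp add: fun_eq_iff)
  qed
  then show ?thesis
  proof (rule cohen_macaulayI)
    interpret C: function_algebra "adjoin constants (insert (cg w) V)" by (rule function_algebra_adjoin_constants)
    show "cf j \<in> adjoin constants (insert (cg w) V)" for j
      by (rule cf_mem) (auto simp: V_def s m_def)
    show "cg j \<in> adjoin constants (insert (cg w) V)" for j
    proof -
      consider "j < w" | "w = j" | "w < j" "j < n" | "n \<le> j" by linarith
      then show ?thesis
      proof cases
        case 1
        have "cg j z = 0" for z by (rule decomp[of z]) (use 1 in simp)
        then have "cg j = 0" by (simp add: fun_eq_iff)
        then show ?thesis by simp
      next
        case 2
        then show ?thesis by (intro adjoin.base) simp
      next
        case 3
        have "cg (w + (j - w)) \<in> (\<lambda>j. cg (w + j)) ` {1..<l}"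
          by (rule image_eqI[of _ _ "j - w"]) (use 3 in \<open>auto simp: l_def\<close>)
        then have "cg j \<in> V" using 3 by (simp add: V_def)
        then show ?thesis by (intro adjoin.base) blast
      next
        case 4
        have "cg j z = 0" for z unfolding cg_def using proj_props(3)[of z] 4 by (intro coeff_eq_0) simp
        then have "cg j = 0" by (simp add: fun_eq_iff)
        then show ?thesis by simp
      qed
    qed
    show "\<exists>\<phi>\<in>regular_functions (basis_U n). v = (\<lambda>z. \<phi> (point z))" if "v \<in> insert (cg w) V" for v
      using that cf_regular cg_regular unfolding V_def by blast
  qed
qed

end

lemma cohen_macaulay_subvariety:
  assumes n: "n = s + d + t" "1 \<le> n" and st: "s = 0 \<or> s = 1 \<or> t = 0"
    and i: "i = Plus1 \<Longrightarrow> u \<noteq> 1" and dw: "y_exponents u i = (d, w)"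
  shows "cohen_macaulay n (subvariety n s u t i :: 'a::alg_closed_field poly poly set set)"
proof -
  have w: "w \<le> d" "d \<le> Suc w" using dw by (cases i; auto split: if_splits)+
  \<comment> \<open>The pair \<open>(y^n, 0)\<close> belongs to \<open>pairs\<close> for all
    exponents; it shows that the set is nonempty and serves as the default point.\<close>
  have "(monom 1 d * ([:0, 1 :: 'a:] ^ s * [:0, 1:] ^ t), monom 1 w * ([:0, 1:] ^ s * 0)) \<in> pairs n s d w"
    by (rule pairsI[OF linear_power_monic linear_power_monic _ n(1) w(1) n(2)]) simp
  then interpret pair_coordinates n s d w t "(monom 1 d * ([:0, 1 :: 'a:] ^ s * [:0, 1:] ^ t), monom 1 w * ([:0, 1:] ^ s * 0))"
    by unfold_locales (use n w in auto)
  have "subvariety n s u t i = (\<lambda>(f, g). graph_ideal f g) ` (pairs n s d w :: ('a poly \<times> 'a poly) set)"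
    using assms by (intro subvariety_eq)
  then show ?thesis
    using st cohen_macaulay_s_0 cohen_macaulay_s_1 cohen_macaulay_t_0 by auto
qed

theorem corollary2p3p18:
  fixes n :: nat
    and Y :: "'a::alg_closed_field poly poly set set"
  assumes "CHAR('a) > 2"
    and "n \<ge> 1"
    and "Y \<in> {subvariety n s u 0 Plus0 |s u. s + u = n}
           \<union> {subvariety n s u 0 Plus1 |s u. u \<ge> 2 \<and> s + u = n}
           \<union> {subvariety n (n - 1) 0 0 Plus1}
       \<or> Y \<in> {subvariety n 0 0 n Plus0}
           \<union> {subvariety n 0 0 (n - 1) Plus1}
       \<or> Y \<in> {subvariety n 0 u t Plus0 |u t. u \<ge> 1 \<and> u + t = n}
           \<union> {subvariety n 0 u t Plus1 |u t. u \<ge> 2 \<and> u + t = n}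
       \<or> Y \<in> {subvariety n 1 u t Plus0 |u t. 1 + u + t = n}
           \<union> {subvariety n 1 u t Plus1 |u t. u \<ge> 2 \<and> 1 + u + t = n}
           \<union> {subvariety n 1 0 t Plus1 |t. 1 + t + 1 = n}"
  shows "cohen_macaulay n Y"
proof -
  \<comment> \<open>For \<open>+1\<close> with \<open>u = 0\<close> the value \<open>d = 1\<close>
    accounts for the extra point on \<open>y = 0\<close>, so \<open>n = s + d + t\<close> holds for
    every label.\<close>
  note cm = cohen_macaulay_subvariety[where 'a = 'a, OF _ assms(2)]
  show ?thesis
    using assms(3)
  proof (elim disjE UnE)
    assume "Y \<in> {subvariety n s u 0 Plus0 |s u. s + u = n}"
    then obtain s u where Y: "Y = subvariety n s u 0 Plus0" "s + u = n" by blast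
    then show ?thesis unfolding Y(1) by (intro cm[where d = "u" and w = "u"]) auto
  next
    assume "Y \<in> {subvariety n s u 0 Plus1 |s u. u \<ge> 2 \<and> s + u = n}"
    then obtain s u where Y: "Y = subvariety n s u 0 Plus1" "u \<ge> 2 \<and> s + u = n" by blast
    then show ?thesis unfolding Y(1) by (intro cm[where d = "u" and w = "u - 1"]) auto
  next
    assume "Y \<in> {subvariety n (n - 1) 0 0 Plus1}"
    then have Y: "Y = subvariety n (n - 1) 0 0 Plus1" by simp
    show ?thesis unfolding Y using assms(2) by (intro cm[where d = "1" and w = "0"]) auto
  next
    assume "Y \<in> {subvariety n 0 0 n Plus0}"
    then have Y: "Y = subvariety n 0 0 n Plus0" by simp
    show ?thesis unfolding Y using assms(2) by (intro cm[where d = "0" and w = "0"]) auto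
  next
    assume "Y \<in> {subvariety n 0 0 (n - 1) Plus1}"
    then have Y: "Y = subvariety n 0 0 (n - 1) Plus1" by simp
    show ?thesis unfolding Y using assms(2) by (intro cm[where d = "1" and w = "0"]) auto
  next
    assume "Y \<in> {subvariety n 0 u t Plus0 |u t. u \<ge> 1 \<and> u + t = n}"
    then obtain u t where Y: "Y = subvariety n 0 u t Plus0" "u \<ge> 1 \<and> u + t = n" by blast
    then show ?thesis unfolding Y(1) by (intro cm[where d = "u" and w = "u"]) auto
  next
    assume "Y \<in> {subvariety n 0 u t Plus1 |u t. u \<ge> 2 \<and> u + t = n}"
    then obtain u t where Y: "Y = subvariety n 0 u t Plus1" "u \<ge> 2 \<and> u + t = n" by blast
    then show ?thesis unfolding Y(1) by (intro cm[where d = "u" and w = "u - 1"]) auto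
  next
    assume "Y \<in> {subvariety n 1 u t Plus0 |u t. 1 + u + t = n}"
    then obtain u t where Y: "Y = subvariety n 1 u t Plus0" "1 + u + t = n" by blast
    then show ?thesis unfolding Y(1) by (intro cm[where d = "u" and w = "u"]) auto
  next
    assume "Y \<in> {subvariety n 1 u t Plus1 |u t. u \<ge> 2 \<and> 1 + u + t = n}"
    then obtain u t where Y: "Y = subvariety n 1 u t Plus1" "u \<ge> 2 \<and> 1 + u + t = n" by blast
    then show ?thesis unfolding Y(1) by (intro cm[where d = "u" and w = "u - 1"]) auto
  next
    assume "Y \<in> {subvariety n 1 0 t Plus1 |t. 1 + t + 1 = n}"
    then obtain t where Y: "Y = subvariety n 1 0 t Plus1" "1 + t + 1 = n" by blast
    then show ?thesis unfolding Y(1) by (intro cm[where d = "1" and w = "0"]) auto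
  qed
qed

end
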